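(* Let $H\in(\frac12,1)$, let $x_0\in\mathbb{R}^m$, and let $g:[0,1]\to\mathbb{R}^d$ be such that $g\in C^{H-\varepsilon}([0,1]:\mathbb{R}^d)$ for any $0<\varepsilon<H$. Suppose that the coefficients $b$ and $\sigma$ satisfy conditions (i) and (ii) given in the context. Consider the deterministic equation on $\mathbb{R}^m$ $$x_t=x_0+\int_0^tb(s,x_s)\,ds+\int_0^t\sigma(s,x_s)\,dg_s,\qquad t\in[0,1],\qquad(\ast)$$ where the last integral is interpreted as a Riemann–Stieltjes integral. Then the following hold. (a) Equation $(\ast)$ has a unique solution $x\in W_0^{\alpha,\infty}([0,1]:\mathbb{R}^m)$ for any $\alpha\in(1-H,\min\{\frac12,\lambda,\frac{\gamma}{1+\gamma}\})$. Moreover, the solution is $(1-\alpha)$-Hölder continuous. (b) For any $\alpha\in(1-H,\min\{\frac12,\lambda,\frac{\gamma}{1+\gamma}\})$ and any $0<\delta<\alpha-(1-H)$, the following estimates hold: $$\Vert x\Vert_\infty\le C_1(1+|x_0|)\exp\{C_2\Vert g\Vert_{1-\alpha+\delta}^\kappa\},$$ $$\Vert x\Vert_{1-\alpha}\le C_3(1+|x_0|)(1+\Vert g\Vert_{1-\alpha+\delta}^\kappa)(1+\Vert g\Vert_{1-\alpha+\delta})(1+\exp\{C_2\Vert g\Vert_{1-\alpha+\delta}^\kappa\}),$$ where $\kappa=\frac{1}{1-\alpha}$ and the constants $C_1$, $C_2$ and $C_3$ depend on $\alpha$, $\delta$ and all the constants appearing in conditions (i) and (ii).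
   Context: Norms and spaces: $\Vert f\Vert_\infty=\sup_{0\le r\le1}|f(r)|$ and, for $\mu\in(0,1)$, $\Vert f\Vert_\mu=\sup_{0\le\theta<r\le1}\frac{|f(r)-f(\theta)|}{|r-\theta|^\mu}$; $C^\mu([0,1]:\mathbb{R}^d)$ is the space of $\mathbb{R}^d$-valued $\mu$-Hölder continuous functions on $[0,1]$. For $0<\alpha<1$, $W_0^{\alpha,\infty}([0,1]:\mathbb{R}^m)$ is the space of measurable $f:[0,1]\to\mathbb{R}^m$ with $\sup_{0\le t\le1}\left\{|f(t)|+\int_0^t\frac{|f(t)-f(s)|}{(t-s)^{\alpha+1}}ds\right\}<\infty$. For a matrix $A=(a^{i,j})_{m\times d}$ and a vector $y=(y^i)_{m\times1}$, $|A|^2=\sum_{i,j}|a^{i,j}|^2$ and $|y|^2=\sum_i|y^i|^2$. Conditions on the coefficients $b:[0,1]\times\mathbb{R}^m\to\mathbb{R}^m$ and $\sigma:[0,1]\times\mathbb{R}^m\to\mathbb{R}^{m\times d}$: (i) The function $\sigma$ is differentiable in the space variable $x\in\mathbb{R}^m$, and there exist constants $M>0$, $1-H<\lambda\le1$, $\frac1H-1<\gamma\le1$, and for every $N>0$ there exists $M_N>0$, such that the following hold for each $i=1,\dots,m$: $|\sigma(t,x)-\sigma(t,y)|\le M|x-y|$ for all $t\in[0,1]$ and $x,y\in\mathbb{R}^m$; $|\partial_{x_i}\sigma(t,x)-\partial_{y_i}\sigma(t,y)|\le M_N|x-y|^\gamma$ for all $t\in[0,1]$ and $x,y\in\mathbb{R}^m$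 such that $|x|\vee|y|\le N$; $|\sigma(t,x)-\sigma(s,x)|+|\partial_{x_i}\sigma(t,x)-\partial_{x_i}\sigma(s,x)|\le M|t-s|^\lambda$ for all $x\in\mathbb{R}^m$ and $t,s\in[0,1]$. (ii) There exists $L>0$ such that $|b(t,x)-b(t,y)|\le L|x-y|$ and $|b(t,x)|\le L(1+|x|)$ for all $x,y\in\mathbb{R}^m$ and $t\in[0,1]$.
   Formalization: C1, C2, C3 may also depend on a bound for |σ(0,0)| (for b=0, σ a constant matrix A and g_t=te₁ the solution is unbounded in A, so the claim fails otherwise), and b(·,x) is assumed measurable in time for each x, without which the drift integral may be undefined. *)

theory Defs
  imports "HOL-Analysis.Analysis"
begin

text \<open>
  Functions on $[0,1]$ are total functions on the reals of which only the values on
  \<^term>\<open>{0..1::real}\<close> are ever used. An $m \times d$ matrix has type \<open>real^'d^'m\<close>; its \<^const>\<open>norm\<close>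
  is the Euclidean norm of all its entries.
\<close>

definition sup_norm :: "(real \<Rightarrow> 'a::real_normed_vector) \<Rightarrow> real" where
  "sup_norm f = (SUP r\<in>{0..1}. norm (f r))"

text \<open>
  A real-valued supremum, hence meaningful only for \<open>f\<close> satisfying \<open>holder_continuous \<mu> f\<close> below.
\<close>

definition holder_norm :: "real \<Rightarrow> (real \<Rightarrow> 'a::real_normed_vector) \<Rightarrow> real" where
  "holder_norm \<mu> f =
     (SUP (\<theta>, r)\<in>{(\<theta>, r). 0 \<le> \<theta> \<and> \<theta> < r \<and> r \<le> 1}. norm (f r - f \<theta>) / \<bar>r - \<theta>\<bar> powr \<mu>)"

definition holder_continuous :: "real \<Rightarrow> (real \<Rightarrow> 'a::real_normed_vector) \<Rightarrow> bool" where
  "holder_continuous \<mu> f \<longleftrightarrow>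
     (\<exists>C. \<forall>s\<in>{0..1}. \<forall>t\<in>{0..1}. norm (f t - f s) \<le> C * \<bar>t - s\<bar> powr \<mu>)"

text \<open>
  The space $W_0^{\alpha,\infty}$. The integral may be infinite, so it is taken in
  \<^typ>\<open>ennreal\<close>; the integrand is $0$ at the endpoint $s = t$ by the convention $x / 0 = 0$.
\<close>

definition W0 :: "real \<Rightarrow> (real \<Rightarrow> 'a::euclidean_space) set" where
  "W0 \<alpha> = {f. f \<in> borel_measurable (lebesgue_on {0..1}) \<and>
     (SUP t\<in>{0..1}. ennreal (norm (f t)) +
        (\<integral>\<^sup>+s\<in>{0..t}. ennreal (norm (f t - f s) / (t - s) powr (\<alpha> + 1)) \<partial>lebesgue)) < \<infinity>}"

text \<open>
  Riemann--Stieltjes integral $\int_a^b F\,dg$ of a matrix-valued \<open>F\<close> against a vector-valued \<open>g\<close>: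
  the limit of the sums over tagged partitions, with arbitrary tags, as the mesh tends to $0$.
\<close>

definition has_RS_integral ::
    "(real \<Rightarrow> real^'d^'m) \<Rightarrow> (real \<Rightarrow> real^'d) \<Rightarrow> real^'m \<Rightarrow> real \<Rightarrow> real \<Rightarrow> bool" where
  "has_RS_integral F g I a b \<longleftrightarrow>
     (\<forall>e>0. \<exists>\<eta>>0. \<forall>p. p tagged_division_of {a..b} \<and> (\<forall>(\<xi>, K)\<in>p. Sup K - Inf K < \<eta>) \<longrightarrow>
        norm ((\<Sum>(\<xi>, K)\<in>p. F \<xi> *v (g (Sup K) - g (Inf K))) - I) < e)"

definition partial_deriv :: "'m \<Rightarrow> (real^'m \<Rightarrow> 'a::real_normed_vector) \<Rightarrow> real^'m \<Rightarrow> 'a" where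
  "partial_deriv i f x = vector_derivative (\<lambda>h. f (x + h *\<^sub>R axis i 1)) (at 0)"

text \<open>
  These conditions bound the increments of \<open>\<sigma>\<close> but not its size: a constant \<open>\<sigma>\<close> satisfies them
  with the same constants however large it is. Hence the constants in the a priori estimates for
  the equation must also be allowed to depend on a bound for \<open>norm (\<sigma> 0 0)\<close>.
\<close>

definition sigma_condition ::
    "real \<Rightarrow> real \<Rightarrow> (real \<Rightarrow> real) \<Rightarrow> real \<Rightarrow> real \<Rightarrow> (real \<Rightarrow> real^'m \<Rightarrow> real^'d^'m) \<Rightarrow> bool" where
  "sigma_condition H M MN lam gam \<sigma> \<longleftrightarrow>
     M > 0 \<and> 1 - H < lam \<and> lam \<le> 1 \<and> 1 / H - 1 < gam \<and> gam \<le> 1 \<and> (\<forall>N>0. MN N > 0) \<and>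
     (\<forall>t\<in>{0..1}. \<forall>x. \<sigma> t differentiable (at x)) \<and>
     (\<forall>t\<in>{0..1}. \<forall>x y. norm (\<sigma> t x - \<sigma> t y) \<le> M * norm (x - y)) \<and>
     (\<forall>N>0. \<forall>i. \<forall>t\<in>{0..1}. \<forall>x y. max (norm x) (norm y) \<le> N \<longrightarrow>
        norm (partial_deriv i (\<sigma> t) x - partial_deriv i (\<sigma> t) y) \<le> MN N * norm (x - y) powr gam) \<and>
     (\<forall>i. \<forall>x. \<forall>t\<in>{0..1}. \<forall>s\<in>{0..1}.
        norm (\<sigma> t x - \<sigma> s x) + norm (partial_deriv i (\<sigma> t) x - partial_deriv i (\<sigma> s) x)
          \<le> M * \<bar>t - s\<bar> powr lam)"

text \<open>
  Measurability of \<open>b\<close> in time is implicit in writing $\int_0^t b(s,x_s)\,ds$. Together with the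
  Lipschitz bound, measurability of each \<open>b(\<cdot>, x)\<close> is all that is needed.
\<close>

definition b_condition :: "real \<Rightarrow> (real \<Rightarrow> real^'m \<Rightarrow> real^'m) \<Rightarrow> bool" where
  "b_condition L b \<longleftrightarrow>
     L > 0 \<and>
     (\<forall>x. (\<lambda>t. b t x) \<in> borel_measurable (lebesgue_on {0..1})) \<and>
     (\<forall>t\<in>{0..1}. \<forall>x y. norm (b t x - b t y) \<le> L * norm (x - y)) \<and>
     (\<forall>t\<in>{0..1}. \<forall>x. norm (b t x) \<le> L * (1 + norm x))"

definition is_solution ::
    "(real \<Rightarrow> real^'m \<Rightarrow> real^'m) \<Rightarrow> (real \<Rightarrow> real^'m \<Rightarrow> real^'d^'m) \<Rightarrow> (real \<Rightarrow> real^'d) \<Rightarrow> real^'m \<Rightarrow>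
     (real \<Rightarrow> real^'m) \<Rightarrow> bool" where
  "is_solution b \<sigma> g x\<^sub>0 x \<longleftrightarrow>
     (\<forall>t\<in>{0..1}. set_integrable lebesgue {0..t} (\<lambda>s. b s (x s)) \<and>
        (\<exists>J. has_RS_integral (\<lambda>s. \<sigma> s (x s)) g J 0 t \<and>
             x t = x\<^sub>0 + (LINT s:{0..t}|lebesgue. b s (x s)) + J))"

end

theory Submission
  imports Defs
begin

text \<open>
  The equation is treated pathwise with Young's integral. Everything rests on one mechanism, the
  \<^emph>\<open>sewing lemma\<close>: if $|\Xi(u,w) - \Xi(u,v) - \Xi(v,w)| \le K (w-u)^\theta$ with $\theta > 1$, then
  there is a path whose increments agree with $\Xi$ up to $C_\theta K (v-u)^\theta$
  (\<open>sewing_exists\<close>, \<open>sewing_bound\<close>). For $\Xi(u,v) = F_v (g_v - g_u)$ with $F$ and $g$ Hoelder of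
  exponents adding up to $\theta > 1$ this path is the Riemann--Stieltjes integral, because the
  increments of a path telescope over every tagged division
  (\<open>has_RS_integral_path_increment\<close>, \<open>has_RS_integral_eq_path_increment\<close>). Hence a Hoelder path
  $x$ solves the equation if and only if
  \[ \Bigl| x_v - x_u - \int_u^v b(s,x_s)\,ds - \sigma(v,x_v)(g_v-g_u) \Bigr| \le C (v-u)^\theta
     \quad\mbox{for all } u \le v \]
  with some $C$ (\<open>davie_solution\<close>). In this form nothing but inequalities for increments remains,
  solutions can be restricted and concatenated, and the unspecified $C$ is always improved to an
  explicit one by \<open>sewing_bound\<close>.

  The four ingredients are the following.

  \<^item> A function in $W_0^{\alpha,\infty}$ is $\alpha$-Hoelder on $(0,1]$
    (\<open>W0_imp_holder_right_of_0\<close>). Since $g$ is Hoelder of exponent $1-\alpha+\delta$, the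
    sewing lemma applies to $\sigma(\cdot,x)$ at once and shows that every solution in $W_0^{\alpha,\infty}$ is $(1-\alpha)$-Hoelder on $[0,1]$ (\<open>W0_solution_holder\<close>).

  \<^item> The map that sends $x$ to the right-hand side of the equation contracts differences in the
    $\nu$-Hoelder seminorm on short intervals, where $\nu = \min(\lambda, \gamma(1-\alpha)) > \alpha$
    (\<open>difference_estimate\<close>). This gives uniqueness (\<open>davie_solution_unique\<close>) and, by Picard
    iteration, local existence (\<open>local_solution_exists\<close>). The length of the intervals depends on a
    bound for the initial value, since $\partial\sigma$ is only locally Hoelder and the coefficients may
    grow linearly.

  \<^item> On an interval of length of order $(1+G^{1/(1-\alpha)})^{-1}$, $G$ being the Hoelder constant of $g$,
    the seminorm of a solution is bounded by itself with a factor $1/2$ plus a multiple of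
    $1 + |x_a|$ (\<open>apriori_local\<close>). So $1+|x|$ at most doubles over each such interval; counting the
    intervals gives the exponential bounds (\<open>apriori_sup\<close>, \<open>apriori_holder\<close>).

  \<^item> The a priori bound makes the length of the intervals of local existence uniform, so that
    finitely many local solutions, concatenated, cover $[0,1]$ (\<open>davie_solution_exists\<close>).
\<close>

section \<open>Hoelder functions and self-improving bounds\<close>

text \<open>
  Iterating $C \mapsto A + qC$ from any admissible constant converges to its fixed point. Thus an
  estimate known with an uncontrolled constant improves to one with an explicit constant. The
  sewing bound, uniqueness and the a priori bound all arise in this way.
\<close>

lemma self_improving_bound:
  fixes f w :: "'i \<Rightarrow> real"
  assumes init: "0 \<le> B" "\<And>i. i \<in> I \<Longrightarrow> f i \<le> B * w i"
    and step: "\<And>C i. 0 \<le> C \<Longrightarrow> (\<And>j. j \<in> I \<Longrightarrow> f j \<le> C * w j) \<Longrightarrow> i \<in> I \<Longrightarrow> f i \<le> (A + q * C) * w i"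
    and q: "0 \<le> A" "0 \<le> q" "q < 1"
    and i: "i \<in> I"
  shows "f i \<le> A / (1 - q) * w i"
proof -
  define r where "r = A / (1 - q)"
  define c where "c n = r + q ^ n * (B - r)" for n :: nat
  have A: "A = r * (1 - q)" using q(3) by (simp add: r_def)
  have c_Suc: "c (Suc n) = A + q * c n" for n
    by (simp add: c_def A algebra_simps)
  have c: "0 \<le> c n \<and> (\<forall>i\<in>I. f i \<le> c n * w i)" for n
  proof (induction n)
    case 0
    then show ?case using init by (simp add: c_def)
  next
    case (Suc n)
    then show ?case using step[of "c n"] q by (auto simp: c_Suc)
  qed
  have "(\<lambda>n. c n * w i) \<longlonglongrightarrow> (r + 0 * (B - r)) * w i"
    unfolding c_def using q by (intro tendsto_intros LIMSEQ_power_zero) auto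
  moreover have "\<forall>n\<ge>0. f i \<le> c n * w i" using c i by blast
  ultimately show ?thesis unfolding r_def by (intro LIMSEQ_le_const) auto
qed

text \<open>
  On an interval of length $h$, spare Hoelder exponent is traded for a small factor. This is where
  every gain from short time steps comes from.
\<close>

lemma powr_le_scaled:
  fixes d :: real
  assumes "0 \<le> d" "d \<le> h" "p \<le> q"
  shows "d powr q \<le> h powr (q - p) * d powr p"
proof -
  have "d powr q = d powr (q - p) * d powr p" by (simp flip: powr_add)
  also have "\<dots> \<le> h powr (q - p) * d powr p"
    using assms by (intro mult_right_mono powr_mono2) auto
  finally show ?thesis .
qed

definition holder_on :: "real \<Rightarrow> real \<Rightarrow> real \<Rightarrow> real \<Rightarrow> (real \<Rightarrow> 'a::real_normed_vector) \<Rightarrow> bool" where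
  "holder_on a c R p x \<longleftrightarrow>
     (\<forall>u v. a \<le> u \<longrightarrow> u \<le> v \<longrightarrow> v \<le> c \<longrightarrow> norm (x v - x u) \<le> R * (v - u) powr p)"

lemma holder_onD:
  "holder_on a c R p x \<Longrightarrow> a \<le> u \<Longrightarrow> u \<le> v \<Longrightarrow> v \<le> c \<Longrightarrow> norm (x v - x u) \<le> R * (v - u) powr p"
  unfolding holder_on_def by blast

lemma holder_onI:
  "(\<And>u v. a \<le> u \<Longrightarrow> u \<le> v \<Longrightarrow> v \<le> c \<Longrightarrow> norm (x v - x u) \<le> R * (v - u) powr p) \<Longrightarrow> holder_on a c R p x"
  unfolding holder_on_def by blast

lemma holder_on_subinterval: "holder_on a c R p x \<Longrightarrow> a \<le> a' \<Longrightarrow> c' \<le> c \<Longrightarrow> holder_on a' c' R p x"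
  unfolding holder_on_def by auto

lemma holder_on_mono: "holder_on a c R p x \<Longrightarrow> R \<le> R' \<Longrightarrow> holder_on a c R' p x"
  unfolding holder_on_def by (meson mult_right_mono order_trans powr_ge_zero)

lemma holder_on_lower_exponent:
  assumes x: "holder_on a c R p x" and "0 \<le> R" "c - a \<le> h" "q \<le> p"
  shows "holder_on a c (R * h powr (p - q)) q x"
proof (rule holder_onI)
  fix u v assume uv: "a \<le> u" "u \<le> v" "v \<le> c"
  have "R * (v - u) powr p \<le> R * (h powr (p - q) * (v - u) powr q)"
    using assms uv by (intro mult_left_mono powr_le_scaled) auto
  with holder_onD[OF x uv] show "norm (x v - x u) \<le> R * h powr (p - q) * (v - u) powr q"
    by (simp add: mult.assoc)
qed

lemma holder_on_sym:
  assumes "holder_on a c R p x" "s \<in> {a..c}" "t \<in> {a..c}"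
  shows "norm (x t - x s) \<le> R * \<bar>t - s\<bar> powr p"
  using holder_onD[OF assms(1), of s t] holder_onD[OF assms(1), of t s] assms(2,3)
  by (cases "s \<le> t") (auto simp: norm_minus_commute)

lemma holder_on_imp_continuous_on:
  assumes "holder_on a c R p x" "0 < p"
  shows "continuous_on {a..c} x"
  unfolding continuous_on_def
proof
  fix t assume t: "t \<in> {a..c}"
  have "((\<lambda>s. R * \<bar>s - t\<bar> powr p) \<longlongrightarrow> R * \<bar>t - t\<bar> powr p) (at t within {a..c})"
    using \<open>0 < p\<close> by (intro tendsto_mult tendsto_const tendsto_powr' tendsto_rabs tendsto_diff tendsto_ident_at) auto
  then have lim: "((\<lambda>s. R * \<bar>s - t\<bar> powr p) \<longlongrightarrow> 0) (at t within {a..c})" by simp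
  have "\<forall>\<^sub>F s in at t within {a..c}. norm (x s - x t) \<le> R * \<bar>s - t\<bar> powr p"
    using holder_on_sym[OF assms(1) t] by (auto simp: eventually_at_filter)
  then have "((\<lambda>s. x s - x t) \<longlongrightarrow> 0) (at t within {a..c})"
    using lim by (rule Lim_null_comparison)
  then show "(x \<longlongrightarrow> x t) (at t within {a..c})" by (rule LIM_zero_cancel)
qed

lemma holder_on_lower_exponent_unit:
  assumes "holder_on a c R p x" "0 \<le> R" "c - a \<le> 1" "q \<le> p"
  shows "holder_on a c R q x"
  using holder_on_lower_exponent[OF assms] by simp

lemma holder_on_diff:
  assumes x: "holder_on a c R p x" and y: "holder_on a c R' p y"
  shows "holder_on a c (R + R') p (\<lambda>s. x s - y s)"
proof (rule holder_onI)
  fix u v assume uv: "a \<le> u" "u \<le> v" "v \<le> c"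
  have "(x v - y v) - (x u - y u) = (x v - x u) - (y v - y u)" by simp
  also have "norm \<dots> \<le> R * (v - u) powr p + R' * (v - u) powr p"
    by (intro order_trans[OF norm_triangle_ineq4] add_mono holder_onD[OF x] holder_onD[OF y] uv)
  finally show "norm ((x v - y v) - (x u - y u)) \<le> (R + R') * (v - u) powr p" by (simp add: distrib_right)
qed

lemma holder_on_self_improving:
  assumes start: "holder_on a c B p x" "0 \<le> B"
    and step: "\<And>C. 0 \<le> C \<Longrightarrow> holder_on a c C p x \<Longrightarrow> holder_on a c (A + q * C) p x"
    and q: "0 \<le> A" "0 \<le> q" "q < 1"
  shows "holder_on a c (A / (1 - q)) p x"
proof -
  let ?I = "{(u, v). a \<le> u \<and> u \<le> v \<and> v \<le> c}"
  let ?f = "\<lambda>(u, v). norm (x v - x u)"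
  let ?w = "\<lambda>(u, v). (v - u) powr p"
  have iff: "holder_on a c C p x \<longleftrightarrow> (\<forall>i\<in>?I. ?f i \<le> C * ?w i)" for C
    unfolding holder_on_def by auto
  have "?f i \<le> A / (1 - q) * ?w i" if "i \<in> ?I" for i
  proof (rule self_improving_bound[where I = ?I and B = B])
    show "?f j \<le> B * ?w j" if "j \<in> ?I" for j using start that unfolding iff by blast
    fix C j assume "0 \<le> C" "\<And>j. j \<in> ?I \<Longrightarrow> ?f j \<le> C * ?w j" "j \<in> ?I"
    then show "?f j \<le> (A + q * C) * ?w j" using step[of C] unfolding iff by blast
  qed (use that start q in auto)
  then show ?thesis unfolding iff by blast
qed

lemma holder_on_holder_norm:
  assumes "holder_continuous p f"
  shows "0 \<le> holder_norm p f" "holder_on 0 1 (holder_norm p f) p f"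
proof -
  let ?S = "{(u, v). 0 \<le> u \<and> u < v \<and> v \<le> (1::real)}"
  let ?q = "\<lambda>(u, v). norm (f v - f u) / \<bar>v - u\<bar> powr p"
  obtain C where C: "\<forall>u\<in>{0..1}. \<forall>v\<in>{0..1}. norm (f v - f u) \<le> C * \<bar>v - u\<bar> powr p"
    using assms unfolding holder_continuous_def ..
  have bdd: "bdd_above (?q ` ?S)"
  proof (rule bdd_aboveI2)
    fix i assume "i \<in> ?S"
    then obtain u v where "i = (u, v)" "0 \<le> u" "u < v" "v \<le> 1" by auto
    then show "?q i \<le> C" using C[rule_format, of u v] by (simp add: divide_le_eq)
  qed
  have le: "norm (f v - f u) / \<bar>v - u\<bar> powr p \<le> holder_norm p f" if "0 \<le> u" "u < v" "v \<le> 1" for u v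
    using cSUP_upper[OF _ bdd, of "(u, v)"] that unfolding holder_norm_def by simp
  have "0 \<le> norm (f 1 - f 0) / \<bar>1 - 0\<bar> powr p" by simp
  also have "\<dots> \<le> holder_norm p f" by (rule le) auto
  finally show "0 \<le> holder_norm p f" .
  show "holder_on 0 1 (holder_norm p f) p f"
  proof (rule holder_onI)
    fix u v :: real assume uv: "0 \<le> u" "u \<le> v" "v \<le> 1"
    show "norm (f v - f u) \<le> holder_norm p f * (v - u) powr p"
      using le[of u v] uv by (cases "u = v") (auto simp: divide_le_eq)
  qed
qed

lemma holder_norm_leI:
  assumes "holder_on 0 1 R p f"
  shows "holder_norm p f \<le> R"
  unfolding holder_norm_def
proof (rule cSUP_least)
  have "(0, 1) \<in> {(u, v). 0 \<le> u \<and> u < v \<and> v \<le> (1::real)}" by simp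
  then show "{(u, v). 0 \<le> u \<and> u < v \<and> v \<le> (1::real)} \<noteq> {}" by blast
  fix i assume "i \<in> {(u, v). 0 \<le> u \<and> u < v \<and> v \<le> (1::real)}"
  then obtain u v where "i = (u, v)" "0 \<le> u" "u < v" "v \<le> 1" by auto
  then show "(case i of (u, v) \<Rightarrow> norm (f v - f u) / \<bar>v - u\<bar> powr p) \<le> R"
    using holder_onD[OF assms, of u v] by (simp add: divide_le_eq)
qed

section \<open>The sewing lemma\<close>

text \<open>
  $\Xi(u,v)$ stands for a first approximation to an integral over $[u,v]$.
\<close>

definition almost_additive ::
    "real \<Rightarrow> real \<Rightarrow> real \<Rightarrow> real \<Rightarrow> (real \<Rightarrow> real \<Rightarrow> 'a::real_normed_vector) \<Rightarrow> bool" where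
  "almost_additive a b K \<theta> \<Xi> \<longleftrightarrow>
     (\<forall>u\<in>{a..b}. \<Xi> u u = 0) \<and>
     (\<forall>u v w. a \<le> u \<and> u \<le> v \<and> v \<le> w \<and> w \<le> b \<longrightarrow>
        norm (\<Xi> u w - \<Xi> u v - \<Xi> v w) \<le> K * (w - u) powr \<theta>)"

lemma almost_additiveD:
  assumes "almost_additive a b K \<theta> \<Xi>"
  shows "u \<in> {a..b} \<Longrightarrow> \<Xi> u u = 0"
    and "\<lbrakk>a \<le> u; u \<le> v; v \<le> w; w \<le> b\<rbrakk> \<Longrightarrow> norm (\<Xi> u w - \<Xi> u v - \<Xi> v w) \<le> K * (w - u) powr \<theta>"
  using assms unfolding almost_additive_def by auto

text \<open>
  The sum of the geometric series with ratio $2^{1-\theta}$, the factor by which the defect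
  $2 (d/2)^\theta$ of two halves is smaller than the defect $d^\theta$ of the whole.
\<close>

definition sewing_const :: "real \<Rightarrow> real" where
  "sewing_const \<theta> = 1 / (1 - 2 powr (1 - \<theta>))"

lemma sewing_const_pos: "1 < \<theta> \<Longrightarrow> 0 < sewing_const \<theta>"
  unfolding sewing_const_def using powr_less_mono[of "1-\<theta>" 0 "2::real"] by simp

lemma half_powr: "0 \<le> d \<Longrightarrow> 2 * (d / 2) powr \<theta> = 2 powr (1 - \<theta>) * d powr \<theta>" for d :: real
  by (simp add: powr_divide powr_diff)

text \<open>
  Comparing both sides at the midpoint turns the constant $C$ into $K + 2^{1-\theta} C$, so the bound
  improves itself to one that depends on the defect of $\Xi$ only.
\<close>

lemma sewing_bound:
  fixes Y :: "real \<Rightarrow> 'a::real_normed_vector"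
  assumes \<Xi>: "almost_additive a b K \<theta> \<Xi>" and "1 < \<theta>" "0 \<le> K"
    and Y: "\<And>u v. a \<le> u \<Longrightarrow> u \<le> v \<Longrightarrow> v \<le> b \<Longrightarrow> norm (Y v - Y u - \<Xi> u v) \<le> C * (v - u) powr \<theta>"
    and uv: "a \<le> u" "u \<le> v" "v \<le> b"
  shows "norm (Y v - Y u - \<Xi> u v) \<le> sewing_const \<theta> * K * (v - u) powr \<theta>"
proof -
  let ?q = "2 powr (1 - \<theta>) :: real"
  let ?I = "{(u, v). a \<le> u \<and> u \<le> v \<and> v \<le> b}"
  let ?f = "\<lambda>(u, v). norm (Y v - Y u - \<Xi> u v)"
  let ?w = "\<lambda>(u, v). (v - u) powr \<theta>"
  have "?f (u, v) \<le> K / (1 - ?q) * ?w (u, v)"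
  proof (rule self_improving_bound[where I = ?I and B = "max C 0"])
    fix p assume "p \<in> ?I"
    then obtain u v where p: "p = (u, v)" "a \<le> u" "u \<le> v" "v \<le> b" by auto
    have "C * (v - u) powr \<theta> \<le> max C 0 * (v - u) powr \<theta>" by (intro mult_right_mono) auto
    then show "?f p \<le> max C 0 * ?w p" using Y[OF p(2-4)] unfolding p by simp
  next
    fix C' p assume C': "0 \<le> C'" "\<And>p. p \<in> ?I \<Longrightarrow> ?f p \<le> C' * ?w p" and "p \<in> ?I"
    then obtain u v where p: "p = (u, v)" "a \<le> u" "u \<le> v" "v \<le> b" by auto
    define m where "m = (u + v) / 2"
    have m: "u \<le> m" "m \<le> v" "m - u = (v - u) / 2" "v - m = (v - u) / 2"
      using p by (auto simp: m_def field_simps)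
    have "Y v - Y u - \<Xi> u v
        = (Y m - Y u - \<Xi> u m) + (Y v - Y m - \<Xi> m v) - (\<Xi> u v - \<Xi> u m - \<Xi> m v)"
      by simp
    also have "norm \<dots> \<le> norm (Y m - Y u - \<Xi> u m) + norm (Y v - Y m - \<Xi> m v)
        + norm (\<Xi> u v - \<Xi> u m - \<Xi> m v)"
      by (meson add_mono_thms_linordered_semiring(3) norm_triangle_ineq norm_triangle_ineq4 order_trans)
    also have "\<dots> \<le> C' * (m - u) powr \<theta> + C' * (v - m) powr \<theta> + K * (v - u) powr \<theta>"
      using C'(2)[of "(u, m)"] C'(2)[of "(m, v)"] almost_additiveD(2)[OF \<Xi>, of u m v] p m(1,2)
      by (intro add_mono) auto
    also have "\<dots> = C' * (2 * ((v - u) / 2) powr \<theta>) + K * (v - u) powr \<theta>"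
      unfolding m by simp
    also have "\<dots> = (K + ?q * C') * (v - u) powr \<theta>"
      using half_powr[of "v - u" \<theta>] p by (simp add: algebra_simps)
    finally show "?f p \<le> (K + ?q * C') * ?w p" by (simp add: p)
  qed (use assms powr_less_mono[of "1-\<theta>" 0 "2::real"] in auto)
  then show ?thesis by (simp add: sewing_const_def)
qed

text \<open>
  The key estimate of the sewing lemma, uniform over all partitions, by Davie's argument: remove
  the subinterval that contains the midpoint. What is left are two partitions of intervals of at
  most half the length, and their contributions sum up geometrically because $\theta > 1$. Cutting
  out a whole subinterval, instead of splitting at a partition point, is what keeps both remaining
  pieces below half the length.
\<close>

lemma sum_almost_additive_le:
  fixes \<Xi> :: "real \<Rightarrow> real \<Rightarrow> 'a::real_normed_vector"
  assumes \<Xi>: "almost_additive a b K \<theta> \<Xi>" and "1 < \<theta>" "0 \<le> K"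
    and mono: "\<And>j k. j \<le> k \<Longrightarrow> \<tau> j \<le> \<tau> k" and range: "\<And>j. \<tau> j \<in> {a..b}"
    and "i \<le> k"
  shows "norm ((\<Sum>j=i..<k. \<Xi> (\<tau> j) (\<tau> (Suc j))) - \<Xi> (\<tau> i) (\<tau> k))
           \<le> 2 * sewing_const \<theta> * K * (\<tau> k - \<tau> i) powr \<theta>"
  using \<open>i \<le> k\<close>
proof (induction "k - i" arbitrary: i k rule: less_induct)
  case less
  let ?S = "\<lambda>i k. \<Sum>j=i..<k. \<Xi> (\<tau> j) (\<tau> (Suc j))"
  let ?C = "2 * sewing_const \<theta> * K"
  have C0: "0 \<le> ?C" using sewing_const_pos \<open>1 < \<theta>\<close> \<open>0 \<le> K\<close> by (simp add: less_imp_le)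
  show ?case
  proof (cases "i = k")
    case True
    then show ?thesis using almost_additiveD(1)[OF \<Xi> range] by simp
  next
    case False
    with less have "i < k" by simp
    define D where "D = \<tau> k - \<tau> i"
    have D: "0 \<le> D" using mono[of i k] \<open>i < k\<close> by (simp add: D_def)
    \<comment> \<open>the subinterval from \<open>\<tau> m\<close> to \<open>\<tau> (Suc m)\<close> contains the midpoint\<close>
    define m where "m = Max {j \<in> {i..<k}. \<tau> j \<le> \<tau> i + D / 2}"
    have "m \<in> {j \<in> {i..<k}. \<tau> j \<le> \<tau> i + D / 2}"
      unfolding m_def using \<open>i < k\<close> D by (intro Max_in) auto
    then have m: "i \<le> m" "m < k" "\<tau> m \<le> \<tau> i + D / 2" by auto
    have Sm: "\<tau> i + D / 2 \<le> \<tau> (Suc m)"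
    proof (cases "Suc m = k")
      case True
      then show ?thesis using D by (simp add: D_def field_simps)
    next
      case False
      with m have "Suc m \<in> {i..<k}" by auto
      moreover have "Suc m \<notin> {j \<in> {i..<k}. \<tau> j \<le> \<tau> i + D / 2}"
        using Max_ge[of "{j \<in> {i..<k}. \<tau> j \<le> \<tau> i + D / 2}" "Suc m"] unfolding m_def[symmetric]
        by auto
      ultimately show ?thesis by auto
    qed
    have "?S i k = ?S i m + ?S m k"
      using m by (intro sum.atLeastLessThan_concat[symmetric]) auto
    also have "?S m k = \<Xi> (\<tau> m) (\<tau> (Suc m)) + ?S (Suc m) k"
      using m by (simp add: sum.atLeast_Suc_lessThan)
    finally have split: "?S i k - \<Xi> (\<tau> i) (\<tau> k)
        = (?S i m - \<Xi> (\<tau> i) (\<tau> m)) + (?S (Suc m) k - \<Xi> (\<tau> (Suc m)) (\<tau> k))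
          - (\<Xi> (\<tau> i) (\<tau> k) - \<Xi> (\<tau> i) (\<tau> m) - \<Xi> (\<tau> m) (\<tau> k))
          - (\<Xi> (\<tau> m) (\<tau> k) - \<Xi> (\<tau> m) (\<tau> (Suc m)) - \<Xi> (\<tau> (Suc m)) (\<tau> k))"
      by simp
    have pw: "x powr \<theta> \<le> y powr \<theta>" if "0 \<le> x" "x \<le> y" for x y
      using that \<open>1 < \<theta>\<close> by (intro powr_mono2) auto
    have 1: "norm (?S i m - \<Xi> (\<tau> i) (\<tau> m)) \<le> ?C * (D / 2) powr \<theta>"
    proof -
      have "norm (?S i m - \<Xi> (\<tau> i) (\<tau> m)) \<le> ?C * (\<tau> m - \<tau> i) powr \<theta>"
        using m by (intro less) auto
      also have "\<dots> \<le> ?C * (D / 2) powr \<theta>"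
        using m mono[of i m] by (intro mult_left_mono C0 pw) auto
      finally show ?thesis .
    qed
    have 2: "norm (?S (Suc m) k - \<Xi> (\<tau> (Suc m)) (\<tau> k)) \<le> ?C * (D / 2) powr \<theta>"
    proof -
      have "norm (?S (Suc m) k - \<Xi> (\<tau> (Suc m)) (\<tau> k)) \<le> ?C * (\<tau> k - \<tau> (Suc m)) powr \<theta>"
        using m by (intro less) auto
      also have "\<dots> \<le> ?C * (D / 2) powr \<theta>"
        using m mono[of "Suc m" k] Sm by (intro mult_left_mono C0 pw) (auto simp: D_def field_simps)
      finally show ?thesis .
    qed
    have 3: "norm (\<Xi> (\<tau> i) (\<tau> k) - \<Xi> (\<tau> i) (\<tau> m) - \<Xi> (\<tau> m) (\<tau> k)) \<le> K * D powr \<theta>"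
      unfolding D_def using m range[of i] range[of k] mono
      by (intro almost_additiveD(2)[OF \<Xi>]) auto
    have 4: "norm (\<Xi> (\<tau> m) (\<tau> k) - \<Xi> (\<tau> m) (\<tau> (Suc m)) - \<Xi> (\<tau> (Suc m)) (\<tau> k)) \<le> K * D powr \<theta>"
    proof -
      have "norm (\<Xi> (\<tau> m) (\<tau> k) - \<Xi> (\<tau> m) (\<tau> (Suc m)) - \<Xi> (\<tau> (Suc m)) (\<tau> k))
          \<le> K * (\<tau> k - \<tau> m) powr \<theta>"
        using m range[of m] range[of k] mono by (intro almost_additiveD(2)[OF \<Xi>]) auto
      also have "\<dots> \<le> K * D powr \<theta>"
        using m mono[of i m] mono[of m k] \<open>0 \<le> K\<close> by (intro mult_left_mono pw) (auto simp: D_def)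
      finally show ?thesis .
    qed
    have "norm (?S i k - \<Xi> (\<tau> i) (\<tau> k))
        \<le> ?C * (D / 2) powr \<theta> + ?C * (D / 2) powr \<theta> + K * D powr \<theta> + K * D powr \<theta>"
      unfolding split
      by (intro order_trans[OF norm_triangle_ineq4] order_trans[OF norm_triangle_ineq] add_mono 1 2 3 4)
    also have "\<dots> = ?C * (2 * (D / 2) powr \<theta>) + 2 * K * D powr \<theta>" by (simp add: algebra_simps)
    also have "\<dots> = (2 * K) * (sewing_const \<theta> * 2 powr (1 - \<theta>) + 1) * D powr \<theta>"
      using half_powr[OF D, of \<theta>] by (simp add: algebra_simps)
    also have "sewing_const \<theta> * 2 powr (1 - \<theta>) + 1 = sewing_const \<theta>"
      using powr_less_mono[of "1-\<theta>" 0 "2::real"] \<open>1 < \<theta>\<close>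
      unfolding sewing_const_def by (simp add: field_simps)
    finally show ?thesis by (simp add: D_def algebra_simps)
  qed
qed


text \<open>
  The path is the limit of the sums of $\Xi$ over the $n$-th dyadic partition of $[a,b]$, cut off at
  $v$; since level $n$ consists of $2^n$ intervals with defect of order $2^{-n\theta}$, the sums
  converge. The cut-off sums are not additive in $v$, but the increment between $u$ and $v$ differs
  from the sum over the partition clamped to $[u,v]$ only by the defect in the interval that
  contains $u$, which vanishes in the limit. The clamped sums are close to $\Xi(u,v)$ by
  \<open>sum_almost_additive_le\<close>.
\<close>

theorem sewing_exists:
  fixes \<Xi> :: "real \<Rightarrow> real \<Rightarrow> 'a::banach"
  assumes \<Xi>: "almost_additive a b K \<theta> \<Xi>" and \<theta>: "1 < \<theta>" and K: "0 \<le> K" and "a \<le> b"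
  shows "\<exists>Y. \<forall>u v. a \<le> u \<and> u \<le> v \<and> v \<le> b \<longrightarrow>
           norm (Y v - Y u - \<Xi> u v) \<le> 2 * sewing_const \<theta> * K * (v - u) powr \<theta>"
proof -
  define \<tau> where "\<tau> n j = a + (b - a) * min 1 (real j / 2 ^ n)" for n j :: nat
  have \<tau>_range: "\<tau> n j \<in> {a..b}" for n j
    using \<open>a \<le> b\<close> mult_left_mono[of "min 1 (real j / 2 ^ n)" 1 "b - a"] by (auto simp: \<tau>_def)
  have \<tau>_mono: "\<tau> n j \<le> \<tau> n k" if "j \<le> k" for n j k
    unfolding \<tau>_def using that \<open>a \<le> b\<close>
    by (intro add_left_mono mult_left_mono min.mono divide_right_mono) auto
  have \<tau>_step: "\<tau> n (Suc j) - \<tau> n j \<le> (b - a) / 2 ^ n" for n j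
  proof -
    have "min 1 (x + h) - min 1 x \<le> h" if "0 \<le> h" for x h :: real
      using that by auto
    from this[of "1 / 2 ^ n" "real j / 2 ^ n"]
    have "min 1 (real (Suc j) / 2 ^ n) - min 1 (real j / 2 ^ n) \<le> 1 / 2 ^ n"
      by (simp add: add_divide_distrib add.commute)
    from mult_left_mono[OF this, of "b - a"] show ?thesis
      using \<open>a \<le> b\<close> by (simp add: \<tau>_def algebra_simps)
  qed
  have \<tau>_refine: "\<tau> (Suc n) (2 * j) = \<tau> n j" for n j
    by (simp add: \<tau>_def)
  define \<epsilon> where "\<epsilon> n = 2 ^ n * (K * ((b - a) / 2 ^ n) powr \<theta>)" for n :: nat
  have \<epsilon>: "\<epsilon> n = K * (b - a) powr \<theta> * (2 powr (1 - \<theta>)) ^ n" for n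
  proof -
    have "(2 powr (1 - \<theta>)) ^ n = 2 ^ n / (2 ^ n) powr \<theta>"
    proof -
      have "(2 powr \<theta>) ^ n = (2 ^ n :: real) powr \<theta>"
        by (simp add: powr_powr mult.commute flip: powr_realpow)
      then show ?thesis by (simp add: powr_diff power_divide)
    qed
    then show ?thesis using \<open>a \<le> b\<close> by (simp add: \<epsilon>_def powr_divide)
  qed
  have q: "0 \<le> (2::real) powr (1 - \<theta>)" "(2::real) powr (1 - \<theta>) < 1"
    using powr_less_mono[of "1-\<theta>" 0 "2::real"] \<theta> by auto
  have \<epsilon>_lim: "\<epsilon> \<longlonglongrightarrow> 0" and \<epsilon>_summable: "summable \<epsilon>"
    unfolding \<epsilon> using q
    by (auto intro!: tendsto_mult_right_zero LIMSEQ_power_zero summable_mult summable_geometric)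

  have defect: "norm (\<Xi> p r - \<Xi> p q - \<Xi> q r) \<le> K * ((b - a) / 2 ^ n) powr \<theta>"
    if "a \<le> p" "p \<le> q" "q \<le> r" "r \<le> b" "r - p \<le> (b - a) / 2 ^ n" for p q r n
  proof -
    have "norm (\<Xi> p r - \<Xi> p q - \<Xi> q r) \<le> K * (r - p) powr \<theta>"
      using that by (intro almost_additiveD(2)[OF \<Xi>])
    also have "\<dots> \<le> K * ((b - a) / 2 ^ n) powr \<theta>"
      using that K \<theta> by (intro mult_left_mono powr_mono2) auto
    finally show ?thesis .
  qed

  define S where "S n v = (\<Sum>j<2^n. \<Xi> (min v (\<tau> n j)) (min v (\<tau> n (Suc j))))" for n v
  have S_refine: "norm (S (Suc n) v - S n v) \<le> \<epsilon> n" if v: "a \<le> v" "v \<le> b" for n v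
  proof -
    have "S (Suc n) v = (\<Sum>j<2^n. \<Sum>i\<in>{j*2..<j*2+2}. \<Xi> (min v (\<tau> (Suc n) i)) (min v (\<tau> (Suc n) (Suc i))))"
      unfolding S_def sum.nat_group by (simp add: mult.commute)
    also have "\<dots> = (\<Sum>j<2^n. \<Xi> (min v (\<tau> n j)) (min v (\<tau> (Suc n) (Suc (2 * j))))
                 + \<Xi> (min v (\<tau> (Suc n) (Suc (2 * j)))) (min v (\<tau> n (Suc j))))"
    proof (rule sum.cong[OF refl])
      fix j :: nat
      have "{j*2..<j*2+2} = {2*j, Suc (2*j)}" by auto
      then show "(\<Sum>i\<in>{j*2..<j*2+2}. \<Xi> (min v (\<tau> (Suc n) i)) (min v (\<tau> (Suc n) (Suc i))))
          = \<Xi> (min v (\<tau> n j)) (min v (\<tau> (Suc n) (Suc (2 * j))))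
            + \<Xi> (min v (\<tau> (Suc n) (Suc (2 * j)))) (min v (\<tau> n (Suc j)))"
        using \<tau>_refine[of n j] \<tau>_refine[of n "Suc j"] by simp
    qed
    finally have "S (Suc n) v - S n v = (\<Sum>j<2^n.
        - (\<Xi> (min v (\<tau> n j)) (min v (\<tau> n (Suc j)))
           - \<Xi> (min v (\<tau> n j)) (min v (\<tau> (Suc n) (Suc (2 * j))))
           - \<Xi> (min v (\<tau> (Suc n) (Suc (2 * j)))) (min v (\<tau> n (Suc j)))))"
      by (simp add: S_def sum_subtractf[symmetric] algebra_simps)
    also have "norm \<dots> \<le> (\<Sum>j<(2::nat)^n. K * ((b - a) / 2 ^ n) powr \<theta>)"
    proof (rule sum_norm_le, unfold norm_minus_cancel, rule defect)
      fix j :: nat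
      have *: "\<tau> n j \<le> \<tau> (Suc n) (Suc (2 * j))" "\<tau> (Suc n) (Suc (2 * j)) \<le> \<tau> n (Suc j)"
        using \<tau>_mono[of "2*j" "Suc (2*j)" "Suc n"] \<tau>_mono[of "Suc (2*j)" "2 * Suc j" "Suc n"]
          \<tau>_refine[of n j] \<tau>_refine[of n "Suc j"] by auto
      then show "min v (\<tau> n j) \<le> min v (\<tau> (Suc n) (Suc (2 * j)))"
        "min v (\<tau> (Suc n) (Suc (2 * j))) \<le> min v (\<tau> n (Suc j))" by auto
      show "a \<le> min v (\<tau> n j)" using v \<tau>_range by auto
      show "min v (\<tau> n (Suc j)) \<le> b" using v by auto
      show "min v (\<tau> n (Suc j)) - min v (\<tau> n j) \<le> (b - a) / 2 ^ n"
        using \<tau>_step[of n j] \<tau>_mono[of j "Suc j" n] by auto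
    qed
    also have "\<dots> = \<epsilon> n" by (simp add: \<epsilon>_def)
    finally show ?thesis .
  qed
  have conv: "convergent (\<lambda>n. S n v)" if v: "a \<le> v" "v \<le> b" for v
  proof -
    have "summable (\<lambda>n. S (Suc n) v - S n v)"
      using S_refine[OF v] by (intro summable_comparison_test'[OF \<epsilon>_summable])
    from summable_LIMSEQ[OF this] have "convergent (\<lambda>n. S n v - S 0 v)"
      by (auto simp: sum_lessThan_telescope[of "\<lambda>n. S n v"] intro: convergentI)
    then show ?thesis by (simp add: convergent_diff_const_right_iff)
  qed
  define Y where "Y v = lim (\<lambda>n. S n v)" for v

  have "norm (Y v - Y u - \<Xi> u v) \<le> 2 * sewing_const \<theta> * K * (v - u) powr \<theta>"
    if uv: "a \<le> u" "u \<le> v" "v \<le> b" for u v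
  proof -
    define c where "c x = max u (min v x)" for x
    have c: "u \<le> c x" "c x \<le> v" "x \<le> y \<Longrightarrow> c x \<le> c y" for x y
      using uv by (auto simp: c_def)
    define T where "T n = (\<Sum>j<2^n. \<Xi> (c (\<tau> n j)) (c (\<tau> n (Suc j))))" for n
    have T: "norm (T n - \<Xi> u v) \<le> 2 * sewing_const \<theta> * K * (v - u) powr \<theta>" for n
    proof -
      have "c (\<tau> n 0) = u" "c (\<tau> n (2^n)) = v"
        using uv by (auto simp: \<tau>_def c_def)
      moreover have "c (\<tau> n j) \<in> {a..b}" for j
        using c(1)[of "\<tau> n j"] c(2)[of "\<tau> n j"] uv by simp
      ultimately show ?thesis
        using sum_almost_additive_le[OF \<Xi> \<theta> K, of "\<lambda>j. c (\<tau> n j)" 0 "2^n"] c(3) \<tau>_mono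
        unfolding T_def atLeast0LessThan by auto
    qed
    have S: "norm (S n v - S n u - T n) \<le> \<epsilon> n" for n
    proof -
      have "norm (S n v - S n u - T n) \<le> (\<Sum>j<(2::nat)^n. K * ((b - a) / 2 ^ n) powr \<theta>)"
        unfolding S_def T_def sum_subtractf[symmetric]
      proof (rule sum_norm_le)
        fix j
        let ?p = "\<tau> n j" and ?r = "\<tau> n (Suc j)"
        have pr: "?p \<le> ?r" "a \<le> ?p" "?r \<le> b" "?r - ?p \<le> (b - a) / 2 ^ n"
          using \<tau>_mono[of j "Suc j" n] \<tau>_range[of n] \<tau>_step[of n j] by auto
        have nonneg: "0 \<le> K * ((b - a) / 2 ^ n) powr \<theta>" using K by simp
        have diag: "\<Xi> u u = 0" "\<Xi> v v = 0" using almost_additiveD(1)[OF \<Xi>] uv by auto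
        \<comment> \<open>only an interval with \<open>u\<close> in its interior contributes an error\<close>
        consider "?r \<le> u" | "u \<le> ?p" | "?p < u" "u < ?r" by linarith
        then show "norm (\<Xi> (min v ?p) (min v ?r) - \<Xi> (min u ?p) (min u ?r) - \<Xi> (c ?p) (c ?r))
            \<le> K * ((b - a) / 2 ^ n) powr \<theta>"
        proof cases
          case 1
          then have "min v ?p = ?p" "min v ?r = ?r" "min u ?p = ?p" "min u ?r = ?r" "c ?p = u" "c ?r = u"
            using pr uv by (auto simp: c_def)
          then show ?thesis using nonneg diag by simp
        next
          case 2
          then have "min u ?p = u" "min u ?r = u" "c ?p = min v ?p" "c ?r = min v ?r"
            using pr uv by (auto simp: c_def)
          then show ?thesis using nonneg diag by simp
        next
          case 3
          then have "min v ?p = ?p" "min u ?p = ?p" "min u ?r = u" "c ?p = u" "c ?r = min v ?r"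
            using pr uv by (auto simp: c_def)
          then show ?thesis using defect[of ?p u "min v ?r" n] pr 3 uv by auto
        qed
      qed
      then show ?thesis by (simp add: \<epsilon>_def)
    qed
    have "(\<lambda>n. norm (S n v - S n u - \<Xi> u v)) \<longlonglongrightarrow> norm (Y v - Y u - \<Xi> u v)"
      using conv[of u] conv[of v] uv unfolding Y_def convergent_LIMSEQ_iff
      by (intro tendsto_intros) auto
    moreover have "(\<lambda>n. \<epsilon> n + 2 * sewing_const \<theta> * K * (v - u) powr \<theta>)
        \<longlonglongrightarrow> 0 + 2 * sewing_const \<theta> * K * (v - u) powr \<theta>"
      by (intro tendsto_intros \<epsilon>_lim)
    moreover have "norm (S n v - S n u - \<Xi> u v) \<le> \<epsilon> n + 2 * sewing_const \<theta> * K * (v - u) powr \<theta>" for n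
      using norm_triangle_ineq[of "S n v - S n u - T n" "T n - \<Xi> u v"] S[of n] T[of n] by simp
    ultimately show ?thesis using LIMSEQ_le by fastforce
  qed
  then show ?thesis by blast
qed

section \<open>Young integrals and Riemann--Stieltjes sums\<close>

lemma norm_matrix_vector_mult_le: "norm (A *v x) \<le> norm A * norm x" for A :: "real^'d^'m"
proof -
  have "\<bar>(A *v x) $ i\<bar> \<le> norm (A $ i) * norm x" for i
    unfolding matrix_vector_mul_component by (rule Cauchy_Schwarz_ineq2)
  then have "norm (A *v x) \<le> L2_set (\<lambda>i. norm x * norm (A $ i)) UNIV"
    unfolding norm_vec_def[of "A *v x"] by (intro L2_set_mono) (auto simp: mult.commute)
  also have "\<dots> = norm x * norm A"
    by (simp add: L2_set_right_distrib[symmetric] norm_vec_def[of A])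
  finally show ?thesis by (simp add: mult.commute)
qed

text \<open>
  The defect of $F_v (g_v - g_u)$ is $(F_w - F_v)(g_v - g_u)$. Taking the value of $F$ at the right
  end point means that $F_a$ never enters, so $F$ may jump at $a$. This matters for functions in
  $W_0^{\alpha,\infty}$, whose definition gives no control of continuity at $0$.
\<close>

lemma young_almost_additive:
  fixes F :: "real \<Rightarrow> real^'d^'m" and g :: "real \<Rightarrow> real^'d"
  assumes F: "\<And>u v. a < u \<Longrightarrow> u \<le> v \<Longrightarrow> v \<le> b \<Longrightarrow> norm (F v - F u) \<le> K * (v - u) powr \<nu>"
    and g: "holder_on a b G \<beta> g"
    and nonneg: "0 \<le> K" "0 \<le> G" "0 \<le> \<nu>" "0 \<le> \<beta>"
  shows "almost_additive a b (K * G) (\<nu> + \<beta>) (\<lambda>u v. F v *v (g v - g u))"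
  unfolding almost_additive_def
proof (intro conjI ballI allI impI)
  fix u v w assume *: "a \<le> u \<and> u \<le> v \<and> v \<le> w \<and> w \<le> b"
  have split: "F w *v (g w - g u) - F v *v (g v - g u) - F w *v (g w - g v) = (F w - F v) *v (g v - g u)"
    by (simp add: matrix_vector_mult_diff_distrib matrix_vector_mult_diff_rdistrib)
  show "norm (F w *v (g w - g u) - F v *v (g v - g u) - F w *v (g w - g v)) \<le> K * G * (w - u) powr (\<nu> + \<beta>)"
  proof (cases "v = a")
    case True
    with * have "u = v" by simp
    then show ?thesis unfolding split using * nonneg by simp
  next
    case False
    have "norm ((F w - F v) *v (g v - g u)) \<le> (K * (w - v) powr \<nu>) * (G * (v - u) powr \<beta>)"
      using * F[of v w] holder_onD[OF g, of u v] False nonneg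
      by (intro order_trans[OF norm_matrix_vector_mult_le] mult_mono) auto
    also have "\<dots> \<le> (K * (w - u) powr \<nu>) * (G * (w - u) powr \<beta>)"
      using * nonneg by (intro mult_mono mult_left_mono powr_mono2) auto
    also have "\<dots> = K * G * (w - u) powr (\<nu> + \<beta>)" by (simp add: powr_add)
    finally show ?thesis unfolding split .
  qed
qed simp

lemma has_RS_integralE:
  assumes "has_RS_integral F g I a b" "0 < e"
  obtains \<eta> where "0 < \<eta>"
    and "\<And>p. p tagged_division_of {a..b} \<Longrightarrow> (\<And>\<xi> k. (\<xi>, k) \<in> p \<Longrightarrow> Sup k - Inf k < \<eta>) \<Longrightarrow>
           norm ((\<Sum>(\<xi>, k)\<in>p. F \<xi> *v (g (Sup k) - g (Inf k))) - I) < e"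
proof -
  from assms obtain \<eta> where "0 < \<eta>"
    and *: "\<forall>p. p tagged_division_of {a..b} \<and> (\<forall>(\<xi>, k)\<in>p. Sup k - Inf k < \<eta>) \<longrightarrow>
           norm ((\<Sum>(\<xi>, k)\<in>p. F \<xi> *v (g (Sup k) - g (Inf k))) - I) < e"
    unfolding has_RS_integral_def by blast
  show thesis
  proof (rule that[OF \<open>0 < \<eta>\<close>])
    fix p assume "p tagged_division_of {a..b}" "\<And>\<xi> k. (\<xi>, k) \<in> p \<Longrightarrow> Sup k - Inf k < \<eta>"
    then show "norm ((\<Sum>(\<xi>, k)\<in>p. F \<xi> *v (g (Sup k) - g (Inf k))) - I) < e"
      using * by (auto simp: case_prod_unfold)
  qed
qed

text \<open>
  Over every tagged division the increments of $Y$ add up to $Y_b - Y_a$, and on each interval the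
  term of the Riemann--Stieltjes sum differs from the increment by a multiple of the power
  $\nu + \beta > 1$ of its length. The sum of these errors is at most a multiple of the mesh to the
  power $\nu + \beta - 1$.
\<close>

lemma has_RS_integral_path_increment:
  fixes F :: "real \<Rightarrow> real^'d^'m" and g :: "real \<Rightarrow> real^'d"
  assumes Y: "\<And>u v. a \<le> u \<Longrightarrow> u \<le> v \<Longrightarrow> v \<le> b \<Longrightarrow>
                norm (Y v - Y u - F v *v (g v - g u)) \<le> C * (v - u) powr (\<nu> + \<beta>)"
    and F: "holder_on a b K \<nu> F" and g: "holder_on a b G \<beta> g"
    and nonneg: "0 \<le> C" "0 \<le> K" "0 \<le> G" "0 \<le> \<nu>" "0 \<le> \<beta>" and \<theta>: "1 < \<nu> + \<beta>" and "a \<le> b"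
  shows "has_RS_integral F g (Y b - Y a) a b"
  unfolding has_RS_integral_def
proof (intro allI impI)
  fix e :: real assume "0 < e"
  define E where "E = K * G + C"
  define D where "D = E * (b - a)"
  have E: "0 \<le> E" and D: "0 \<le> D" using nonneg \<open>a \<le> b\<close> by (auto simp: E_def D_def)
  \<comment> \<open>chosen such that \<open>D * \<eta> powr (\<nu> + \<beta> - 1) < e\<close>\<close>
  define \<eta> where "\<eta> = (e / (D + 1)) powr (1 / (\<nu> + \<beta> - 1))"
  have \<eta>: "0 < \<eta>" "\<eta> powr (\<nu> + \<beta> - 1) = e / (D + 1)"
    using \<open>0 < e\<close> D \<theta> by (auto simp: \<eta>_def powr_powr)
  have "norm ((\<Sum>(\<xi>, k)\<in>p. F \<xi> *v (g (Sup k) - g (Inf k))) - (Y b - Y a)) < e"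
    if p: "p tagged_division_of {a..b}" and mesh: "\<forall>(\<xi>, k)\<in>p. Sup k - Inf k < \<eta>" for p
  proof -
    have "norm ((\<Sum>(\<xi>, k)\<in>p. F \<xi> *v (g (Sup k) - g (Inf k))) - (Y b - Y a))
        = norm (\<Sum>(\<xi>, k)\<in>p. F \<xi> *v (g (Sup k) - g (Inf k)) - (Y (Sup k) - Y (Inf k)))"
      unfolding additive_tagged_division_1[OF \<open>a \<le> b\<close> p, of Y, symmetric]
      by (simp add: sum_subtractf case_prod_unfold)
    also have "\<dots> \<le> (\<Sum>(\<xi>, k)\<in>p. E * \<eta> powr (\<nu> + \<beta> - 1) * (Sup k - Inf k))"
    proof (intro sum_norm_le, clarify)
      fix \<xi> k assume k: "(\<xi>, k) \<in> p"
      then obtain u v where uv: "k = cbox u v" "u \<le> \<xi>" "\<xi> \<le> v"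
        using tagged_division_ofD(2,4)[OF p k] by (metis atLeastAtMost_iff box_real(2))
      then have uv': "k = {u..v}" "u \<le> v" "Sup k = v" "Inf k = u" by auto
      have "a \<le> u" "v \<le> b"
        using tagged_division_ofD(3)[OF p k] uv' by auto
      have "norm (F \<xi> *v (g v - g u) - (Y v - Y u))
          = norm ((F v - F \<xi>) *v (g v - g u) + (Y v - Y u - F v *v (g v - g u)))"
        by (simp add: matrix_vector_mult_diff_rdistrib norm_minus_commute algebra_simps)
      also have "\<dots> \<le> norm ((F v - F \<xi>) *v (g v - g u)) + norm (Y v - Y u - F v *v (g v - g u))"
        by (rule norm_triangle_ineq)
      also have "norm ((F v - F \<xi>) *v (g v - g u)) \<le> (K * (v - \<xi>) powr \<nu>) * (G * (v - u) powr \<beta>)"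
        using holder_onD[OF F, of \<xi> v] holder_onD[OF g, of u v] uv uv' \<open>a \<le> u\<close> \<open>v \<le> b\<close> nonneg
        by (intro order_trans[OF norm_matrix_vector_mult_le] mult_mono) auto
      also have "\<dots> \<le> (K * (v - u) powr \<nu>) * (G * (v - u) powr \<beta>)"
        using uv nonneg by (intro mult_mono mult_left_mono powr_mono2) auto
      also have "norm (Y v - Y u - F v *v (g v - g u)) \<le> C * (v - u) powr (\<nu> + \<beta>)"
        using \<open>a \<le> u\<close> \<open>v \<le> b\<close> uv' by (intro Y)
      finally have "norm (F \<xi> *v (g v - g u) - (Y v - Y u)) \<le> E * (v - u) powr (\<nu> + \<beta>)"
        by (simp add: E_def powr_add algebra_simps)
      also have "(v - u) powr (\<nu> + \<beta>) = (v - u) powr (\<nu> + \<beta> - 1) * (v - u)"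
        using uv' powr_mult_base[of "v - u" "\<nu> + \<beta> - 1"] by (simp add: algebra_simps)
      also have "E * ((v - u) powr (\<nu> + \<beta> - 1) * (v - u)) \<le> E * (\<eta> powr (\<nu> + \<beta> - 1) * (v - u))"
        using mesh k uv' \<theta> E by (intro mult_left_mono mult_right_mono powr_mono2) auto
      finally show "norm (F \<xi> *v (g (Sup k) - g (Inf k)) - (Y (Sup k) - Y (Inf k)))
          \<le> E * \<eta> powr (\<nu> + \<beta> - 1) * (Sup k - Inf k)"
        using uv' by (simp add: mult.assoc)
    qed
    also have "\<dots> = E * \<eta> powr (\<nu> + \<beta> - 1) * (b - a)"
      using additive_tagged_division_1[OF \<open>a \<le> b\<close> p, of "\<lambda>x. x"]
      by (simp add: sum_distrib_left[symmetric] case_prod_unfold)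
    also have "\<dots> = D * e / (D + 1)" by (simp add: \<eta> D_def)
    also have "\<dots> < e" using D \<open>0 < e\<close> by (simp add: field_simps)
    finally show ?thesis .
  qed
  then show "\<exists>\<eta>>0. \<forall>p. p tagged_division_of {a..b} \<and> (\<forall>(\<xi>, k)\<in>p. Sup k - Inf k < \<eta>) \<longrightarrow>
      norm ((\<Sum>(\<xi>, k)\<in>p. F \<xi> *v (g (Sup k) - g (Inf k))) - (Y b - Y a)) < e"
    using \<eta>(1) by blast
qed

lemma equispaced_tagged_division:
  fixes a b :: real and n :: nat
  assumes "a < b" "0 < n"
  defines "\<tau> \<equiv> \<lambda>j. a + (b - a) * (real j / real n)"
  shows "(\<lambda>j. (\<tau> (Suc j), {\<tau> j..\<tau> (Suc j)})) ` {..<n} tagged_division_of {a..b}"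
proof (rule tagged_division_ofI)
  have less: "\<tau> j < \<tau> k \<longleftrightarrow> j < k" for j k
    using assms by (simp add: \<tau>_def divide_less_cancel)
  then have le: "\<tau> j \<le> \<tau> k \<longleftrightarrow> j \<le> k" for j k by (metis linorder_not_less)
  have ends: "\<tau> 0 = a" "\<tau> n = b" using assms by (auto simp: \<tau>_def)
  let ?p = "(\<lambda>j. (\<tau> (Suc j), {\<tau> j..\<tau> (Suc j)})) ` {..<n}"
  show "finite ?p" by simp
  fix x k assume "(x, k) \<in> ?p"
  then obtain j where j: "j < n" "x = \<tau> (Suc j)" "k = {\<tau> j..\<tau> (Suc j)}" by auto
  show "x \<in> k" "\<exists>a b. k = cbox a b" using j le by (auto simp flip: box_real)
  have "a \<le> \<tau> j" "\<tau> (Suc j) \<le> b" using j le[of 0 j] le[of "Suc j" n] ends by auto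
  then show "k \<subseteq> {a..b}" using j by auto
  fix x' k' assume "(x', k') \<in> ?p" "(x, k) \<noteq> (x', k')"
  then obtain i where i: "i < n" "k' = {\<tau> i..\<tau> (Suc i)}" "i \<noteq> j" using j by auto
  then consider "Suc i \<le> j" | "Suc j \<le> i" by linarith
  then show "interior k \<inter> interior k' = {}"
    using i j le[of "Suc i" j] le[of "Suc j" i] by cases auto
next
  let ?p = "(\<lambda>j. (\<tau> (Suc j), {\<tau> j..\<tau> (Suc j)})) ` {..<n}"
  have le: "\<tau> j \<le> \<tau> k" if "j \<le> k" for j k
    using assms that by (simp add: \<tau>_def divide_right_mono)
  have ends: "\<tau> 0 = a" "\<tau> n = b" using assms by (auto simp: \<tau>_def)
  have "(\<Union>j<k. {\<tau> j..\<tau> (Suc j)}) = {a..\<tau> k}" if "0 < k" for k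
    using that
  proof (induction k rule: nat_induct_non_zero)
    case 1
    then show ?case by (simp add: ends lessThan_Suc)
  next
    case (Suc k)
    have "(\<Union>j<Suc k. {\<tau> j..\<tau> (Suc j)}) = {a..\<tau> k} \<union> {\<tau> k..\<tau> (Suc k)}"
      using Suc by (simp add: lessThan_Suc Un_commute)
    also have "\<dots> = {a..\<tau> (Suc k)}"
      using le[of 0 k] le[of k "Suc k"] ends by (intro ivl_disj_un_two_touch) auto
    finally show ?case .
  qed
  moreover have "{k. \<exists>x. (x, k) \<in> ?p} = (\<lambda>j. {\<tau> j..\<tau> (Suc j)}) ` {..<n}" by auto
  ultimately show "\<Union> {k. \<exists>x. (x, k) \<in> ?p} = {a..b}"
    using \<open>0 < n\<close> by (simp add: ends)
qed

text \<open>
  Since the integral exists, the limit can be computed along equispaced divisions tagged at right end points, whose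
  sums are directly comparable with the increments of $Y$.
\<close>

lemma has_RS_integral_eq_path_increment:
  fixes F :: "real \<Rightarrow> real^'d^'m" and g :: "real \<Rightarrow> real^'d"
  assumes I: "has_RS_integral F g I a b"
    and Y: "\<And>u v. a \<le> u \<Longrightarrow> u \<le> v \<Longrightarrow> v \<le> b \<Longrightarrow>
                norm (Y v - Y u - F v *v (g v - g u)) \<le> C * (v - u) powr \<theta>"
    and \<theta>: "1 < \<theta>" and C: "0 \<le> C" and "a \<le> b"
  shows "I = Y b - Y a"
proof (cases "a = b")
  case True
  have p: "{(a, {a..b})} tagged_division_of {a..b}"
    using True by (intro tagged_division_of_self_real) auto
  have "norm I \<le> 0 + e" if "0 < e" for e
  proof -
    obtain \<eta> where \<eta>: "0 < \<eta>" and fine: "\<And>p. p tagged_division_of {a..b} \<Longrightarrow>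
        (\<And>\<xi> k. (\<xi>, k) \<in> p \<Longrightarrow> Sup k - Inf k < \<eta>) \<Longrightarrow>
        norm ((\<Sum>(\<xi>, k)\<in>p. F \<xi> *v (g (Sup k) - g (Inf k))) - I) < e"
      using has_RS_integralE[OF I \<open>0 < e\<close>] by blast
    show ?thesis using fine[OF p] True \<eta> by simp
  qed
  then have "norm I \<le> 0" by (rule field_le_epsilon)
  then show ?thesis using True by simp
next
  case False
  with \<open>a \<le> b\<close> have ab: "a < b" by simp
  have "norm (I - (Y b - Y a)) \<le> 0 + e" if e: "0 < e" for e
  proof -
    obtain \<eta> where \<eta>: "0 < \<eta>" and fine: "\<And>p. p tagged_division_of {a..b} \<Longrightarrow>
        (\<And>\<xi> k. (\<xi>, k) \<in> p \<Longrightarrow> Sup k - Inf k < \<eta>) \<Longrightarrow>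
        norm ((\<Sum>(\<xi>, k)\<in>p. F \<xi> *v (g (Sup k) - g (Inf k))) - I) < e / 2"
      using has_RS_integralE[OF I half_gt_zero[OF e]] by blast
    have lim: "(\<lambda>n. C * (b - a) powr \<theta> * real n powr (1 - \<theta>)) \<longlonglongrightarrow> C * (b - a) powr \<theta> * 0"
      using \<theta> by (intro tendsto_mult tendsto_const tendsto_neg_powr filterlim_real_sequentially) auto
    have "\<forall>\<^sub>F n in sequentially. C * (b - a) powr \<theta> * real n powr (1 - \<theta>) < e / 2"
      using order_tendstoD(2)[OF lim, of "e / 2"] e by simp
    moreover have "(\<lambda>n. (b - a) / real n) \<longlonglongrightarrow> 0"
      by (rule lim_const_over_n)
    then have "\<forall>\<^sub>F n in sequentially. (b - a) / real n < \<eta>" using \<eta> order_tendstoD(2) by blast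
    ultimately have "\<forall>\<^sub>F n in sequentially.
        0 < n \<and> C * (b - a) powr \<theta> * real n powr (1 - \<theta>) < e / 2 \<and> (b - a) / real n < \<eta>"
      using eventually_gt_at_top[of 0] by eventually_elim auto
    then obtain n :: nat where n: "0 < n" "C * (b - a) powr \<theta> * real n powr (1 - \<theta>) < e / 2" "(b - a) / real n < \<eta>"
      using eventually_happens' sequentially_bot by blast
    define \<tau> where "\<tau> j = a + (b - a) * (real j / real n)" for j
    let ?p = "(\<lambda>j. (\<tau> (Suc j), {\<tau> j..\<tau> (Suc j)})) ` {..<n}"
    have step: "\<tau> (Suc j) - \<tau> j = (b - a) / n" for j
      using n by (simp add: \<tau>_def field_simps)
    have mono: "\<tau> j < \<tau> k" if "j < k" for j k
      using that ab n by (simp add: \<tau>_def divide_less_cancel)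
    have inj: "inj_on (\<lambda>j. (\<tau> (Suc j), {\<tau> j..\<tau> (Suc j)})) {..<n}"
    proof (rule inj_onI)
      fix i j assume "(\<tau> (Suc i), {\<tau> i..\<tau> (Suc i)}) = (\<tau> (Suc j), {\<tau> j..\<tau> (Suc j)})"
      then show "i = j" using mono[of "Suc i" "Suc j"] mono[of "Suc j" "Suc i"] by (cases i j rule: linorder_cases) auto
    qed
    have le: "\<tau> j \<le> \<tau> k" if "j \<le> k" for j k
      using mono[of j k] that by (cases "j = k") auto
    have p: "?p tagged_division_of {a..b}"
      using equispaced_tagged_division[OF ab n(1)] unfolding \<tau>_def by simp
    have ends: "\<tau> 0 = a" "\<tau> n = b" using n by (auto simp: \<tau>_def)
    have SupInf: "Sup {\<tau> j..\<tau> (Suc j)} = \<tau> (Suc j)" "Inf {\<tau> j..\<tau> (Suc j)} = \<tau> j" for j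
      using mono[of j "Suc j"] by auto
    have "norm ((\<Sum>(\<xi>, k)\<in>?p. F \<xi> *v (g (Sup k) - g (Inf k))) - I) < e / 2"
      using n(3) step by (intro fine p) (auto simp: SupInf)
    then have 1: "norm ((\<Sum>j<n. F (\<tau> (Suc j)) *v (g (\<tau> (Suc j)) - g (\<tau> j))) - I) < e / 2"
      by (simp add: sum.reindex[OF inj] SupInf)
    have "norm ((\<Sum>j<n. Y (\<tau> (Suc j)) - Y (\<tau> j)) - (\<Sum>j<n. F (\<tau> (Suc j)) *v (g (\<tau> (Suc j)) - g (\<tau> j))))
        \<le> (\<Sum>j<n. C * ((b - a) / n) powr \<theta>)"
      unfolding sum_subtractf[symmetric]
    proof (rule sum_norm_le)
      fix j assume "j \<in> {..<n}"
      then have "a \<le> \<tau> j" "\<tau> (Suc j) \<le> b" "\<tau> j \<le> \<tau> (Suc j)"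
        using le[of 0 j] le[of "Suc j" n] le[of j "Suc j"] ends by auto
      then show "norm (Y (\<tau> (Suc j)) - Y (\<tau> j) - F (\<tau> (Suc j)) *v (g (\<tau> (Suc j)) - g (\<tau> j)))
          \<le> C * ((b - a) / n) powr \<theta>"
        using Y[of "\<tau> j" "\<tau> (Suc j)"] step by simp
    qed
    also have "(\<Sum>j<n. Y (\<tau> (Suc j)) - Y (\<tau> j)) = Y b - Y a"
      by (simp add: sum_lessThan_telescope[of "\<lambda>j. Y (\<tau> j)"] ends)
    also have "(\<Sum>j<n. C * ((b - a) / n) powr \<theta>) = C * (b - a) powr \<theta> * real n powr (1 - \<theta>)"
      using n ab by (simp add: powr_divide powr_diff)
    finally have 2: "norm ((Y b - Y a) - (\<Sum>j<n. F (\<tau> (Suc j)) *v (g (\<tau> (Suc j)) - g (\<tau> j)))) < e / 2"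
      using n(2) by simp
    have "(Y b - Y a) - I = ((Y b - Y a) - (\<Sum>j<n. F (\<tau> (Suc j)) *v (g (\<tau> (Suc j)) - g (\<tau> j))))
        + ((\<Sum>j<n. F (\<tau> (Suc j)) *v (g (\<tau> (Suc j)) - g (\<tau> j))) - I)" by simp
    also have "norm \<dots> < e" using norm_triangle_lt[OF add_strict_mono[OF 2 1]] by simp
    finally show ?thesis by (simp add: norm_minus_commute)
  qed
  then have "norm (I - (Y b - Y a)) \<le> 0" by (rule field_le_epsilon)
  then show ?thesis by (simp only: norm_le_zero_iff right_minus_eq)
qed

section \<open>The space $W_0^{\alpha,\infty}$ and Hoelder functions\<close>

lemma W0_E:
  assumes "f \<in> W0 \<alpha>"
  obtains B where "0 \<le> B" "f \<in> borel_measurable (lebesgue_on {0..1})"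
    "\<And>t. t \<in> {0..1} \<Longrightarrow> norm (f t) \<le> B"
    "\<And>t. t \<in> {0..1} \<Longrightarrow>
       (\<integral>\<^sup>+s\<in>{0..t}. ennreal (norm (f t - f s) / (t - s) powr (\<alpha> + 1)) \<partial>lebesgue) \<le> ennreal B"
proof -
  let ?\<Phi> = "\<lambda>t. \<integral>\<^sup>+s\<in>{0..t}. ennreal (norm (f t - f s) / (t - s) powr (\<alpha> + 1)) \<partial>lebesgue"
  let ?s = "SUP t\<in>{0..1}. ennreal (norm (f t)) + ?\<Phi> t"
  define B where "B = enn2real ?s"
  have "?s < \<infinity>" and m: "f \<in> borel_measurable (lebesgue_on {0..1})" using assms by (auto simp: W0_def)
  then have s: "?s = ennreal B" by (simp add: B_def)
  have le: "ennreal (norm (f t)) + ?\<Phi> t \<le> ennreal B" if "t \<in> {0..1}" for t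
    unfolding s[symmetric] using that by (intro SUP_upper)
  show thesis
  proof (rule that[of B])
    show B: "0 \<le> B" by (simp add: B_def)
    show "f \<in> borel_measurable (lebesgue_on {0..1})" by (rule m)
    fix t :: real assume t: "t \<in> {0..1}"
    have "ennreal (norm (f t)) \<le> ennreal B"
      by (rule order_trans[OF _ le[OF t]]) simp
    then show "norm (f t) \<le> B" using B by simp
    show "?\<Phi> t \<le> ennreal B"
      by (rule order_trans[OF _ le[OF t]]) simp
  qed
qed

text \<open>
  If $u$ and $v = u + h$ with $h \le u$, then $(u-h,u)$ lies to the left of both points. The two
  integrals at $u$ and $v$ are bounded, so some $s$ in this interval has both integrands at most of
  order $1/h$; then $f_s$ is within order $h^\alpha$ of $f_u$ and of $f_v$.
\<close>

lemma W0_holder_local: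
  fixes f :: "real \<Rightarrow> 'a::euclidean_space"
  assumes m: "f \<in> borel_measurable (lebesgue_on {0..1})" and "0 \<le> B"
    and \<Phi>: "\<And>t. t \<in> {0..1} \<Longrightarrow>
       (\<integral>\<^sup>+s\<in>{0..t}. ennreal (norm (f t - f s) / (t - s) powr (\<alpha> + 1)) \<partial>lebesgue) \<le> ennreal B"
    and uv: "u < v" "v \<le> 1" "v \<le> 2 * u" and \<alpha>: "0 \<le> \<alpha>"
  shows "norm (f v - f u) \<le> 2 * 2 powr (\<alpha> + 1) * (2 * B + 1) * (v - u) powr \<alpha>"
proof -
  define h where "h = v - u"
  let ?J = "{u - h<..<u}"
  define p where "p t s = norm (f t - f s) / (t - s) powr (\<alpha> + 1)" for t s
  define c where "c = (2 * B + 1) / h"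
  have h: "0 < h" "h \<le> u" "v = u + h" using uv by (auto simp: h_def)
  have c: "0 \<le> c" using h \<open>0 \<le> B\<close> by (simp add: c_def)
  have id: "(\<lambda>s::real. s) \<in> borel_measurable (lebesgue_on {0..1})"
    by (intro continuous_imp_measurable_on_sets_lebesgue) auto
  have p_meas: "(\<lambda>s. ennreal (p t s) * indicator ?J s) \<in> borel_measurable lebesgue" for t
  proof -
    note [measurable] = m id
    have "(\<lambda>s. ennreal (p t s)) \<in> borel_measurable (lebesgue_on {0..1})"
      unfolding p_def by measurable
    then have "(\<lambda>s. ennreal (p t s) * indicator {0..1} s) \<in> borel_measurable lebesgue"
      by (subst (asm) borel_measurable_restrict_space_iff_ennreal) auto
    then have "(\<lambda>s. ennreal (p t s) * indicator {0..1} s * indicator ?J s) \<in> borel_measurable lebesgue"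
      by (rule borel_measurable_times_ennreal) (auto intro!: borel_measurable_indicator)
    also have "(\<lambda>s. ennreal (p t s) * indicator {0..1} s * indicator ?J s)
        = (\<lambda>s. ennreal (p t s) * indicator ?J s)"
      using h uv by (auto simp: fun_eq_iff split: split_indicator)
    finally show ?thesis .
  qed
  have "\<exists>s\<in>?J. p v s + p u s \<le> c"
  proof (rule ccontr)
    assume "\<not> ?thesis"
    then have gt: "c \<le> p v s + p u s" if "s \<in> ?J" for s
      using that by (meson linear)
    have le: "(\<integral>\<^sup>+s. ennreal (p t s) * indicator ?J s \<partial>lebesgue) \<le> ennreal B" if t: "u \<le> t" "t \<le> v" for t
    proof -
      have "(\<integral>\<^sup>+s. ennreal (p t s) * indicator ?J s \<partial>lebesgue)
          \<le> (\<integral>\<^sup>+s. ennreal (p t s) * indicator {0..t} s \<partial>lebesgue)"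
        using h t by (intro nn_integral_mono) (auto split: split_indicator)
      also have "\<dots> \<le> ennreal B"
        unfolding p_def using t h uv by (intro \<Phi>) auto
      finally show ?thesis .
    qed
    have "ennreal (2 * B + 1) = ennreal c * emeasure lebesgue ?J"
      using h \<open>0 \<le> B\<close> by (simp add: c_def ennreal_mult[symmetric])
    also have "\<dots> = (\<integral>\<^sup>+s. ennreal c * indicator ?J s \<partial>lebesgue)"
      by (simp add: nn_integral_cmult_indicator)
    also have "\<dots> \<le> (\<integral>\<^sup>+s. ennreal (p v s) * indicator ?J s + ennreal (p u s) * indicator ?J s \<partial>lebesgue)"
      using gt by (intro nn_integral_mono)
        (auto split: split_indicator simp: p_def ennreal_plus[symmetric] simp del: ennreal_plus intro!: ennreal_leI)
    also have "\<dots> = (\<integral>\<^sup>+s. ennreal (p v s) * indicator ?J s \<partial>lebesgue)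
        + (\<integral>\<^sup>+s. ennreal (p u s) * indicator ?J s \<partial>lebesgue)"
      by (intro nn_integral_add p_meas)
    also have "\<dots> \<le> ennreal B + ennreal B" using uv by (intro add_mono le) auto
    also have "\<dots> = ennreal (2 * B)" using \<open>0 \<le> B\<close> by (simp flip: ennreal_plus)
    finally show False using \<open>0 \<le> B\<close> by simp
  qed
  then obtain s where s: "u - h < s" "s < u" "p v s + p u s \<le> c" by auto
  have p0: "0 \<le> p t s" for t by (simp add: p_def)
  have near: "norm (f t - f s) \<le> c * (2 * h) powr (\<alpha> + 1)" if t: "s < t" "t - s \<le> 2 * h" "p t s \<le> c" for t
  proof -
    have "norm (f t - f s) = p t s * (t - s) powr (\<alpha> + 1)" using t by (simp add: p_def)
    also have "\<dots> \<le> c * (2 * h) powr (\<alpha> + 1)"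
      using t c \<alpha> by (intro mult_mono powr_mono2) auto
    finally show ?thesis .
  qed
  have "norm (f v - f u) \<le> norm (f v - f s) + norm (f u - f s)"
    using norm_triangle_ineq4[of "f v - f s" "f u - f s"] by simp
  also have "\<dots> \<le> c * (2 * h) powr (\<alpha> + 1) + c * (2 * h) powr (\<alpha> + 1)"
    using s h p0[of u] p0[of v] by (intro add_mono near) auto
  also have "\<dots> = 2 * 2 powr (\<alpha> + 1) * (2 * B + 1) * h powr \<alpha>"
    using h by (simp add: c_def powr_mult powr_add)
  finally show ?thesis by (simp add: h_def)
qed

text \<open>
  For $v > 2u$ there is no room of length $v - u$ to the left of $u$. Instead $v$ is halved until it
  is comparable to $u$; the increments form a geometric series.
\<close>

lemma halving_chain:
  fixes f :: "real \<Rightarrow> 'a::real_normed_vector"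
  assumes local: "\<And>u v. 0 < u \<Longrightarrow> u \<le> v \<Longrightarrow> v \<le> 2 * u \<Longrightarrow> v \<le> 1 \<Longrightarrow> norm (f v - f u) \<le> C * (v - u) powr \<alpha>"
    and "0 \<le> C" and \<alpha>: "0 < \<alpha>" and uv: "0 < u" "u \<le> v" "v \<le> 1"
  shows "norm (f v - f u) \<le> 2 powr \<alpha> * (C / (1 - 2 powr (-\<alpha>))) * (v - u) powr \<alpha>"
proof -
  define q where "q = (2::real) powr (-\<alpha>)"
  define C' where "C' = C / (1 - q)"
  have q: "0 < q" "q < 1" using powr_less_mono[of "-\<alpha>" 0 "2::real"] \<alpha> by (auto simp: q_def)
  have C': "0 \<le> C'" "C + C' * q = C'" "C \<le> C'"
    using q \<open>0 \<le> C\<close> by (auto simp: C'_def field_simps)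
  have half: "(v / 2) powr \<alpha> = q * v powr \<alpha>" if "0 \<le> v" for v
    using that by (simp add: q_def powr_divide powr_minus_divide)
  have chain: "norm (f v - f u) \<le> C' * v powr \<alpha>" if "0 < u" "u \<le> v" "v \<le> 2 ^ k * u" "v \<le> 1" for k u v
    using that
  proof (induction k arbitrary: v)
    case 0
    then show ?case using C' by simp
  next
    case (Suc k)
    show ?case
    proof (cases "v \<le> 2 * u")
      case True
      have "norm (f v - f u) \<le> C * (v - u) powr \<alpha>" using Suc True by (intro local) auto
      also have "\<dots> \<le> C' * v powr \<alpha>"
        using Suc C' \<alpha> \<open>0 \<le> C\<close> by (intro mult_mono powr_mono2) auto
      finally show ?thesis .
    next
      case False
      have "norm (f v - f u) \<le> norm (f v - f (v / 2)) + norm (f (v / 2) - f u)"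
        using norm_triangle_ineq[of "f v - f (v / 2)" "f (v / 2) - f u"] by simp
      also have "\<dots> \<le> C * (v - v / 2) powr \<alpha> + C' * (v / 2) powr \<alpha>"
        using Suc False by (intro add_mono local Suc.IH) auto
      also have "\<dots> = C * ((v / 2) powr \<alpha>) + C' * q * v powr \<alpha>"
        using Suc half[of v] by simp
      also have "\<dots> \<le> C * v powr \<alpha> + C' * q * v powr \<alpha>"
        using Suc \<alpha> \<open>0 \<le> C\<close> q C' by (intro add_mono mult_left_mono powr_mono2) auto
      also have "\<dots> = C' * v powr \<alpha>"
        by (subst C'(2)[symmetric]) (simp add: algebra_simps)
      finally show ?thesis .
    qed
  qed
  show ?thesis
  proof (cases "v \<le> 2 * u")
    case True
    have "1 * C \<le> 2 powr \<alpha> * C'"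
      using C' \<alpha> \<open>0 \<le> C\<close> by (intro mult_mono ge_one_powr_ge_zero) auto
    then have "C * (v - u) powr \<alpha> \<le> 2 powr \<alpha> * C' * (v - u) powr \<alpha>"
      by (intro mult_right_mono) auto
    with local[of u v] uv True show ?thesis by (simp add: C'_def q_def)
  next
    case False
    obtain k :: nat where k: "v / u < 2 ^ k" using real_arch_pow[of 2 "v / u"] by auto
    then have "v \<le> 2 ^ k * u" using uv by (simp add: field_simps)
    then have "norm (f v - f u) \<le> C' * v powr \<alpha>" using uv by (intro chain) auto
    also have "\<dots> \<le> C' * (2 * (v - u)) powr \<alpha>"
      using False uv \<alpha> C' by (intro mult_left_mono powr_mono2) auto
    also have "(2 * (v - u)) powr \<alpha> = 2 powr \<alpha> * (v - u) powr \<alpha>" using uv by (intro powr_mult)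
    finally show ?thesis by (simp add: C'_def q_def mult_ac)
  qed
qed

lemma W0_imp_holder_right_of_0:
  fixes f :: "real \<Rightarrow> 'a::euclidean_space"
  assumes "f \<in> W0 \<alpha>" and \<alpha>: "0 < \<alpha>"
  obtains C where "0 \<le> C" "\<And>t. t \<in> {0..1} \<Longrightarrow> norm (f t) \<le> C"
    "\<And>u v. 0 < u \<Longrightarrow> u \<le> v \<Longrightarrow> v \<le> 1 \<Longrightarrow> norm (f v - f u) \<le> C * (v - u) powr \<alpha>"
proof -
  from W0_E[OF assms(1)] obtain B where B: "0 \<le> B" "f \<in> borel_measurable (lebesgue_on {0..1})"
    "\<And>t. t \<in> {0..1} \<Longrightarrow> norm (f t) \<le> B"
    "\<And>t. t \<in> {0..1} \<Longrightarrow>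
       (\<integral>\<^sup>+s\<in>{0..t}. ennreal (norm (f t - f s) / (t - s) powr (\<alpha> + 1)) \<partial>lebesgue) \<le> ennreal B"
    by blast
  define K where "K = 2 * 2 powr (\<alpha> + 1) * (2 * B + 1)"
  have K: "0 \<le> K" using B by (simp add: K_def)
  have local: "norm (f v - f u) \<le> K * (v - u) powr \<alpha>" if "0 < u" "u \<le> v" "v \<le> 2 * u" "v \<le> 1" for u v
    using W0_holder_local[OF B(2,1,4), of u v] that \<alpha> unfolding K_def by (cases "u = v") auto
  define C where "C = 2 powr \<alpha> * (K / (1 - 2 powr (-\<alpha>)))"
  have "0 \<le> C" using K powr_less_mono[of "-\<alpha>" 0 "2::real"] \<alpha> by (simp add: C_def)
  show thesis
  proof (rule that[of "max B C"])
    fix u v :: real assume uv: "0 < u" "u \<le> v" "v \<le> 1"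
    have "norm (f v - f u) \<le> C * (v - u) powr \<alpha>"
      unfolding C_def using uv by (intro halving_chain local K \<alpha>)
    also have "\<dots> \<le> max B C * (v - u) powr \<alpha>" by (intro mult_right_mono) auto
    finally show "norm (f v - f u) \<le> max B C * (v - u) powr \<alpha>" .
  qed (use B in \<open>auto simp: le_max_iff_disj\<close>)
qed

text \<open>
  The integrand is at most $C (t-s)^{\mu-\alpha-1}$, which is integrable because $\alpha < \mu$.
\<close>

lemma holder_imp_W0:
  fixes f :: "real \<Rightarrow> 'a::euclidean_space"
  assumes f: "holder_on 0 1 C \<mu> f" and "\<alpha> < \<mu>" "0 < \<mu>" "0 \<le> C"
  shows "f \<in> W0 \<alpha>"
proof -
  have "continuous_on {0..1} f" using f \<open>0 < \<mu>\<close> by (rule holder_on_imp_continuous_on)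
  then have m: "f \<in> borel_measurable (lebesgue_on {0..1})"
    by (intro continuous_imp_measurable_on_sets_lebesgue) auto
  define B where "B = norm (f 0) + C + C / (\<mu> - \<alpha>)"
  have "ennreal (norm (f t)) + (\<integral>\<^sup>+s\<in>{0..t}. ennreal (norm (f t - f s) / (t - s) powr (\<alpha> + 1)) \<partial>lebesgue)
      \<le> ennreal B" if t: "t \<in> {0..1}" for t
  proof -
    have "norm (f t) \<le> norm (f 0) + norm (f t - f 0)" using norm_triangle_sub by blast
    also have "norm (f t - f 0) \<le> C * t powr \<mu>" using holder_onD[OF f, of 0 t] t by simp
    also have "C * t powr \<mu> \<le> C * 1" using t \<open>0 \<le> C\<close> \<open>0 < \<mu>\<close> by (intro mult_left_mono powr_le1) auto
    finally have 1: "norm (f t) \<le> norm (f 0) + C" by simp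
    have "(\<integral>\<^sup>+s\<in>{0..t}. ennreal (norm (f t - f s) / (t - s) powr (\<alpha> + 1)) \<partial>lebesgue)
        \<le> (\<integral>\<^sup>+s\<in>{0..t}. ennreal (C * (t - s) powr (\<mu> - \<alpha> - 1)) \<partial>lebesgue)"
    proof (intro nn_integral_mono)
      fix s
      show "ennreal (norm (f t - f s) / (t - s) powr (\<alpha> + 1)) * indicator {0..t} s
          \<le> ennreal (C * (t - s) powr (\<mu> - \<alpha> - 1)) * indicator {0..t} s"
      proof (cases "s \<in> {0..<t}")
        case True
        then have "norm (f t - f s) / (t - s) powr (\<alpha> + 1) \<le> C * (t - s) powr \<mu> / (t - s) powr (\<alpha> + 1)"
          using holder_onD[OF f, of s t] t by (intro divide_right_mono) auto
        also have "\<dots> = C * (t - s) powr (\<mu> - \<alpha> - 1)"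
          using powr_diff[of "t - s" \<mu> "\<alpha> + 1"] by (simp add: algebra_simps)
        finally show ?thesis by (intro mult_right_mono ennreal_leI) auto
      qed (auto split: split_indicator)
    qed
    also have "\<dots> = (\<integral>\<^sup>+s\<in>{0..t}. ennreal (C * (t - s) powr (\<mu> - \<alpha> - 1)) \<partial>lborel)"
      by (simp add: nn_integral_completion)
    also have "\<dots> = (\<integral>\<^sup>+r\<in>{0..t}. ennreal (C * r powr (\<mu> - \<alpha> - 1)) \<partial>lborel)"
    proof -
      have "(\<integral>\<^sup>+r\<in>{0..t}. ennreal (C * r powr (\<mu> - \<alpha> - 1)) \<partial>lborel)
          = (\<integral>\<^sup>+s. ennreal (C * (t - s) powr (\<mu> - \<alpha> - 1)) * indicator {0..t} (t - s) \<partial>lborel)"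
        by (subst nn_integral_real_affine[where c = "-1" and t = t]) auto
      also have "\<dots> = (\<integral>\<^sup>+s\<in>{0..t}. ennreal (C * (t - s) powr (\<mu> - \<alpha> - 1)) \<partial>lborel)"
        by (intro nn_integral_cong) (auto split: split_indicator)
      finally show ?thesis ..
    qed
    also have "\<dots> = ennreal (C * (t powr (\<mu> - \<alpha>) / (\<mu> - \<alpha>)))"
      using has_integral_mult_right[OF has_integral_powr_from_0[of "\<mu> - \<alpha> - 1" t], of C] t assms
      by (intro nn_integral_has_integral_lebesgue') auto
    also have "\<dots> \<le> ennreal (C / (\<mu> - \<alpha>))"
    proof (rule ennreal_leI)
      have "t powr (\<mu> - \<alpha>) \<le> 1" using t assms by (intro powr_le1) auto
      then have "t powr (\<mu> - \<alpha>) / (\<mu> - \<alpha>) \<le> 1 / (\<mu> - \<alpha>)"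
        using assms by (intro divide_right_mono) auto
      from mult_left_mono[OF this \<open>0 \<le> C\<close>] show "C * (t powr (\<mu> - \<alpha>) / (\<mu> - \<alpha>)) \<le> C / (\<mu> - \<alpha>)" by simp
    qed
    finally have 2: "(\<integral>\<^sup>+s\<in>{0..t}. ennreal (norm (f t - f s) / (t - s) powr (\<alpha> + 1)) \<partial>lebesgue)
        \<le> ennreal (C / (\<mu> - \<alpha>))" .
    show ?thesis
      using add_mono[OF ennreal_leI[OF 1] 2] assms unfolding B_def by (simp add: ennreal_plus[symmetric] del: ennreal_plus)
  qed
  then have "(SUP t\<in>{0..1}. ennreal (norm (f t)) +
      (\<integral>\<^sup>+s\<in>{0..t}. ennreal (norm (f t - f s) / (t - s) powr (\<alpha> + 1)) \<partial>lebesgue)) \<le> ennreal B"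
    by (intro SUP_least)
  then show ?thesis using m unfolding W0_def by (auto simp: less_top intro: le_less_trans)
qed

section \<open>Regularity of the coefficients\<close>

lemma derivative_eq_sum_partial_deriv:
  fixes f :: "real^'m \<Rightarrow> 'a::real_normed_vector"
  assumes D: "(f has_derivative D) (at x)"
  shows "D v = (\<Sum>i\<in>UNIV. v $ i *\<^sub>R partial_deriv i f x)"
proof -
  interpret D: bounded_linear D using D by (rule has_derivative_bounded_linear)
  have "partial_deriv i f x = D (axis i 1)" for i
  proof -
    have "((\<lambda>h::real. x + h *\<^sub>R axis i 1) has_derivative (\<lambda>h. h *\<^sub>R axis i 1)) (at 0)"
      by (auto intro!: derivative_eq_intros)
    moreover have "(f has_derivative D) (at (x + 0 *\<^sub>R axis i 1))" using D by simp
    ultimately have "((\<lambda>h. f (x + h *\<^sub>R axis i 1)) has_derivative (\<lambda>h. D (h *\<^sub>R axis i 1))) (at 0)"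
      by (rule has_derivative_compose)
    then have "((\<lambda>h. f (x + h *\<^sub>R axis i 1)) has_vector_derivative D (axis i 1)) (at 0)"
      by (simp add: has_vector_derivative_def D.scaleR)
    then show ?thesis unfolding partial_deriv_def by (rule vector_derivative_at)
  qed
  moreover have "D v = (\<Sum>i\<in>UNIV. v $ i *\<^sub>R D (axis i 1))"
    by (subst basis_expansion[of v, symmetric]) (simp only: D.sum scalar_mult_eq_scaleR D.scaleR)
  ultimately show ?thesis by simp
qed


lemma sigma_increment:
  assumes \<sigma>: "sigma_condition H M MN lam gam \<sigma>" and st: "s \<in> {0..1}" "t \<in> {0..1}"
  shows "norm (\<sigma> t x - \<sigma> s y) \<le> M * \<bar>t - s\<bar> powr lam + M * norm (x - y)"
proof -
  have "norm (\<sigma> t y - \<sigma> s y) + norm (partial_deriv undefined (\<sigma> t) y - partial_deriv undefined (\<sigma> s) y)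
      \<le> M * \<bar>t - s\<bar> powr lam"
    using \<sigma> st unfolding sigma_condition_def by blast
  then have "norm (\<sigma> t y - \<sigma> s y) \<le> M * \<bar>t - s\<bar> powr lam"
    by (smt (verit) norm_ge_zero)
  moreover have "norm (\<sigma> t x - \<sigma> t y) \<le> M * norm (x - y)"
    using \<sigma> st unfolding sigma_condition_def by blast
  ultimately show ?thesis
    using norm_triangle_ineq[of "\<sigma> t x - \<sigma> t y" "\<sigma> t y - \<sigma> s y"] by simp
qed

lemma sigma_growth:
  assumes \<sigma>: "sigma_condition H M MN lam gam \<sigma>" and "0 \<le> lam" and t: "t \<in> {0..1}"
  shows "norm (\<sigma> t x) \<le> (norm (\<sigma> 0 0) + M) * (1 + norm x)"
proof -
  have M: "0 \<le> M" using \<sigma> unfolding sigma_condition_def by linarith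
  have "norm (\<sigma> t x) \<le> norm (\<sigma> 0 0) + norm (\<sigma> t x - \<sigma> 0 0)" by (rule norm_triangle_sub)
  also have "norm (\<sigma> t x - \<sigma> 0 0) \<le> M * t powr lam + M * norm x"
    using sigma_increment[OF \<sigma>, of 0 t x 0] t by simp
  also have "M * t powr lam \<le> M * 1" using M t \<open>0 \<le> lam\<close> by (intro mult_left_mono powr_le1) auto
  also have "norm (\<sigma> 0 0) + (M * 1 + M * norm x) \<le> (norm (\<sigma> 0 0) + M) * (1 + norm x)"
    by (simp add: algebra_simps)
  finally show ?thesis by simp
qed

text \<open>
  Move $x_1$ to $y_1 + (x_2 - y_2)$, which costs only the Lipschitz constant. Then both differences
  are taken along the same vector $z = x_2 - y_2$, and the mean value inequality for
  $\theta \mapsto \sigma(t, y_1 + \theta z) - \sigma(s, y_2 + \theta z)$ leaves only differences of partial derivatives of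
  $\sigma$ at nearby points. The radius $3N$ accommodates the points $y_i + \theta z$.
\<close>

lemma sigma_four_point:
  fixes \<sigma> :: "real \<Rightarrow> real^'m \<Rightarrow> real^'d^'m"
  assumes \<sigma>: "sigma_condition H M MN lam gam \<sigma>" and st: "s \<in> {0..1}" "t \<in> {0..1}"
    and N: "0 < N" "norm y\<^sub>1 \<le> N" "norm x\<^sub>2 \<le> N" "norm y\<^sub>2 \<le> N"
  shows "norm ((\<sigma> t x\<^sub>1 - \<sigma> t y\<^sub>1) - (\<sigma> s x\<^sub>2 - \<sigma> s y\<^sub>2))
    \<le> M * norm ((x\<^sub>1 - y\<^sub>1) - (x\<^sub>2 - y\<^sub>2))
      + CARD('m) * (M * \<bar>t - s\<bar> powr lam + MN (3 * N) * norm (y\<^sub>1 - y\<^sub>2) powr gam) * norm (x\<^sub>2 - y\<^sub>2)"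
proof -
  define z where "z = x\<^sub>2 - y\<^sub>2"
  define B where "B = M * \<bar>t - s\<bar> powr lam + MN (3 * N) * norm (y\<^sub>1 - y\<^sub>2) powr gam"
  define D where "D r x = frechet_derivative (\<sigma> r) (at x)" for r x
  have D: "(\<sigma> r has_derivative D r x) (at x)" if "r \<in> {0..1}" for r x
    using \<sigma> that unfolding sigma_condition_def D_def by (simp flip: frechet_derivative_works)
  define \<phi> where "\<phi> \<theta> = \<sigma> t (y\<^sub>1 + \<theta> *\<^sub>R z) - \<sigma> s (y\<^sub>2 + \<theta> *\<^sub>R z)" for \<theta> :: real
  define \<phi>' where "\<phi>' \<theta> h = D t (y\<^sub>1 + \<theta> *\<^sub>R z) (h *\<^sub>R z) - D s (y\<^sub>2 + \<theta> *\<^sub>R z) (h *\<^sub>R z)" for \<theta> h :: real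
  have deriv: "(\<phi> has_derivative \<phi>' \<theta>) (at \<theta> within {0..1})" for \<theta>
  proof -
    have "((\<lambda>\<theta>. y + \<theta> *\<^sub>R z) has_derivative (\<lambda>h. h *\<^sub>R z)) (at \<theta> within {0..1})" for y
      by (auto intro!: derivative_eq_intros)
    then show ?thesis
      unfolding \<phi>_def \<phi>'_def
      by (intro has_derivative_diff has_derivative_compose[OF _ D] st)
  qed
  have bound: "norm (\<phi>' \<theta> h) \<le> CARD('m) * B * norm z * norm h" if "\<theta> \<in> {0..1}" for \<theta> h
  proof -
    let ?p = "y\<^sub>1 + \<theta> *\<^sub>R z" and ?q = "y\<^sub>2 + \<theta> *\<^sub>R z"
    have "norm (\<theta> *\<^sub>R z) \<le> 2 * N"
    proof -
      have "norm (\<theta> *\<^sub>R z) \<le> 1 * norm z" unfolding norm_scaleR using that by (intro mult_right_mono) auto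
      then show ?thesis using norm_triangle_ineq4[of x\<^sub>2 y\<^sub>2] N by (simp add: z_def)
    qed
    then have pq: "max (norm ?p) (norm ?q) \<le> 3 * N"
      using norm_triangle_ineq[of y\<^sub>1 "\<theta> *\<^sub>R z"] norm_triangle_ineq[of y\<^sub>2 "\<theta> *\<^sub>R z"] N by simp
    have part: "norm (partial_deriv i (\<sigma> t) ?p - partial_deriv i (\<sigma> s) ?q) \<le> B" for i
    proof -
      have "norm (\<sigma> t ?q - \<sigma> s ?q) + norm (partial_deriv i (\<sigma> t) ?q - partial_deriv i (\<sigma> s) ?q)
          \<le> M * \<bar>t - s\<bar> powr lam"
        using \<sigma> st unfolding sigma_condition_def by blast
      then have "norm (partial_deriv i (\<sigma> t) ?q - partial_deriv i (\<sigma> s) ?q) \<le> M * \<bar>t - s\<bar> powr lam"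
        by (smt (verit) norm_ge_zero)
      moreover have "norm (partial_deriv i (\<sigma> t) ?p - partial_deriv i (\<sigma> t) ?q) \<le> MN (3 * N) * norm (?p - ?q) powr gam"
      proof -
        have "0 < 3 * N" using N by simp
        with \<sigma> st pq show ?thesis unfolding sigma_condition_def by blast
      qed
      ultimately show ?thesis
        using norm_triangle_ineq[of "partial_deriv i (\<sigma> t) ?p - partial_deriv i (\<sigma> t) ?q"
            "partial_deriv i (\<sigma> t) ?q - partial_deriv i (\<sigma> s) ?q"] by (simp add: B_def)
    qed
    have "\<phi>' \<theta> h = (\<Sum>i\<in>UNIV. (h *\<^sub>R z) $ i *\<^sub>R (partial_deriv i (\<sigma> t) ?p - partial_deriv i (\<sigma> s) ?q))"
      unfolding \<phi>'_def derivative_eq_sum_partial_deriv[OF D[OF st(2)]] derivative_eq_sum_partial_deriv[OF D[OF st(1)]]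
      by (simp add: sum_subtractf scaleR_diff_right)
    also have "norm \<dots> \<le> (\<Sum>i\<in>(UNIV::'m set). norm (h *\<^sub>R z) * B)"
    proof (rule sum_norm_le)
      fix i
      have "\<bar>(h *\<^sub>R z) $ i\<bar> \<le> norm (h *\<^sub>R z)" by (rule component_le_norm_cart)
      then show "norm ((h *\<^sub>R z) $ i *\<^sub>R (partial_deriv i (\<sigma> t) ?p - partial_deriv i (\<sigma> s) ?q)) \<le> norm (h *\<^sub>R z) * B"
        unfolding norm_scaleR[of "(h *\<^sub>R z) $ i"] by (intro mult_mono part) auto
    qed
    finally show ?thesis by (simp add: mult_ac)
  qed
  have "0 \<le> B"
  proof -
    have "0 < M" "0 < MN (3 * N)" using \<sigma> N unfolding sigma_condition_def by auto
    then show ?thesis by (simp add: B_def)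
  qed
  then have "norm (\<phi> 1 - \<phi> 0) \<le> CARD('m) * B * norm z * norm (1 - 0 :: real)"
    by (intro differentiable_bound[where S = "{0..1}" and f' = \<phi>'] deriv onorm_bound bound) auto
  then have 1: "norm (\<phi> 1 - \<phi> 0) \<le> CARD('m) * B * norm z" by simp
  have 2: "norm (\<sigma> t x\<^sub>1 - \<sigma> t (y\<^sub>1 + z)) \<le> M * norm ((x\<^sub>1 - y\<^sub>1) - (x\<^sub>2 - y\<^sub>2))"
  proof -
    have "norm (\<sigma> t x\<^sub>1 - \<sigma> t (y\<^sub>1 + z)) \<le> M * norm (x\<^sub>1 - (y\<^sub>1 + z))"
      using \<sigma> st unfolding sigma_condition_def by blast
    then show ?thesis by (simp add: z_def algebra_simps)
  qed
  have "(\<sigma> t x\<^sub>1 - \<sigma> t y\<^sub>1) - (\<sigma> s x\<^sub>2 - \<sigma> s y\<^sub>2) = (\<sigma> t x\<^sub>1 - \<sigma> t (y\<^sub>1 + z)) + (\<phi> 1 - \<phi> 0)"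
    by (simp add: \<phi>_def z_def)
  also have "norm \<dots> \<le> M * norm ((x\<^sub>1 - y\<^sub>1) - (x\<^sub>2 - y\<^sub>2)) + CARD('m) * B * norm z"
    by (rule norm_triangle_mono[OF 2 1])
  finally show ?thesis by (simp add: B_def z_def)
qed

text \<open>
  Replacing $x$ by its values at the multiples of $1/(n+1)$ makes the composition measurable as a
  countable patchwork of the functions $b(\cdot,y)$; continuity in the second argument allows the
  passage to the limit.
\<close>

lemma caratheodory_measurable:
  fixes b :: "real \<Rightarrow> 'a::real_normed_vector \<Rightarrow> 'b::{second_countable_topology, real_normed_vector}"
  assumes S: "S \<in> sets lebesgue"
    and meas: "\<And>x. (\<lambda>t. b t x) \<in> borel_measurable (lebesgue_on S)"
    and lip: "\<And>t x y. t \<in> S \<Longrightarrow> norm (b t x - b t y) \<le> L * norm (x - y)"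
    and x: "continuous_on UNIV x"
  shows "(\<lambda>t. b t (x t)) \<in> borel_measurable (lebesgue_on S)"
proof -
  define r where "r n t = real_of_int \<lfloor>real (Suc n) * t\<rfloor> / real (Suc n)" for n :: nat and t :: real
  have meas_n: "(\<lambda>t. b t (x (r n t))) \<in> borel_measurable (lebesgue_on S)" for n
  proof -
    have "(\<lambda>t::real. real (Suc n) * t) \<in> borel_measurable (lebesgue_on S)"
      by (intro continuous_imp_measurable_on_sets_lebesgue[OF _ S] continuous_intros)
    then have "(\<lambda>t. \<lfloor>real (Suc n) * t\<rfloor>) \<in> measurable (lebesgue_on S) (count_space UNIV)"
      by (rule measurable_compose[OF _ measurable_real_floor])
    from measurable_compose_countable'[where f = "\<lambda>k t. b t (x (real_of_int k / real (Suc n)))", OF meas this]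
    show ?thesis unfolding r_def by simp
  qed
  have lim_t: "(\<lambda>n. b t (x (r n t))) \<longlonglongrightarrow> b t (x t)" if t: "t \<in> S" for t
  proof -
    have r: "(\<lambda>n. r n t) \<longlonglongrightarrow> t"
    proof (rule tendsto_sandwich[of "\<lambda>n. t - 1 / real (Suc n)" _ _ "\<lambda>n. t"])
      have lo: "t - 1 / real (Suc n) \<le> r n t" and hi: "r n t \<le> t" for n
      proof -
        have "real (Suc n) * t - 1 \<le> real_of_int \<lfloor>real (Suc n) * t\<rfloor>" by linarith
        from divide_right_mono[OF this, of "real (Suc n)"]
        show "t - 1 / real (Suc n) \<le> r n t" by (simp add: diff_divide_distrib r_def)
        have "real_of_int \<lfloor>real (Suc n) * t\<rfloor> \<le> real (Suc n) * t" by linarith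
        from divide_right_mono[OF this, of "real (Suc n)"]
        show "r n t \<le> t" by (simp add: r_def)
      qed
      show "\<forall>\<^sub>F n in sequentially. t - 1 / real (Suc n) \<le> r n t" by (intro always_eventually allI lo)
      show "\<forall>\<^sub>F n in sequentially. r n t \<le> t" by (intro always_eventually allI hi)
      have "(\<lambda>n. t - 1 / real (Suc n)) \<longlonglongrightarrow> t - 0"
        by (intro tendsto_diff tendsto_const LIMSEQ_Suc[OF lim_const_over_n, of 1])
      then show "(\<lambda>n. t - 1 / real (Suc n)) \<longlonglongrightarrow> t" by simp
    qed (rule tendsto_const)
    have "isCont x t" using x by (simp only: continuous_on_eq_continuous_at[OF open_UNIV] UNIV_I ball_UNIV)
    then have "(\<lambda>n. x (r n t)) \<longlonglongrightarrow> x t" using r by (rule isCont_tendsto_compose)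
    from tendsto_mult[OF tendsto_const tendsto_norm[OF LIM_zero[OF this]], of L]
    have lim: "(\<lambda>n. L * norm (x (r n t) - x t)) \<longlonglongrightarrow> 0" by (simp only: norm_zero mult_zero_right)
    have "(\<lambda>n. b t (x (r n t)) - b t (x t)) \<longlonglongrightarrow> 0"
      by (rule Lim_null_comparison[OF always_eventually[OF allI[OF lip[OF t]]] lim])
    then show ?thesis by (rule LIM_zero_cancel)
  qed
  show ?thesis by (rule borel_measurable_LIMSEQ_metric[OF meas_n]) (use lim_t in simp)
qed

lemma integral_norm_le:
  fixes f :: "real \<Rightarrow> 'a::banach"
  assumes "f integrable_on {u..v}" "u \<le> v" "0 \<le> K" "\<And>s. s \<in> {u..v} \<Longrightarrow> norm (f s) \<le> K"
  shows "norm (integral {u..v} f) \<le> K * (v - u)"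
  using has_integral_bound_real[OF assms(3) finite.emptyI integrable_integral[OF assms(1)]] assms by auto

section \<open>The Picard map\<close>

text \<open>
  In the application $\mu = 1 - \alpha$ is the Hoelder exponent of solutions, $\mu + \delta$ that of $g$, and
  $\nu = \min(\lambda, \gamma\mu)$ the exponent in which differences of solutions are measured; the conditions
  on $\alpha$ amount to $1 - \mu < \nu$, that is, to $\nu + (\mu + \delta) > 1$ with room to spare.
\<close>

locale young_equation =
  fixes H M :: real and MN :: "real \<Rightarrow> real" and lam gam L \<mu> \<delta> \<nu> G :: real
    and b :: "real \<Rightarrow> real^'m \<Rightarrow> real^'m" and \<sigma> :: "real \<Rightarrow> real^'m \<Rightarrow> real^'d^'m"
    and g :: "real \<Rightarrow> real^'d"
  assumes sigma: "sigma_condition H M MN lam gam \<sigma>" and b: "b_condition L b"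
    and \<mu>: "0 < \<mu>" "\<mu> < 1" and \<delta>: "0 < \<delta>" "\<mu> + \<delta> \<le> 1"
    and \<nu>: "1 - \<mu> < \<nu>" "\<nu> \<le> \<mu>" "\<nu> \<le> lam" "\<nu> \<le> gam * \<mu>"
    and G: "0 \<le> G" and g: "holder_on 0 1 G (\<mu> + \<delta>) g"
begin

abbreviation "\<theta> \<equiv> \<nu> + (\<mu> + \<delta>)"
abbreviation "sew \<equiv> sewing_const \<theta>"

lemma theta_gt_1: "1 < \<theta>"
  using \<nu> \<delta> by simp

lemma sew_pos: "0 < sew"
  using theta_gt_1 by (rule sewing_const_pos)

lemma M_pos: "0 < M"
  using sigma unfolding sigma_condition_def by blast

lemma L_pos: "0 < L"
  using b unfolding b_condition_def by blast

lemma lam_pos: "0 < lam"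
  using sigma \<nu> \<mu> unfolding sigma_condition_def by auto

lemma gam_pos: "0 < gam"
proof -
  have "0 < gam * \<mu>" using \<nu> \<mu> by linarith
  then show ?thesis using \<mu> by (simp add: zero_less_mult_iff)
qed

lemma drift_lipschitz: "t \<in> {0..1} \<Longrightarrow> norm (b t x - b t y) \<le> L * norm (x - y)"
  using b unfolding b_condition_def by blast

lemma drift_growth: "t \<in> {0..1} \<Longrightarrow> norm (b t x) \<le> L * (1 + norm x)"
  using b unfolding b_condition_def by blast

lemma drift_absolutely_integrable:
  assumes ac: "0 \<le> a" "a \<le> c" "c \<le> 1" and x: "continuous_on {a..c} x"
  shows "(\<lambda>s. b s (x s)) absolutely_integrable_on {a..c}"
proof -
  define x' where "x' s = x (max a (min c s))" for s
  have eq: "x' s = x s" if "s \<in> {a..c}" for s using that by (simp add: x'_def)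
  have cont: "continuous_on UNIV x'"
    unfolding x'_def using ac by (intro continuous_on_compose2[OF x] continuous_intros) auto
  have "(\<lambda>s. b s (x' s)) \<in> borel_measurable (lebesgue_on {0..1})"
  proof (rule caratheodory_measurable[OF _ _ drift_lipschitz cont])
    show "(\<lambda>t. b t x) \<in> borel_measurable (lebesgue_on {0..1})" for x
      using b unfolding b_condition_def by blast
  qed simp_all
  then have meas: "(\<lambda>s. b s (x' s)) \<in> borel_measurable (lebesgue_on {a..c})"
    by (rule measurable_restrict_mono) (use ac in auto)
  have "compact (x ` {a..c})" using x by (intro compact_continuous_image) auto
  then obtain K where K: "\<And>s. s \<in> {a..c} \<Longrightarrow> norm (x s) \<le> K"
    by (meson bounded_iff compact_imp_bounded imageI)
  have "(\<lambda>s. b s (x' s)) absolutely_integrable_on {a..c}"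
  proof (rule measurable_bounded_by_integrable_imp_absolutely_integrable[OF meas])
    show "(\<lambda>s. L * (1 + K)) integrable_on {a..c}" by (rule integrable_const_ivl)
    fix s assume s: "s \<in> {a..c}"
    then have "norm (b s (x' s)) \<le> L * (1 + norm (x' s))" using ac by (intro drift_growth) auto
    also have "\<dots> \<le> L * (1 + K)"
      using K[OF s] eq[OF s] L_pos by simp
    finally show "norm (b s (x' s)) \<le> L * (1 + K)" .
  qed auto
  then show ?thesis
    by (rule absolutely_integrable_spike[OF _ negligible_empty]) (simp add: eq)
qed

lemma drift_integrable:
  assumes "0 \<le> a" "a \<le> c" "c \<le> 1" "continuous_on {a..c} x" "a \<le> u" "v \<le> c"
  shows "(\<lambda>s. b s (x s)) integrable_on {u..v}"
  using integrable_on_subinterval[OF set_lebesgue_integral_eq_integral(1)[OF drift_absolutely_integrable[OF assms(1-4)]]]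
    assms(5,6) by auto

lemma drift_integral_combine:
  assumes "0 \<le> a" "a \<le> c" "c \<le> 1" "continuous_on {a..c} x" "a \<le> u" "u \<le> v" "v \<le> c"
  shows "integral {a..v} (\<lambda>s. b s (x s)) - integral {a..u} (\<lambda>s. b s (x s)) = integral {u..v} (\<lambda>s. b s (x s))"
  using Henstock_Kurzweil_Integration.integral_combine[OF assms(5,6) drift_integrable[OF assms(1-4)]] assms
  by (simp add: algebra_simps)

text \<open>
  Up to its initial value, $y$ is the image of $x$ under the integral operator on the right-hand
  side of the equation. The existential quantifier makes this a local property, stable under
  restriction and concatenation; \<open>picard_image_remainder\<close> recovers an explicit constant.
\<close>

definition picard_image :: "real \<Rightarrow> real \<Rightarrow> (real \<Rightarrow> real^'m) \<Rightarrow> (real \<Rightarrow> real^'m) \<Rightarrow> bool" where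
  "picard_image a c x y \<longleftrightarrow> (\<exists>C. \<forall>u v. a \<le> u \<longrightarrow> u \<le> v \<longrightarrow> v \<le> c \<longrightarrow>
     norm (y v - y u - integral {u..v} (\<lambda>s. b s (x s)) - \<sigma> v (x v) *v (g v - g u))
       \<le> C * (v - u) powr \<theta>)"

lemma picard_imageE:
  assumes "picard_image a c x y"
  obtains C where "0 \<le> C" "\<And>u v. a \<le> u \<Longrightarrow> u \<le> v \<Longrightarrow> v \<le> c \<Longrightarrow>
    norm (y v - y u - integral {u..v} (\<lambda>s. b s (x s)) - \<sigma> v (x v) *v (g v - g u)) \<le> C * (v - u) powr \<theta>"
proof -
  from assms obtain C where C: "\<And>u v. a \<le> u \<Longrightarrow> u \<le> v \<Longrightarrow> v \<le> c \<Longrightarrow>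
    norm (y v - y u - integral {u..v} (\<lambda>s. b s (x s)) - \<sigma> v (x v) *v (g v - g u)) \<le> C * (v - u) powr \<theta>"
    unfolding picard_image_def by auto
  have "C * (v - u) powr \<theta> \<le> max C 0 * (v - u) powr \<theta>" for u v by (intro mult_right_mono) auto
  from order_trans[OF C this] show thesis by (intro that[of "max C 0"]) simp_all
qed

definition davie_solution :: "real \<Rightarrow> real \<Rightarrow> (real \<Rightarrow> real^'m) \<Rightarrow> bool" where
  "davie_solution a c x \<longleftrightarrow> (\<exists>R\<ge>0. holder_on a c R \<mu> x) \<and> picard_image a c x x"

text \<open>
  The factor $h^{\mu-\nu}$ in front of $R$ is kept because it lets the a priori bound work with the
  power $h^\mu$ rather than $h^\nu$, which yields the exponent $\kappa = 1/(1-\alpha)$.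
\<close>

lemma diffusion_holder:
  assumes ac: "0 \<le> a" "c \<le> 1" "c - a \<le> h" and x: "holder_on a c R \<mu> x" "0 \<le> R"
  shows "holder_on a c (M + M * R * h powr (\<mu> - \<nu>)) \<nu> (\<lambda>s. \<sigma> s (x s))"
proof (rule holder_onI)
  fix u v assume uv: "a \<le> u" "u \<le> v" "v \<le> c"
  have "norm (\<sigma> v (x v) - \<sigma> u (x u)) \<le> M * (v - u) powr lam + M * norm (x v - x u)"
    using sigma_increment[OF sigma, of u v "x v" "x u"] uv ac by simp
  also have "(v - u) powr lam \<le> (v - u) powr \<nu>"
    using uv ac \<nu> by (intro powr_mono') auto
  also have "norm (x v - x u) \<le> R * h powr (\<mu> - \<nu>) * (v - u) powr \<nu>"
    using holder_on_lower_exponent[OF x ac(3) \<nu>(2)] uv by (rule holder_onD)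
  finally show "norm (\<sigma> v (x v) - \<sigma> u (x u)) \<le> (M + M * R * h powr (\<mu> - \<nu>)) * (v - u) powr \<nu>"
    using M_pos by (simp add: algebra_simps mult_le_cancel_left)
qed

lemma young_almost_additive_on:
  fixes F :: "real \<Rightarrow> real^'d^'m"
  assumes ac: "0 \<le> a" "c \<le> 1" and F: "holder_on a c K \<nu> F" "0 \<le> K"
  shows "almost_additive a c (K * G) \<theta> (\<lambda>u v. F v *v (g v - g u))"
proof (rule young_almost_additive)
  fix u v assume "a < u" "u \<le> v" "v \<le> c"
  then show "norm (F v - F u) \<le> K * (v - u) powr \<nu>" using holder_onD[OF F(1)] by simp
next
  show "holder_on a c G (\<mu> + \<delta>) g" using g ac by (rule holder_on_subinterval)
qed (use F G \<nu> \<mu> \<delta> in auto)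

lemma picard_image_exists:
  assumes ac: "0 \<le> a" "a \<le> c" "c \<le> 1" and x: "holder_on a c R \<mu> x" "0 \<le> R"
  shows "\<exists>y. y a = \<xi> \<and> picard_image a c x y"
proof -
  let ?K = "M + M * R * 1 powr (\<mu> - \<nu>)"
  have F: "holder_on a c ?K \<nu> (\<lambda>s. \<sigma> s (x s))"
    using ac x by (intro diffusion_holder) auto
  have K: "0 \<le> ?K" using M_pos x by simp
  obtain Y C where Y: "\<And>u v. a \<le> u \<Longrightarrow> u \<le> v \<Longrightarrow> v \<le> c \<Longrightarrow>
      norm (Y v - Y u - \<sigma> v (x v) *v (g v - g u)) \<le> C * (v - u) powr \<theta>"
    using sewing_exists[OF young_almost_additive_on[OF ac(1,3) F K] theta_gt_1 _ ac(2)] K G by auto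
  define y where "y v = \<xi> + integral {a..v} (\<lambda>s. b s (x s)) + (Y v - Y a)" for v
  have cont: "continuous_on {a..c} x" using x(1) \<mu>(1) by (rule holder_on_imp_continuous_on)
  have "picard_image a c x y"
    unfolding picard_image_def
  proof (intro exI allI impI)
    fix u v assume uv: "a \<le> u" "u \<le> v" "v \<le> c"
    have "y v - y u - integral {u..v} (\<lambda>s. b s (x s)) = Y v - Y u"
      using drift_integral_combine[OF ac cont uv, symmetric] by (simp add: y_def)
    then show "norm (y v - y u - integral {u..v} (\<lambda>s. b s (x s)) - \<sigma> v (x v) *v (g v - g u))
        \<le> C * (v - u) powr \<theta>" using Y[OF uv] by simp
  qed
  moreover have "y a = \<xi>" by (simp add: y_def)
  ultimately show ?thesis by blast
qed

lemma picard_image_remainder: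
  assumes ac: "0 \<le> a" "a \<le> c" "c \<le> 1" "c - a \<le> h" and x: "holder_on a c R \<mu> x" "0 \<le> R"
    and y: "picard_image a c x y" and uv: "a \<le> u" "u \<le> v" "v \<le> c"
  shows "norm (y v - y u - integral {u..v} (\<lambda>s. b s (x s)) - \<sigma> v (x v) *v (g v - g u))
    \<le> sew * ((M + M * R * h powr (\<mu> - \<nu>)) * G) * (v - u) powr \<theta>"
proof -
  have cont: "continuous_on {a..c} x" using x(1) \<mu>(1) by (rule holder_on_imp_continuous_on)
  define Y where "Y v = y v - integral {a..v} (\<lambda>s. b s (x s))" for v
  have Y: "Y v - Y u = y v - y u - integral {u..v} (\<lambda>s. b s (x s))" if "a \<le> u" "u \<le> v" "v \<le> c" for u v
    using drift_integral_combine[OF ac(1-3) cont that, symmetric] by (simp add: Y_def)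
  obtain C where C: "\<And>u v. a \<le> u \<Longrightarrow> u \<le> v \<Longrightarrow> v \<le> c \<Longrightarrow>
      norm (y v - y u - integral {u..v} (\<lambda>s. b s (x s)) - \<sigma> v (x v) *v (g v - g u)) \<le> C * (v - u) powr \<theta>"
    using y unfolding picard_image_def by auto
  have Y_bound: "norm (Y v - Y u - \<sigma> v (x v) *v (g v - g u)) \<le> C * (v - u) powr \<theta>"
    if "a \<le> u" "u \<le> v" "v \<le> c" for u v
    using C[OF that] Y[OF that] by simp
  have K: "0 \<le> M + M * R * h powr (\<mu> - \<nu>)" using M_pos x by simp
  have "norm (Y v - Y u - \<sigma> v (x v) *v (g v - g u)) \<le> sew * ((M + M * R * h powr (\<mu> - \<nu>)) * G) * (v - u) powr \<theta>"
    using young_almost_additive_on[OF ac(1,3) diffusion_holder[OF ac(1,3,4) x] K] theta_gt_1 _ Y_bound uv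
    by (rule sewing_bound) (use K G in simp)
  then show ?thesis using Y[OF uv] by simp
qed

lemma holder_path_norm_le:
  assumes x: "holder_on a c R \<mu> x" "0 \<le> R" and s: "s \<in> {a..c}" "c - a \<le> h"
  shows "norm (x s) \<le> norm (x a) + R * h powr \<mu>"
proof -
  have "norm (x s) \<le> norm (x a) + norm (x s - x a)" by (rule norm_triangle_sub)
  also have "norm (x s - x a) \<le> R * (s - a) powr \<mu>" using s by (intro holder_onD[OF x(1)]) auto
  also have "\<dots> \<le> R * h powr \<mu>" using s x(2) \<mu> by (intro mult_left_mono powr_mono2) auto
  finally show ?thesis by simp
qed

text \<open>
  The factor of $G$ in the bound of a Young integral: the growth constant of $\sigma$ for
  the leading term and the sewing constant for the remainder.
\<close>

definition diffusion_const :: real where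
  "diffusion_const = norm (\<sigma> 0 0) + M + sew * M"

lemma diffusion_const_nonneg: "0 \<le> diffusion_const"
  using M_pos sew_pos by (simp add: diffusion_const_def)

text \<open>
  Drift, leading term and sewing remainder each contribute to the $\mu$-Hoelder constant of $y$ at
  most $1 + |x_a| + R h^\mu \ge 1 + \sup |x|$ times a positive power of $h$. With $y = x$ this is the a priori
  estimate, and with $R = 1$ it shows that the Picard map preserves a ball.
\<close>

lemma increment_estimate:
  assumes ac: "0 \<le> a" "a \<le> c" "c \<le> 1" "c - a \<le> h" "h \<le> 1" and x: "holder_on a c R \<mu> x" "0 \<le> R"
    and y: "picard_image a c x y"
  shows "holder_on a c ((1 + norm (x a) + R * h powr \<mu>) *
      (L * h powr (1 - \<mu>) + diffusion_const * G * h powr \<delta>)) \<mu> y"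
proof (rule holder_onI)
  fix u v assume uv: "a \<le> u" "u \<le> v" "v \<le> c"
  define d where "d = v - u"
  define X where "X = 1 + norm (x a) + R * h powr \<mu>"
  define A where "A = norm (\<sigma> 0 0) + M"
  have cont: "continuous_on {a..c} x" using x(1) \<mu>(1) by (rule holder_on_imp_continuous_on)
  have d: "0 \<le> d" "d \<le> h" "v - u = d" using uv ac by (auto simp: d_def)
  have X: "1 \<le> X" "1 + R * h powr \<mu> \<le> X" using x(2) by (simp_all add: X_def)
  have A: "0 \<le> A" using M_pos by (simp add: A_def)
  have xs: "1 + norm (x s) \<le> X" if "s \<in> {a..c}" for s
    using holder_path_norm_le[OF x that ac(4)] by (simp add: X_def)
  have scale: "d powr q \<le> h powr (q - \<mu>) * d powr \<mu>" if "\<mu> \<le> q" for q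
    using d that by (intro powr_le_scaled) auto
  have 1: "norm (integral {u..v} (\<lambda>s. b s (x s))) \<le> L * X * (h powr (1 - \<mu>) * d powr \<mu>)"
  proof -
    have "norm (integral {u..v} (\<lambda>s. b s (x s))) \<le> L * X * (v - u)"
    proof (rule integral_norm_le)
      show "(\<lambda>s. b s (x s)) integrable_on {u..v}" using drift_integrable[OF ac(1-3) cont] uv by auto
      fix s assume s: "s \<in> {u..v}"
      have "norm (b s (x s)) \<le> L * (1 + norm (x s))" using s uv ac by (intro drift_growth) auto
      also have "\<dots> \<le> L * X" using xs[of s] s uv L_pos by (intro mult_left_mono) auto
      finally show "norm (b s (x s)) \<le> L * X" .
    qed (use uv L_pos X in auto)
    also have "v - u \<le> h powr (1 - \<mu>) * d powr \<mu>" using scale[of 1] d \<mu> by simp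
    finally show ?thesis using L_pos X by (simp add: mult_left_mono)
  qed
  have 2: "norm (\<sigma> v (x v) *v (g v - g u)) \<le> A * X * (G * (h powr \<delta> * d powr \<mu>))"
  proof -
    have "norm (\<sigma> v (x v)) \<le> A * (1 + norm (x v))"
      unfolding A_def using uv ac lam_pos by (intro sigma_growth[OF sigma]) auto
    also have "\<dots> \<le> A * X" using xs[of v] uv A by (intro mult_left_mono) auto
    finally have s: "norm (\<sigma> v (x v)) \<le> A * X" .
    have "norm (g v - g u) \<le> G * d powr (\<mu> + \<delta>)" using holder_onD[OF g, of u v] uv ac d by simp
    also have "\<dots> \<le> G * (h powr \<delta> * d powr \<mu>)" using scale[of "\<mu> + \<delta>"] G \<delta> by (intro mult_left_mono) auto
    finally show ?thesis
      using s A X by (intro order_trans[OF norm_matrix_vector_mult_le] mult_mono) auto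
  qed
  have 3: "norm (y v - y u - integral {u..v} (\<lambda>s. b s (x s)) - \<sigma> v (x v) *v (g v - g u))
      \<le> sew * M * X * (G * (h powr \<delta> * d powr \<mu>))"
  proof -
    have "norm (y v - y u - integral {u..v} (\<lambda>s. b s (x s)) - \<sigma> v (x v) *v (g v - g u))
        \<le> sew * ((M + M * R * h powr (\<mu> - \<nu>)) * G) * d powr \<theta>"
      using picard_image_remainder[OF ac(1-4) x y uv] d by simp
    also have "\<dots> \<le> sew * ((M + M * R * h powr (\<mu> - \<nu>)) * G) * (h powr (\<nu> + \<delta>) * d powr \<mu>)"
      using scale[of \<theta>] \<nu> \<mu> \<delta> sew_pos M_pos G x(2) by (intro mult_left_mono) (auto simp: add_ac)
    also have "\<dots> = sew * M * (h powr \<nu> + R * (h powr (\<mu> - \<nu>) * h powr \<nu>)) * (G * (h powr \<delta> * d powr \<mu>))"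
      by (simp add: powr_add algebra_simps)
    also have "h powr (\<mu> - \<nu>) * h powr \<nu> = h powr \<mu>" by (simp flip: powr_add)
    also have "sew * M * (h powr \<nu> + R * h powr \<mu>) * (G * (h powr \<delta> * d powr \<mu>))
        \<le> sew * M * X * (G * (h powr \<delta> * d powr \<mu>))"
    proof -
      have "h powr \<nu> \<le> 1" using d ac \<nu> \<mu> by (intro powr_le1) auto
      then show ?thesis using X sew_pos M_pos G by (intro mult_right_mono mult_left_mono) auto
    qed
    finally show ?thesis .
  qed
  have "y v - y u = (y v - y u - integral {u..v} (\<lambda>s. b s (x s)) - \<sigma> v (x v) *v (g v - g u))
      + \<sigma> v (x v) *v (g v - g u) + integral {u..v} (\<lambda>s. b s (x s))" by simp
  also have "norm \<dots> \<le> sew * M * X * (G * (h powr \<delta> * d powr \<mu>)) + A * X * (G * (h powr \<delta> * d powr \<mu>))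
      + L * X * (h powr (1 - \<mu>) * d powr \<mu>)"
    by (intro norm_triangle_mono 1 2 3)
  also have "\<dots> = X * (L * h powr (1 - \<mu>) + (A + sew * M) * G * h powr \<delta>) * d powr \<mu>"
    by (simp add: algebra_simps)
  finally show "norm (y v - y u) \<le> (1 + norm (x a) + R * h powr \<mu>) *
      (L * h powr (1 - \<mu>) + diffusion_const * G * h powr \<delta>) * (v - u) powr \<mu>"
    by (simp add: X_def A_def d_def diffusion_const_def)
qed

text \<open>
  The contraction. With $z = x_1 - x_2$, the difference of the integrands
  $\sigma(s,x_1(s)) - \sigma(s,x_2(s))$ is $\nu$-Hoelder with a constant proportional to $Z$ by
  \<open>sigma_four_point\<close>: the term $|x_2(v) - x_2(u)|^\gamma$ is of order $(v-u)^{\gamma\mu}$ and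
  $\gamma\mu \ge \nu$. The sewing bound turns this into a bound for the integrals, and the spare exponent
  $\delta$ produces the factor $h^\delta$.
\<close>

lemma difference_estimate:
  assumes ac: "0 \<le> a" "a \<le> c" "c \<le> 1" "c - a \<le> h" "h \<le> 1"
    and x1: "holder_on a c R \<mu> x\<^sub>1" and x2: "holder_on a c R \<mu> x\<^sub>2" and R: "0 \<le> R"
    and y1: "picard_image a c x\<^sub>1 y\<^sub>1" and y2: "picard_image a c x\<^sub>2 y\<^sub>2"
    and N: "0 < N" "\<And>s. s \<in> {a..c} \<Longrightarrow> norm (x\<^sub>1 s) \<le> N" "\<And>s. s \<in> {a..c} \<Longrightarrow> norm (x\<^sub>2 s) \<le> N"
    and start: "x\<^sub>1 a = x\<^sub>2 a" and z: "holder_on a c Z \<nu> (\<lambda>s. x\<^sub>1 s - x\<^sub>2 s)" and Z: "0 \<le> Z"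
    and E: "E = M + CARD('m) * (M + MN (3 * N) * R powr gam)"
  shows "holder_on a c ((L + M * G + sew * E * G) * h powr \<delta> * Z) \<nu> (\<lambda>s. y\<^sub>1 s - y\<^sub>2 s)"
proof -
  define z where "z s = x\<^sub>1 s - x\<^sub>2 s" for s
  define D where "D s = \<sigma> s (x\<^sub>1 s) - \<sigma> s (x\<^sub>2 s)" for s
  have cont1: "continuous_on {a..c} x\<^sub>1" using x1 \<mu>(1) by (rule holder_on_imp_continuous_on)
  have cont2: "continuous_on {a..c} x\<^sub>2" using x2 \<mu>(1) by (rule holder_on_imp_continuous_on)
  have MN0: "0 < MN (3 * N)" using sigma N(1) unfolding sigma_condition_def by auto
  have E0: "0 \<le> E" using M_pos MN0 unfolding E by simp
  have z_le: "norm (z s) \<le> Z" if s: "s \<in> {a..c}" for s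
  proof -
    have "norm (z s) \<le> Z * (s - a) powr \<nu>"
      using holder_onD[OF z, of a s] s start by (simp add: z_def)
    also have "\<dots> \<le> Z * 1" using s ac \<nu> \<mu> Z by (intro mult_left_mono powr_le1) auto
    finally show ?thesis by simp
  qed
  have D_holder: "holder_on a c (E * Z) \<nu> D"
  proof (rule holder_onI)
    fix u v assume uv: "a \<le> u" "u \<le> v" "v \<le> c"
    let ?d = "(v - u) powr \<nu>"
    have d1: "(v - u) powr lam \<le> ?d" using uv ac \<nu> by (intro powr_mono') auto
    have "norm (x\<^sub>2 v - x\<^sub>2 u) powr gam \<le> (R * (v - u) powr \<mu>) powr gam"
      using holder_onD[OF x2 uv] gam_pos by (intro powr_mono2) auto
    also have "\<dots> = R powr gam * (v - u) powr (gam * \<mu>)"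
      using R by (simp add: powr_mult powr_powr mult.commute)
    also have "\<dots> \<le> R powr gam * ?d"
      using uv ac \<nu> by (intro mult_left_mono powr_mono') auto
    finally have d2: "norm (x\<^sub>2 v - x\<^sub>2 u) powr gam \<le> R powr gam * ?d" .
    have "norm (D v - D u) \<le> M * norm (z v - z u)
        + CARD('m) * (M * \<bar>v - u\<bar> powr lam + MN (3 * N) * norm (x\<^sub>2 v - x\<^sub>2 u) powr gam) * norm (z u)"
      unfolding D_def z_def using uv ac N by (intro sigma_four_point[OF sigma]) auto
    also have "\<dots> \<le> M * (Z * ?d) + CARD('m) * (M * ?d + MN (3 * N) * (R powr gam * ?d)) * Z"
      using holder_onD[OF z uv] z_le[of u] d1 d2 uv M_pos MN0
      by (intro add_mono mult_mono mult_left_mono) (auto simp: z_def)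
    also have "\<dots> = E * Z * ?d" unfolding E by (simp add: algebra_simps)
    finally show "norm (D v - D u) \<le> E * Z * ?d" .
  qed
  define Y where "Y v = (y\<^sub>1 v - integral {a..v} (\<lambda>s. b s (x\<^sub>1 s))) - (y\<^sub>2 v - integral {a..v} (\<lambda>s. b s (x\<^sub>2 s)))" for v
  have Y: "Y v - Y u = (y\<^sub>1 v - y\<^sub>1 u - integral {u..v} (\<lambda>s. b s (x\<^sub>1 s)))
      - (y\<^sub>2 v - y\<^sub>2 u - integral {u..v} (\<lambda>s. b s (x\<^sub>2 s)))" if "a \<le> u" "u \<le> v" "v \<le> c" for u v
    using drift_integral_combine[OF ac(1-3) cont1 that, symmetric] drift_integral_combine[OF ac(1-3) cont2 that, symmetric]
    by (simp add: Y_def)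
  obtain C1 where C1: "\<And>u v. a \<le> u \<Longrightarrow> u \<le> v \<Longrightarrow> v \<le> c \<Longrightarrow>
      norm (y\<^sub>1 v - y\<^sub>1 u - integral {u..v} (\<lambda>s. b s (x\<^sub>1 s)) - \<sigma> v (x\<^sub>1 v) *v (g v - g u)) \<le> C1 * (v - u) powr \<theta>"
    using y1 unfolding picard_image_def by auto
  obtain C2 where C2: "\<And>u v. a \<le> u \<Longrightarrow> u \<le> v \<Longrightarrow> v \<le> c \<Longrightarrow>
      norm (y\<^sub>2 v - y\<^sub>2 u - integral {u..v} (\<lambda>s. b s (x\<^sub>2 s)) - \<sigma> v (x\<^sub>2 v) *v (g v - g u)) \<le> C2 * (v - u) powr \<theta>"
    using y2 unfolding picard_image_def by auto
  have Y_bound: "norm (Y v - Y u - D v *v (g v - g u)) \<le> (C1 + C2) * (v - u) powr \<theta>"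
    if uv: "a \<le> u" "u \<le> v" "v \<le> c" for u v
  proof -
    have "Y v - Y u - D v *v (g v - g u)
        = (y\<^sub>1 v - y\<^sub>1 u - integral {u..v} (\<lambda>s. b s (x\<^sub>1 s)) - \<sigma> v (x\<^sub>1 v) *v (g v - g u))
          - (y\<^sub>2 v - y\<^sub>2 u - integral {u..v} (\<lambda>s. b s (x\<^sub>2 s)) - \<sigma> v (x\<^sub>2 v) *v (g v - g u))"
      unfolding Y[OF uv] D_def by (simp add: matrix_vector_mult_diff_rdistrib)
    also have "norm \<dots> \<le> C1 * (v - u) powr \<theta> + C2 * (v - u) powr \<theta>"
      by (intro order_trans[OF norm_triangle_ineq4] add_mono C1 C2 uv)
    finally show ?thesis by (simp add: algebra_simps)
  qed
  show ?thesis
  proof (rule holder_onI)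
    fix u v assume uv: "a \<le> u" "u \<le> v" "v \<le> c"
    define d where "d = v - u"
    have d: "0 \<le> d" "d \<le> h" "d \<le> 1" "v - u = d" using uv ac by (auto simp: d_def)
    have scale: "d powr q \<le> h powr \<delta> * d powr \<nu>" if "\<nu> + \<delta> \<le> q" for q
    proof -
      have "d powr q \<le> d powr (\<nu> + \<delta>)" using d that by (intro powr_mono') auto
      also have "\<dots> \<le> h powr \<delta> * d powr \<nu>" using powr_le_scaled[of d h \<nu> "\<nu> + \<delta>"] d \<delta> by simp
      finally show ?thesis .
    qed
    have 1: "norm (integral {u..v} (\<lambda>s. b s (x\<^sub>1 s)) - integral {u..v} (\<lambda>s. b s (x\<^sub>2 s))) \<le> L * Z * (h powr \<delta> * d powr \<nu>)"
    proof -
      have int: "(\<lambda>s. b s (x\<^sub>1 s)) integrable_on {u..v}" "(\<lambda>s. b s (x\<^sub>2 s)) integrable_on {u..v}"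
        using drift_integrable[OF ac(1-3) cont1] drift_integrable[OF ac(1-3) cont2] uv by auto
      have "norm (integral {u..v} (\<lambda>s. b s (x\<^sub>1 s) - b s (x\<^sub>2 s))) \<le> L * Z * (v - u)"
      proof (rule integral_norm_le)
        fix s assume s: "s \<in> {u..v}"
        have "norm (b s (x\<^sub>1 s) - b s (x\<^sub>2 s)) \<le> L * norm (x\<^sub>1 s - x\<^sub>2 s)" using s uv ac by (intro drift_lipschitz) auto
        also have "\<dots> \<le> L * Z" using z_le[of s] s uv L_pos by (intro mult_left_mono) (auto simp: z_def)
        finally show "norm (b s (x\<^sub>1 s) - b s (x\<^sub>2 s)) \<le> L * Z" .
      qed (use uv L_pos Z int in \<open>auto intro: integrable_diff\<close>)
      also have "v - u \<le> h powr \<delta> * d powr \<nu>" using scale[of 1] d \<nu> \<delta> by simp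
      finally show ?thesis using L_pos Z int by (simp add: mult_left_mono integral_diff)
    qed
    have 2: "norm (D v *v (g v - g u)) \<le> M * Z * (G * (h powr \<delta> * d powr \<nu>))"
    proof -
      have "norm (D v) \<le> M * norm (z v)"
        using sigma_increment[OF sigma, of v v "x\<^sub>1 v" "x\<^sub>2 v"] uv ac by (simp add: D_def z_def)
      also have "\<dots> \<le> M * Z" using z_le[of v] uv M_pos by (intro mult_left_mono) auto
      finally have s: "norm (D v) \<le> M * Z" .
      have "norm (g v - g u) \<le> G * d powr (\<mu> + \<delta>)" using holder_onD[OF g, of u v] uv ac d by simp
      also have "\<dots> \<le> G * (h powr \<delta> * d powr \<nu>)" using scale[of "\<mu> + \<delta>"] G \<nu> by (intro mult_left_mono) auto
      finally show ?thesis
        using s M_pos Z by (intro order_trans[OF norm_matrix_vector_mult_le] mult_mono) auto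
    qed
    have 3: "norm (Y v - Y u - D v *v (g v - g u)) \<le> sew * (E * Z * G) * (h powr \<delta> * d powr \<nu>)"
    proof -
      have "norm (Y v - Y u - D v *v (g v - g u)) \<le> sew * (E * Z * G) * (v - u) powr \<theta>"
        using young_almost_additive_on[OF ac(1,3) D_holder] theta_gt_1 _ Y_bound uv
        by (rule sewing_bound) (use E0 Z G in auto)
      also have "\<dots> \<le> sew * (E * Z * G) * (h powr \<delta> * d powr \<nu>)"
        using scale[of \<theta>] d \<mu> sew_pos E0 Z G by (intro mult_left_mono) auto
      finally show ?thesis .
    qed
    have "(y\<^sub>1 v - y\<^sub>2 v) - (y\<^sub>1 u - y\<^sub>2 u) = (Y v - Y u - D v *v (g v - g u)) + D v *v (g v - g u)
        + (integral {u..v} (\<lambda>s. b s (x\<^sub>1 s)) - integral {u..v} (\<lambda>s. b s (x\<^sub>2 s)))"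
      unfolding Y[OF uv] by simp
    also have "norm \<dots> \<le> sew * (E * Z * G) * (h powr \<delta> * d powr \<nu>) + M * Z * (G * (h powr \<delta> * d powr \<nu>))
        + L * Z * (h powr \<delta> * d powr \<nu>)"
      by (intro norm_triangle_mono 1 2 3)
    also have "\<dots> = (L + M * G + sew * E * G) * h powr \<delta> * Z * (v - u) powr \<nu>"
      by (simp add: algebra_simps d_def)
    finally show "norm ((y\<^sub>1 v - y\<^sub>2 v) - (y\<^sub>1 u - y\<^sub>2 u)) \<le> (L + M * G + sew * E * G) * h powr \<delta> * Z * (v - u) powr \<nu>" .
  qed
qed

section \<open>Uniqueness and local existence\<close>

lemma picard_image_cong:
  assumes "picard_image a c x y" and eq: "\<And>s. s \<in> {a..c} \<Longrightarrow> x' s = x s" "\<And>s. s \<in> {a..c} \<Longrightarrow> y' s = y s"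
  shows "picard_image a c x' y'"
proof -
  obtain C where "0 \<le> C" and C: "\<And>u v. a \<le> u \<Longrightarrow> u \<le> v \<Longrightarrow> v \<le> c \<Longrightarrow>
    norm (y v - y u - integral {u..v} (\<lambda>s. b s (x s)) - \<sigma> v (x v) *v (g v - g u)) \<le> C * (v - u) powr \<theta>"
    by (rule picard_imageE[OF assms(1)]) (rule that)
  have "norm (y' v - y' u - integral {u..v} (\<lambda>s. b s (x' s)) - \<sigma> v (x' v) *v (g v - g u)) \<le> C * (v - u) powr \<theta>"
    if uv: "a \<le> u" "u \<le> v" "v \<le> c" for u v
  proof -
    have "integral {u..v} (\<lambda>s. b s (x' s)) = integral {u..v} (\<lambda>s. b s (x s))"
      using uv eq(1) by (intro Henstock_Kurzweil_Integration.integral_cong) auto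
    then show ?thesis using C[OF uv] eq[of u] eq[of v] uv by simp
  qed
  then show ?thesis unfolding picard_image_def by (intro exI[of _ C]) simp
qed

lemma picard_image_subinterval:
  assumes "picard_image a c x y" "a \<le> a'" "c' \<le> c"
  shows "picard_image a' c' x y"
proof -
  obtain C where "0 \<le> C" and "\<And>u v. a \<le> u \<Longrightarrow> u \<le> v \<Longrightarrow> v \<le> c \<Longrightarrow>
    norm (y v - y u - integral {u..v} (\<lambda>s. b s (x s)) - \<sigma> v (x v) *v (g v - g u)) \<le> C * (v - u) powr \<theta>"
    by (rule picard_imageE[OF assms(1)]) (rule that)
  then show ?thesis using assms(2,3) unfolding picard_image_def by (intro exI[of _ C]) simp
qed

lemma small_step_exists:
  assumes "0 \<le> Q"
  obtains h where "0 < h" "h \<le> 1" "Q * h powr \<delta> \<le> 1 / 2"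
proof -
  define h where "h = (1 / (2 * (Q + 1))) powr (1 / \<delta>)"
  have "h powr \<delta> = 1 / (2 * (Q + 1))" using assms \<delta> by (simp add: h_def powr_powr)
  moreover have "Q * (1 / (2 * (Q + 1))) \<le> 1 / 2" using assms by (simp add: field_simps)
  ultimately have "Q * h powr \<delta> \<le> 1 / 2" by simp
  moreover have "0 < h" "h \<le> 1"
    using assms \<delta> unfolding h_def by (auto intro!: powr_le1)
  ultimately show thesis using that by blast
qed

text \<open>
  Two solutions are their own Picard images, so \<open>difference_estimate\<close> bounds the seminorm of
  their difference by half of itself.
\<close>

lemma davie_solution_unique_local:
  assumes ac: "0 \<le> a" "a \<le> c" "c \<le> 1" "c - a \<le> h" "h \<le> 1"
    and x: "holder_on a c R \<mu> x" "picard_image a c x x" and y: "holder_on a c R \<mu> y" "picard_image a c y y"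
    and R: "0 \<le> R" and N: "0 < N" "\<And>s. s \<in> {a..c} \<Longrightarrow> norm (x s) \<le> N" "\<And>s. s \<in> {a..c} \<Longrightarrow> norm (y s) \<le> N"
    and E: "E = M + CARD('m) * (M + MN (3 * N) * R powr gam)"
    and h: "(L + M * G + sew * E * G) * h powr \<delta> \<le> 1 / 2"
    and start: "x a = y a" and t: "t \<in> {a..c}"
  shows "x t = y t"
proof -
  define z where "z s = x s - y s" for s
  have "holder_on a c (0 / (1 - 1 / 2)) \<nu> z"
  proof (rule holder_on_self_improving)
    have "holder_on a c R \<nu> x" "holder_on a c R \<nu> y"
      using ac \<nu> by (auto intro: holder_on_lower_exponent_unit[OF _ R] x(1) y(1))
    then show "holder_on a c (R + R) \<nu> z"
      unfolding z_def by (rule holder_on_diff)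
    fix C :: real assume C: "0 \<le> C" "holder_on a c C \<nu> z"
    have "holder_on a c ((L + M * G + sew * E * G) * h powr \<delta> * C) \<nu> z"
      using C(2) unfolding z_def
      by (intro difference_estimate[OF ac x(1) y(1) R x(2) y(2) N start _ C(1) E])
    then show "holder_on a c (0 + 1 / 2 * C) \<nu> z"
      by (rule holder_on_mono) (use mult_right_mono[OF h C(1)] in simp)
  qed (use R in auto)
  then have "norm (z t - z a) \<le> 0 / (1 - 1 / 2) * (t - a) powr \<nu>"
    by (rule holder_onD) (use t in auto)
  then show ?thesis using start by (simp add: z_def)
qed

lemma davie_solution_unique:
  assumes x: "davie_solution 0 1 x" and y: "davie_solution 0 1 y" and start: "x 0 = y 0" and t: "t \<in> {0..1}"
  shows "x t = y t"
proof -
  obtain R1 where R1: "0 \<le> R1" "holder_on 0 1 R1 \<mu> x" using x unfolding davie_solution_def by blast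
  obtain R2 where R2: "0 \<le> R2" "holder_on 0 1 R2 \<mu> y" using y unfolding davie_solution_def by blast
  define R where "R = max R1 R2"
  have R: "0 \<le> R" "holder_on 0 1 R \<mu> x" "holder_on 0 1 R \<mu> y"
    using R1 R2 by (auto simp: R_def intro: holder_on_mono)
  define N where "N = norm (x 0) + R + 1"
  have N: "0 < N" "\<And>s. s \<in> {0..1} \<Longrightarrow> norm (x s) \<le> N" "\<And>s. s \<in> {0..1} \<Longrightarrow> norm (y s) \<le> N"
  proof -
    show "0 < N" using R(1) by (simp add: N_def add_nonneg_pos)
    show "norm (x s) \<le> N" if "s \<in> {0..1}" for s
      using holder_path_norm_le[OF R(2,1) that, of 1] by (simp add: N_def)
    show "norm (y s) \<le> N" if "s \<in> {0..1}" for s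
      using holder_path_norm_le[OF R(3,1) that, of 1] by (simp add: N_def start)
  qed
  define E where "E = M + CARD('m) * (M + MN (3 * N) * R powr gam)"
  have "0 < MN (3 * N)" using sigma N(1) unfolding sigma_condition_def by auto
  then have "0 \<le> E" using M_pos by (simp add: E_def)
  then have "0 \<le> L + M * G + sew * E * G" using L_pos M_pos G sew_pos by simp
  then obtain h where h: "0 < h" "h \<le> 1" "(L + M * G + sew * E * G) * h powr \<delta> \<le> 1 / 2"
    using small_step_exists by blast
  have P: "picard_image a c x x" "picard_image a c y y" if "0 \<le> a" "c \<le> 1" for a c
    using x y that unfolding davie_solution_def by (auto intro: picard_image_subinterval)
  have eq: "\<forall>t\<in>{0..min 1 (real k * h)}. x t = y t" for k
  proof (induction k)
    case 0
    then show ?case using start by simp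
  next
    case (Suc k)
    define a where "a = min 1 (real k * h)"
    define c where "c = min 1 (real (Suc k) * h)"
    have ac: "0 \<le> a" "a \<le> c" "c \<le> 1" "c - a \<le> h"
      using h by (auto simp: a_def c_def algebra_simps min_def)
    have "x s = y s" if "s \<in> {a..c}" for s
    proof (rule davie_solution_unique_local[OF ac h(2) _ P(1)[OF ac(1,3)] _ P(2)[OF ac(1,3)] R(1) N(1) _ _ E_def h(3) _ that])
      show "holder_on a c R \<mu> x" "holder_on a c R \<mu> y"
        using R(2,3) ac(1,3) by (auto intro: holder_on_subinterval)
      show "norm (x s) \<le> N" "norm (y s) \<le> N" if "s \<in> {a..c}" for s
        using N(2,3)[of s] that ac by auto
      show "x a = y a" using Suc ac(1) unfolding a_def[symmetric] by simp
    qed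
    moreover have "s \<in> {0..a} \<or> s \<in> {a..c}" if "s \<in> {0..c}" for s using that by auto
    ultimately show ?case using Suc unfolding a_def[symmetric] c_def[symmetric] by blast
  qed
  obtain k :: nat where "1 / h < k" using reals_Archimedean2 by blast
  then have "min 1 (real k * h) = 1" using h by (simp add: field_simps min_def)
  then show ?thesis using eq[of k] t by simp
qed

text \<open>
  Picard iteration in the ball of paths starting at $\xi$ with $\mu$-Hoelder constant $1$, on which
  the Picard map contracts $\nu$-Hoelder distances by the factor $1/2$. To identify the limit $x$ of
  the iterates $X_n$ as a solution, let $y$ be the Picard image of $x$: contraction bounds the distance
  of $y$ from $X_{n+1}$ by half that of $x$ from $X_n$, so $y = x$.
\<close>

lemma local_solution_exists:
  assumes N: "0 < N"
  shows "\<exists>h. 0 < h \<and> (\<forall>a c \<xi>. 0 \<le> a \<and> a \<le> c \<and> c \<le> 1 \<and> c - a \<le> h \<and> norm \<xi> \<le> N \<longrightarrow>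
           (\<exists>x. x a = \<xi> \<and> davie_solution a c x))"
proof -
  define E where "E = M + CARD('m) * (M + MN (3 * (N + 1)) * 1 powr gam)"
  define Q1 where "Q1 = (2 + N) * (L + diffusion_const * G)"
  define Q2 where "Q2 = L + M * G + sew * E * G"
  have "0 < MN (3 * (N + 1))" using sigma N unfolding sigma_condition_def by auto
  then have Q: "0 \<le> Q1" "0 \<le> Q2"
    using M_pos L_pos G N sew_pos diffusion_const_nonneg by (simp_all add: E_def Q1_def Q2_def)
  then obtain h where h: "0 < h" "h \<le> 1" and "(Q1 + Q2) * h powr \<delta> \<le> 1 / 2"
    using small_step_exists[of "Q1 + Q2"] by auto
  moreover have "0 \<le> Q1 * h powr \<delta>" "0 \<le> Q2 * h powr \<delta>" using Q by simp_all
  ultimately have Qh: "Q1 * h powr \<delta> \<le> 1" "Q2 * h powr \<delta> \<le> 1 / 2" by (simp_all add: distrib_right)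
  have sol: "\<exists>x. x a = \<xi> \<and> davie_solution a c x"
    if ac: "0 \<le> a" "a \<le> c" "c \<le> 1" "c - a \<le> h" and \<xi>: "norm \<xi> \<le> N" for a c \<xi>
  proof -
    define ball where "ball x \<longleftrightarrow> x a = \<xi> \<and> holder_on a c 1 \<mu> x" for x :: "real \<Rightarrow> real^'m"
    have ball_bound: "norm (x s) \<le> N + 1" if "ball x" "s \<in> {a..c}" for x s
    proof -
      have "norm (x s) \<le> norm (x a) + 1 * 1 powr \<mu>"
        using that h ac unfolding ball_def by (intro holder_path_norm_le[of a c]) auto
      then show ?thesis using that \<xi> by (simp add: ball_def)
    qed
    have contraction: "holder_on a c (1 / 2 * Z) \<nu> (\<lambda>s. y\<^sub>1 s - y\<^sub>2 s)"
      if "ball x\<^sub>1" "ball x\<^sub>2" "picard_image a c x\<^sub>1 y\<^sub>1" "picard_image a c x\<^sub>2 y\<^sub>2"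
        "holder_on a c Z \<nu> (\<lambda>s. x\<^sub>1 s - x\<^sub>2 s)" "0 \<le> Z" for x\<^sub>1 x\<^sub>2 y\<^sub>1 y\<^sub>2 Z
    proof -
      have "holder_on a c ((L + M * G + sew * E * G) * h powr \<delta> * Z) \<nu> (\<lambda>s. y\<^sub>1 s - y\<^sub>2 s)"
        using that N ball_bound unfolding ball_def
        by (intro difference_estimate[OF ac h(2) _ _ _ _ _ _ _ _ _ _ _ E_def, of x\<^sub>1 x\<^sub>2]) auto
      then show ?thesis
        by (rule holder_on_mono) (use mult_right_mono[OF Qh(2) that(6)] in \<open>simp add: Q2_def\<close>)
    qed
    have "\<exists>X. \<forall>n. ball (X n) \<and> picard_image a c (X n) (X (Suc n))"
    proof (rule dependent_nat_choice)
      show "\<exists>x. ball x"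
        by (rule exI[of _ "\<lambda>_. \<xi>"]) (auto simp: ball_def holder_on_def)
      fix x and n :: nat assume x: "ball x"
      then obtain y where y: "y a = \<xi>" "picard_image a c x y"
        using picard_image_exists[OF ac(1-3), of 1 x \<xi>] unfolding ball_def by auto
      have "holder_on a c ((1 + norm (x a) + 1 * h powr \<mu>) *
          (L * h powr (1 - \<mu>) + diffusion_const * G * h powr \<delta>)) \<mu> y"
        using x y by (intro increment_estimate[OF ac h(2)]) (auto simp: ball_def)
      moreover have "(1 + norm (x a) + 1 * h powr \<mu>) *
          (L * h powr (1 - \<mu>) + diffusion_const * G * h powr \<delta>) \<le> 1"
      proof -
        have "h powr (1 - \<mu>) \<le> h powr \<delta>" using h \<delta> by (intro powr_mono') auto
        moreover have "h powr \<mu> \<le> 1" using h \<mu> by (intro powr_le1) auto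
        ultimately have 1: "1 + norm (x a) + 1 * h powr \<mu> \<le> 2 + N"
          and 2: "L * h powr (1 - \<mu>) + diffusion_const * G * h powr \<delta> \<le> L * h powr \<delta> + diffusion_const * G * h powr \<delta>"
          using x \<xi> L_pos by (simp_all add: ball_def)
        have "(1 + norm (x a) + 1 * h powr \<mu>) * (L * h powr (1 - \<mu>) + diffusion_const * G * h powr \<delta>)
            \<le> (2 + N) * (L * h powr \<delta> + diffusion_const * G * h powr \<delta>)"
          using 1 2 L_pos diffusion_const_nonneg Q G N by (intro mult_mono) auto
        also have "\<dots> = Q1 * h powr \<delta>" by (simp add: Q1_def algebra_simps)
        finally show ?thesis using Qh(1) by simp
      qed
      ultimately have "ball y" using y(1) by (auto simp: ball_def intro: holder_on_mono)
      with y show "\<exists>y. ball y \<and> picard_image a c x y" by blast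
    qed
    then obtain X where X: "\<And>n. ball (X n)" "\<And>n. picard_image a c (X n) (X (Suc n))" by blast
    have step: "holder_on a c ((1 / 2) ^ n * 2) \<nu> (\<lambda>s. X (Suc n) s - X n s)" for n
    proof (induction n)
      case 0
      have "holder_on a c 1 \<nu> (X n)" for n
        using X(1)[of n] ac h \<nu> unfolding ball_def by (auto intro: holder_on_lower_exponent_unit)
      from holder_on_diff[OF this this] show ?case by simp
    next
      case (Suc n)
      have "holder_on a c (1 / 2 * ((1 / 2) ^ n * 2)) \<nu> (\<lambda>s. X (Suc (Suc n)) s - X (Suc n) s)"
        by (intro contraction[OF X(1) X(1) X(2) X(2) Suc]) simp
      then show ?case by (simp add: mult_ac)
    qed
    \<comment> \<open>the induction on \<open>m\<close> needs the exact partial sums of the geometric series\<close>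
    have tail: "norm ((X (n + m) v - X n v) - (X (n + m) u - X n u)) \<le> 4 * (1 / 2) ^ n * (v - u) powr \<nu>"
      if uv: "a \<le> u" "u \<le> v" "v \<le> c" for n m u v
    proof -
      have "norm ((X (n + m) v - X n v) - (X (n + m) u - X n u))
          \<le> 4 * ((1 / 2) ^ n - (1 / 2) ^ (n + m)) * (v - u) powr \<nu>"
      proof (induction m)
        case (Suc m)
        have "(X (n + Suc m) v - X n v) - (X (n + Suc m) u - X n u)
            = ((X (n + m) v - X n v) - (X (n + m) u - X n u))
              + ((X (Suc (n + m)) v - X (n + m) v) - (X (Suc (n + m)) u - X (n + m) u))" by simp
        also have "norm \<dots> \<le> 4 * ((1 / 2) ^ n - (1 / 2) ^ (n + m)) * (v - u) powr \<nu>
            + (1 / 2) ^ (n + m) * 2 * (v - u) powr \<nu>"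
          by (intro norm_triangle_mono Suc holder_onD[OF step] uv)
        also have "\<dots> = 4 * ((1 / 2) ^ n - (1 / 2) ^ (n + Suc m)) * (v - u) powr \<nu>"
          by (simp add: algebra_simps)
        finally show ?case .
      qed simp
      also have "\<dots> \<le> 4 * (1 / 2) ^ n * (v - u) powr \<nu>" by (intro mult_right_mono) auto
      finally show ?thesis .
    qed
    have conv: "convergent (\<lambda>n. X n s)" if s: "s \<in> {a..c}" for s
    proof -
      have bound: "norm (X (Suc n) s - X n s) \<le> 2 * (1 / 2) ^ n" for n
      proof -
        have "norm (X (Suc n) s - X n s) \<le> (1 / 2) ^ n * 2 * (s - a) powr \<nu>"
          using holder_onD[OF step, of a s n] s X(1) by (auto simp: ball_def)
        also have "\<dots> \<le> (1 / 2) ^ n * 2 * 1" using s ac \<nu> \<mu> by (intro mult_left_mono powr_le1) auto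
        finally show ?thesis by simp
      qed
      have "summable (\<lambda>n. 2 * (1 / 2 :: real) ^ n)" by (intro summable_mult summable_geometric) simp
      then have "summable (\<lambda>n. X (Suc n) s - X n s)"
        by (rule summable_comparison_test'[OF _ bound])
      from summable_LIMSEQ[OF this] have "convergent (\<lambda>n. X n s - X 0 s)"
        by (auto simp: sum_lessThan_telescope[of "\<lambda>n. X n s"] intro: convergentI)
      then show ?thesis by (simp add: convergent_diff_const_right_iff)
    qed
    define x where "x s = lim (\<lambda>n. X n s)" for s
    have lim: "(\<lambda>n. X n s) \<longlonglongrightarrow> x s" if "s \<in> {a..c}" for s
      unfolding x_def using conv[OF that] by (rule convergent_LIMSEQ_iff[THEN iffD1])
    have x_ball: "ball x"
      unfolding ball_def
    proof (intro conjI holder_onI)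
      have "(\<lambda>n. X n a) \<longlonglongrightarrow> \<xi>" using X(1) by (simp add: ball_def)
      then show "x a = \<xi>" unfolding x_def by (rule limI)
      fix u v assume uv: "a \<le> u" "u \<le> v" "v \<le> c"
      have "(\<lambda>n. norm (X n v - X n u)) \<longlonglongrightarrow> norm (x v - x u)"
        using uv by (intro tendsto_intros lim) auto
      moreover have "norm (X n v - X n u) \<le> 1 * (v - u) powr \<mu>" for n
        using X(1)[of n] uv unfolding ball_def by (auto dest: holder_onD)
      ultimately show "norm (x v - x u) \<le> 1 * (v - u) powr \<mu>" by (intro LIMSEQ_le_const2) auto
    qed
    have x_close: "holder_on a c (4 * (1 / 2) ^ n) \<nu> (\<lambda>s. x s - X n s)" for n
    proof (rule holder_onI)
      fix u v assume uv: "a \<le> u" "u \<le> v" "v \<le> c"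
      have "(\<lambda>m. X (n + m) s) \<longlonglongrightarrow> x s" if "s \<in> {a..c}" for s
        using LIMSEQ_ignore_initial_segment[OF lim[OF that], of n] by (simp add: add.commute)
      then have "(\<lambda>m. norm ((X (n + m) v - X n v) - (X (n + m) u - X n u))) \<longlonglongrightarrow> norm ((x v - X n v) - (x u - X n u))"
        using uv by (intro tendsto_intros) auto
      then show "norm ((x v - X n v) - (x u - X n u)) \<le> 4 * (1 / 2) ^ n * (v - u) powr \<nu>"
        using tail[OF uv] by (intro LIMSEQ_le_const2) auto
    qed
    obtain y where y: "y a = \<xi>" "picard_image a c x y"
      using picard_image_exists[OF ac(1-3), of 1 x \<xi>] x_ball unfolding ball_def by auto
    have "y s = x s" if s: "s \<in> {a..c}" for s
    proof -
      have bound: "norm (y s - X (Suc n) s) \<le> 2 * (1 / 2) ^ n" for n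
      proof -
        have "holder_on a c (1 / 2 * (4 * (1 / 2) ^ n)) \<nu> (\<lambda>s. y s - X (Suc n) s)"
          by (intro contraction[OF x_ball X(1) y(2) X(2) x_close]) simp
        from holder_onD[OF this, of a s] have "norm (y s - X (Suc n) s) \<le> 2 * (1 / 2) ^ n * (s - a) powr \<nu>"
          using s y(1) X(1) by (auto simp: ball_def)
        also have "\<dots> \<le> 2 * (1 / 2) ^ n * 1" using s ac \<nu> \<mu> by (intro mult_left_mono powr_le1) auto
        finally show ?thesis by simp
      qed
      have "(\<lambda>n. 2 * (1 / 2 :: real) ^ n) \<longlonglongrightarrow> 0"
        by (intro tendsto_mult_right_zero LIMSEQ_power_zero) simp
      then have "(\<lambda>n. y s - X (Suc n) s) \<longlonglongrightarrow> 0"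
        by (rule Lim_null_comparison[OF always_eventually[OF allI[OF bound]]])
      moreover have "(\<lambda>n. y s - X (Suc n) s) \<longlonglongrightarrow> y s - x s"
        by (intro tendsto_diff tendsto_const LIMSEQ_Suc lim s)
      ultimately have "y s - x s = 0" by (rule LIMSEQ_unique[symmetric])
      then show ?thesis by simp
    qed
    then have "picard_image a c x x" using y(2) by (intro picard_image_cong[OF y(2)]) auto
    moreover have "x a = \<xi>" "holder_on a c 1 \<mu> x" using x_ball by (auto simp: ball_def)
    ultimately show ?thesis
      unfolding davie_solution_def by (intro exI[of _ x] conjI exI[of _ "1::real"]) simp_all
  qed
  show ?thesis
  proof (intro exI[of _ h] conjI allI impI)
    fix a c :: real and \<xi> :: "real^'m"
    assume "0 \<le> a \<and> a \<le> c \<and> c \<le> 1 \<and> c - a \<le> h \<and> norm \<xi> \<le> N"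
    then show "\<exists>x. x a = \<xi> \<and> davie_solution a c x" using sol by simp
  qed (rule h)
qed

section \<open>A priori bounds and global existence\<close>

text \<open>
  The reciprocal of the length on which the seminorm of a solution absorbs itself: with
  $h$ = \<open>1 / inverse_step\<close> both \<open>L * h\<close> and \<open>diffusion_const * G * h powr \<mu>\<close> are at most
  $1/4$. The exponent $1/\mu$ is the $\kappa$ of the theorem.
\<close>

definition inverse_step :: real where
  "inverse_step = 1 + 4 * L + (4 * diffusion_const * G) powr (1 / \<mu>)"

lemma inverse_step_ge_1: "1 \<le> inverse_step"
  using L_pos by (simp add: inverse_step_def)

lemma step_small:
  defines "h \<equiv> 1 / inverse_step"
  shows "0 < h" "h \<le> 1" "L * h \<le> 1 / 4" "diffusion_const * G * h powr \<mu> \<le> 1 / 4"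
proof -
  show h: "0 < h" "h \<le> 1" using inverse_step_ge_1 by (auto simp: h_def)
  have "4 * L \<le> inverse_step" by (simp add: inverse_step_def)
  then show "L * h \<le> 1 / 4" using inverse_step_ge_1 by (simp add: h_def field_simps)
  have nonneg: "0 \<le> 4 * diffusion_const * G" using diffusion_const_nonneg G by simp
  have "4 * diffusion_const * G = ((4 * diffusion_const * G) powr (1 / \<mu>)) powr \<mu>"
    using nonneg \<mu> by (simp add: powr_powr)
  also have "\<dots> \<le> inverse_step powr \<mu>"
    using \<mu> L_pos by (intro powr_mono2) (auto simp: inverse_step_def)
  finally have "4 * diffusion_const * G * h powr \<mu> \<le> inverse_step powr \<mu> * h powr \<mu>"
    by (intro mult_right_mono) auto
  also have "\<dots> = 1"
    using inverse_step_ge_1 by (simp add: h_def powr_divide)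
  finally show "diffusion_const * G * h powr \<mu> \<le> 1 / 4" by simp
qed

lemma davie_solution_subinterval:
  assumes "davie_solution a c x" "a \<le> a'" "c' \<le> c"
  shows "davie_solution a' c' x"
  using assms holder_on_subinterval picard_image_subinterval unfolding davie_solution_def by blast

text \<open>
  By \<open>increment_estimate\<close> with $y = x$ a Hoelder constant $C$ of $x$ may be replaced by
  $W Q + C Q h^\mu$, where $W = 1 + |x_a|$, and $Q h^\mu \le 1/2$ by the choice of $h$. So $2 W Q$ is a
  Hoelder constant, which lets $|x|$ grow by at most $2 W Q h^\mu \le W$.
\<close>

lemma apriori_local:
  assumes ac: "0 \<le> a" "a \<le> c" "c \<le> 1" "c - a \<le> 1 / inverse_step" and x: "davie_solution a c x"
  shows "holder_on a c (2 * (1 + norm (x a)) * (L + diffusion_const * G)) \<mu> x"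
    and "s \<in> {a..c} \<Longrightarrow> 1 + norm (x s) \<le> 2 * (1 + norm (x a))"
proof -
  define h where "h = 1 / inverse_step"
  define W where "W = 1 + norm (x a)"
  define Q where "Q = L * h powr (1 - \<mu>) + diffusion_const * G * h powr \<delta>"
  have h: "0 < h" "h \<le> 1" "c - a \<le> h" using step_small ac by (auto simp: h_def)
  have DG: "0 \<le> diffusion_const * G" using diffusion_const_nonneg G by simp
  have "h powr (1 - \<mu>) \<le> 1" "h powr \<delta> \<le> 1" using h \<mu> \<delta> by (auto intro!: powr_le1)
  then have "Q \<le> L * 1 + diffusion_const * G * 1"
    unfolding Q_def using L_pos DG by (intro add_mono mult_left_mono) auto
  then have Q: "0 \<le> Q" "Q \<le> L + diffusion_const * G"
    using L_pos DG by (auto simp: Q_def)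
  have Qh: "h powr \<mu> * Q \<le> 1 / 2"
  proof -
    have "h powr \<mu> * Q = L * (h powr \<mu> * h powr (1 - \<mu>)) + diffusion_const * G * (h powr \<mu> * h powr \<delta>)"
      by (simp add: Q_def algebra_simps)
    also have "h powr \<mu> * h powr (1 - \<mu>) = h" using h by (simp flip: powr_add)
    also have "diffusion_const * G * (h powr \<mu> * h powr \<delta>) \<le> diffusion_const * G * (h powr \<mu> * 1)"
      using \<open>h powr \<delta> \<le> 1\<close> DG by (intro mult_left_mono) auto
    also have "L * h + diffusion_const * G * (h powr \<mu> * 1) \<le> 1 / 4 + 1 / 4"
      using step_small unfolding h_def by (intro add_mono) auto
    finally show ?thesis by simp
  qed
  obtain R where R: "0 \<le> R" "holder_on a c R \<mu> x" and im: "picard_image a c x x"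
    using x unfolding davie_solution_def by blast
  have W: "1 \<le> W" by (simp add: W_def)
  have "holder_on a c (W * Q / (1 - 1 / 2)) \<mu> x"
  proof (rule holder_on_self_improving[OF R(2,1)])
    fix C assume C: "0 \<le> C" "holder_on a c C \<mu> x"
    have "holder_on a c ((W + C * h powr \<mu>) * Q) \<mu> x"
      using increment_estimate[OF ac(1-3) h(3,2) C(2,1) im] by (simp add: W_def Q_def)
    moreover have "(W + C * h powr \<mu>) * Q \<le> W * Q + 1 / 2 * C"
      using mult_left_mono[OF Qh C(1)] by (simp add: algebra_simps)
    ultimately show "holder_on a c (W * Q + 1 / 2 * C) \<mu> x" by (rule holder_on_mono)
  qed (use W Q in auto)
  then have holder: "holder_on a c (2 * W * Q) \<mu> x" by (simp add: mult_ac)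
  moreover have "2 * W * Q \<le> 2 * W * (L + diffusion_const * G)"
    using W Q by (intro mult_left_mono) auto
  ultimately show "holder_on a c (2 * (1 + norm (x a)) * (L + diffusion_const * G)) \<mu> x"
    unfolding W_def by (rule holder_on_mono)
  assume s: "s \<in> {a..c}"
  have "0 \<le> 2 * W * Q" using W Q by simp
  from holder_path_norm_le[OF holder this s h(3)]
  have "1 + norm (x s) \<le> W + 2 * W * (h powr \<mu> * Q)" by (simp add: W_def mult_ac)
  also have "\<dots> \<le> W + 2 * W * (1 / 2)" using Qh W by (intro add_left_mono mult_left_mono) auto
  also have "\<dots> = 2 * W" by simp
  finally show "1 + norm (x s) \<le> 2 * (1 + norm (x a))" unfolding W_def .
qed

lemma apriori_sup:
  assumes T: "0 \<le> T" "T \<le> 1" and x: "davie_solution 0 T x" and t: "t \<in> {0..T}"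
  shows "1 + norm (x t) \<le> exp (1 + inverse_step) * (1 + norm (x 0))"
proof -
  define h where "h = 1 / inverse_step"
  have h: "0 < h" "h \<le> 1" using step_small by (auto simp: h_def)
  have bound: "\<forall>s\<in>{0..min T (real k * h)}. 1 + norm (x s) \<le> 2 ^ k * (1 + norm (x 0))" for k
  proof (induction k)
    case 0
    then show ?case using T by simp
  next
    case (Suc k)
    define a where "a = min T (real k * h)"
    define c where "c = min T (real (Suc k) * h)"
    have ac: "0 \<le> a" "a \<le> c" "c \<le> T" "c - a \<le> h"
      using h T by (auto simp: a_def c_def algebra_simps min_def)
    have xa: "1 + norm (x a) \<le> 2 ^ k * (1 + norm (x 0))" using Suc ac unfolding a_def[symmetric] by simp
    have "1 + norm (x s) \<le> 2 ^ Suc k * (1 + norm (x 0))" if s: "s \<in> {0..c}" for s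
    proof (cases "s \<le> a")
      case True
      then have "1 + norm (x s) \<le> 2 ^ k * (1 + norm (x 0))" using Suc s unfolding a_def[symmetric] by simp
      also have "\<dots> \<le> 2 ^ Suc k * (1 + norm (x 0))" by (intro mult_right_mono) auto
      finally show ?thesis .
    next
      case False
      have "davie_solution a c x" using x ac by (intro davie_solution_subinterval[OF x]) auto
      then have "1 + norm (x s) \<le> 2 * (1 + norm (x a))"
        using ac T s False unfolding h_def by (intro apriori_local(2)[of a c]) auto
      then show ?thesis using xa by simp
    qed
    then show ?case unfolding c_def by blast
  qed
  define n where "n = nat \<lceil>inverse_step\<rceil>"
  have n: "inverse_step \<le> real n" "real n \<le> 1 + inverse_step"
    using inverse_step_ge_1 unfolding n_def by linarith+
  have "1 \<le> real n * h" using n(1) inverse_step_ge_1 by (simp add: h_def)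
  then have "min T (real n * h) = T" using T by simp
  then have "1 + norm (x t) \<le> 2 ^ n * (1 + norm (x 0))" using bound[of n] t by simp
  also have "(2::real) ^ n \<le> exp 1 ^ n" using exp_ge_add_one_self[of 1] by (intro power_mono) auto
  also have "exp 1 ^ n = exp (real n)" by (simp flip: exp_of_nat_mult)
  also have "exp (real n) \<le> exp (1 + inverse_step)" using n(2) by simp
  finally show ?thesis by (simp add: mult_right_mono)
qed

text \<open>
  Increments over at most one time step are covered by \<open>apriori_local\<close> started at the left end
  point; longer ones are bounded by twice the supremum, at the cost of a factor \<open>inverse_step\<close>.
\<close>

lemma apriori_holder:
  assumes T: "0 \<le> T" "T \<le> 1" and x: "davie_solution 0 T x"
  shows "holder_on 0 T (exp (1 + inverse_step) * (1 + norm (x 0)) *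
           (2 * (L + diffusion_const * G) + 2 * inverse_step)) \<mu> x"
proof (rule holder_onI)
  fix u v assume uv: "0 \<le> u" "u \<le> v" "v \<le> T"
  define B where "B = exp (1 + inverse_step) * (1 + norm (x 0))"
  have B: "0 \<le> B" by (simp add: B_def)
  have sup: "1 + norm (x t) \<le> B" if "t \<in> {0..T}" for t
    unfolding B_def by (rule apriori_sup[OF T x that])
  have DG: "0 \<le> L + diffusion_const * G" using diffusion_const_nonneg G L_pos by simp
  have "norm (x v - x u) \<le> B * (2 * (L + diffusion_const * G) + 2 * inverse_step) * (v - u) powr \<mu>"
  proof (cases "v - u \<le> 1 / inverse_step")
    case True
    have "davie_solution u v x" using uv by (intro davie_solution_subinterval[OF x]) auto
    then have "holder_on u v (2 * (1 + norm (x u)) * (L + diffusion_const * G)) \<mu> x"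
      using uv T True by (intro apriori_local(1)) auto
    then have "norm (x v - x u) \<le> 2 * (1 + norm (x u)) * (L + diffusion_const * G) * (v - u) powr \<mu>"
      using uv by (auto dest: holder_onD)
    also have "\<dots> \<le> 2 * B * (L + diffusion_const * G) * (v - u) powr \<mu>"
      using sup[of u] uv DG by (intro mult_right_mono mult_left_mono) auto
    also have "\<dots> \<le> B * (2 * (L + diffusion_const * G) + 2 * inverse_step) * (v - u) powr \<mu>"
      using B inverse_step_ge_1 by (intro mult_right_mono) (auto simp: algebra_simps)
    finally show ?thesis .
  next
    case False
    have "1 / inverse_step = (1 / inverse_step) powr 1" using inverse_step_ge_1 by simp
    also have "\<dots> \<le> (1 / inverse_step) powr \<mu>"
      using inverse_step_ge_1 \<mu> by (intro powr_mono') auto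
    also have "\<dots> \<le> (v - u) powr \<mu>" using False \<mu> inverse_step_ge_1 by (intro powr_mono2) auto
    finally have 1: "1 \<le> inverse_step * (v - u) powr \<mu>"
      using inverse_step_ge_1 by (simp add: field_simps)
    have "norm (x v - x u) \<le> norm (x v) + norm (x u)" by (rule norm_triangle_ineq4)
    also have "\<dots> \<le> 2 * B * 1" using sup[of u] sup[of v] uv by simp
    also have "\<dots> \<le> 2 * B * (inverse_step * (v - u) powr \<mu>)" using 1 B by (intro mult_left_mono) auto
    also have "\<dots> \<le> B * (2 * (L + diffusion_const * G) + 2 * inverse_step) * (v - u) powr \<mu>"
    proof -
      have "0 \<le> B * (2 * (L + diffusion_const * G)) * (v - u) powr \<mu>" using B DG by simp
      then show ?thesis by (simp add: algebra_simps)
    qed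
    finally show ?thesis .
  qed
  then show "norm (x v - x u) \<le> exp (1 + inverse_step) * (1 + norm (x 0)) *
      (2 * (L + diffusion_const * G) + 2 * inverse_step) * (v - u) powr \<mu>" by (simp only: B_def)
qed

text \<open>
  The remainder over an interval across the junction $c$ is the sum of the remainders on both sides
  and of the defect of $\sigma(v,z_v)(g_v - g_u)$ at $c$, which is of the right order because the
  concatenated path is Hoelder.
\<close>

lemma davie_solution_concat:
  assumes acd: "0 \<le> a" "a \<le> c" "c \<le> d" "d \<le> 1" and x: "davie_solution a c x" and y: "davie_solution c d y"
    and "x c = y c"
  shows "davie_solution a d (\<lambda>s. if s \<le> c then x s else y s)"
proof -
  define z where "z s = (if s \<le> c then x s else y s)" for s
  have zx: "z s = x s" if "s \<in> {a..c}" for s using that by (simp add: z_def)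
  have zy: "z s = y s" if "s \<in> {c..d}" for s using that \<open>x c = y c\<close> by (auto simp: z_def)
  obtain R1 where R1: "0 \<le> R1" "holder_on a c R1 \<mu> x" using x unfolding davie_solution_def by blast
  obtain R2 where R2: "0 \<le> R2" "holder_on c d R2 \<mu> y" using y unfolding davie_solution_def by blast
  define R where "R = R1 + R2"
  have R: "0 \<le> R" using R1 R2 by (simp add: R_def)
  have left: "norm (z v - z u) \<le> R1 * (v - u) powr \<mu>" if "a \<le> u" "u \<le> v" "v \<le> c" for u v
    using holder_onD[OF R1(2) that] zx that by simp
  have right: "norm (z v - z u) \<le> R2 * (v - u) powr \<mu>" if "c \<le> u" "u \<le> v" "v \<le> d" for u v
    using holder_onD[OF R2(2) that] zy that by simp
  have holder: "holder_on a d R \<mu> z"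
  proof (rule holder_onI)
    fix u v assume uv: "a \<le> u" "u \<le> v" "v \<le> d"
    have R12: "R1 * (v - u) powr \<mu> \<le> R * (v - u) powr \<mu>" "R2 * (v - u) powr \<mu> \<le> R * (v - u) powr \<mu>"
      using R1 R2 by (auto simp: R_def intro!: mult_right_mono)
    consider "v \<le> c" | "c \<le> u" | "u < c" "c < v" by linarith
    then show "norm (z v - z u) \<le> R * (v - u) powr \<mu>"
    proof cases
      case 3
      have "norm (z v - z u) \<le> norm (z v - z c) + norm (z c - z u)"
        using norm_triangle_ineq[of "z v - z c" "z c - z u"] by simp
      also have "\<dots> \<le> R2 * (v - c) powr \<mu> + R1 * (c - u) powr \<mu>"
        using 3 uv by (intro add_mono left right) auto
      also have "\<dots> \<le> R2 * (v - u) powr \<mu> + R1 * (v - u) powr \<mu>"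
        using 3 uv R1 R2 \<mu> by (intro add_mono mult_left_mono powr_mono2) auto
      finally show ?thesis by (simp add: R_def algebra_simps)
    qed (use left[of u v] right[of u v] uv R12 in auto)
  qed
  have zl: "picard_image a c z z"
    using x zx unfolding davie_solution_def by (auto intro: picard_image_cong[of a c x x])
  have zr: "picard_image c d z z"
    using y zy unfolding davie_solution_def by (auto intro: picard_image_cong[of c d y y])
  let ?rem = "\<lambda>u v. z v - z u - integral {u..v} (\<lambda>s. b s (z s)) - \<sigma> v (z v) *v (g v - g u)"
  obtain C1 where C1: "0 \<le> C1" "\<And>u v. a \<le> u \<Longrightarrow> u \<le> v \<Longrightarrow> v \<le> c \<Longrightarrow> norm (?rem u v) \<le> C1 * (v - u) powr \<theta>"
    by (rule picard_imageE[OF zl]) (rule that)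
  obtain C2 where C2: "0 \<le> C2" "\<And>u v. c \<le> u \<Longrightarrow> u \<le> v \<Longrightarrow> v \<le> d \<Longrightarrow> norm (?rem u v) \<le> C2 * (v - u) powr \<theta>"
    by (rule picard_imageE[OF zr]) (rule that)
  define K where "K = M + M * R * 1 powr (\<mu> - \<nu>)"
  have K: "0 \<le> K" using M_pos R by (simp add: K_def)
  have ad: "a \<le> d" "d - a \<le> 1" using acd by auto
  have \<Xi>: "almost_additive a d (K * G) \<theta> (\<lambda>u v. \<sigma> v (z v) *v (g v - g u))"
    using young_almost_additive_on[OF acd(1,4) diffusion_holder[OF acd(1,4) ad(2) holder R]] K
    by (simp add: K_def)
  have cont: "continuous_on {a..d} z" using holder \<mu>(1) by (rule holder_on_imp_continuous_on)
  have "norm (?rem u v) \<le> (C1 + C2 + K * G) * (v - u) powr \<theta>" if uv: "a \<le> u" "u \<le> v" "v \<le> d" for u v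
  proof -
    have KG: "0 \<le> K * G" using K G by simp
    consider "v \<le> c" | "c \<le> u" | "u < c" "c < v" by linarith
    then show ?thesis
    proof cases
      case 1
      have "C1 * (v - u) powr \<theta> \<le> (C1 + C2 + K * G) * (v - u) powr \<theta>"
        using C1 C2 KG by (intro mult_right_mono) auto
      with C1(2)[OF uv(1,2) 1] show ?thesis by (rule order_trans)
    next
      case 2
      have "C2 * (v - u) powr \<theta> \<le> (C1 + C2 + K * G) * (v - u) powr \<theta>"
        using C1 C2 KG by (intro mult_right_mono) auto
      with C2(2)[OF 2 uv(2,3)] show ?thesis by (rule order_trans)
    next
      case 3
      have int: "integral {u..v} (\<lambda>s. b s (z s)) = integral {u..c} (\<lambda>s. b s (z s)) + integral {c..v} (\<lambda>s. b s (z s))"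
        using drift_integral_combine[OF acd(1) ad(1) acd(4) cont, of u v] drift_integral_combine[OF acd(1) ad(1) acd(4) cont, of u c]
          drift_integral_combine[OF acd(1) ad(1) acd(4) cont, of c v] 3 uv acd by (simp add: algebra_simps)
      have "?rem u v = ?rem u c + ?rem c v - (\<sigma> v (z v) *v (g v - g u) - \<sigma> c (z c) *v (g c - g u) - \<sigma> v (z v) *v (g v - g c))"
        by (simp add: int algebra_simps)
      also have "norm \<dots> \<le> C1 * (c - u) powr \<theta> + C2 * (v - c) powr \<theta> + K * G * (v - u) powr \<theta>"
        using 3 uv acd by (intro order_trans[OF norm_triangle_ineq4] add_mono order_trans[OF norm_triangle_ineq]
            C1(2) C2(2) almost_additiveD(2)[OF \<Xi>]) auto
      also have "\<dots> \<le> C1 * (v - u) powr \<theta> + C2 * (v - u) powr \<theta> + K * G * (v - u) powr \<theta>"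
        using 3 uv C1 C2 theta_gt_1 by (intro add_mono mult_left_mono powr_mono2 order_refl) auto
      finally show ?thesis by (simp add: algebra_simps)
    qed
  qed
  then have "picard_image a d z z" unfolding picard_image_def by (intro exI[of _ "C1 + C2 + K * G"]) simp
  then have "davie_solution a d z"
    unfolding davie_solution_def using R holder by blast
  then show ?thesis unfolding z_def .
qed

theorem davie_solution_exists:
  "\<exists>x. x 0 = \<xi> \<and> davie_solution 0 1 x"
proof -
  define N where "N = exp (1 + inverse_step) * (1 + norm \<xi>)"
  have N: "0 < N" by (simp add: N_def add_pos_nonneg)
  obtain h where h: "0 < h" and loc: "\<And>a c \<eta>. 0 \<le> a \<Longrightarrow> a \<le> c \<Longrightarrow> c \<le> 1 \<Longrightarrow> c - a \<le> h \<Longrightarrow> norm \<eta> \<le> N \<Longrightarrow>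
      \<exists>x. x a = \<eta> \<and> davie_solution a c x"
    using local_solution_exists[OF N] by auto
  have ex: "\<exists>x. x 0 = \<xi> \<and> davie_solution 0 (min 1 (real k * h)) x" for k
  proof (induction k)
    case 0
    have "1 * (1 + norm \<xi>) \<le> exp (1 + inverse_step) * (1 + norm \<xi>)"
      using inverse_step_ge_1 by (intro mult_right_mono) auto
    then have "norm \<xi> \<le> N" by (simp add: N_def)
    then show ?case using loc[of 0 0 \<xi>] h by simp
  next
    case (Suc k)
    define a where "a = min 1 (real k * h)"
    define c where "c = min 1 (real (Suc k) * h)"
    have ac: "0 \<le> a" "a \<le> c" "c \<le> 1" "c - a \<le> h"
      using h by (auto simp: a_def c_def algebra_simps min_def)
    obtain x where x: "x 0 = \<xi>" "davie_solution 0 a x" using Suc unfolding a_def by blast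
    have "1 + norm (x a) \<le> N"
      unfolding N_def x(1)[symmetric] using ac by (intro apriori_sup[of a] x(2)) auto
    then obtain y where y: "y a = x a" "davie_solution a c y" using loc[OF ac, of "x a"] by auto
    have "davie_solution 0 c (\<lambda>s. if s \<le> a then x s else y s)"
      using ac x y by (intro davie_solution_concat) auto
    moreover have "(if 0 \<le> a then x 0 else y 0) = \<xi>" using ac x by simp
    ultimately show ?case
      unfolding c_def by (intro exI[of _ "\<lambda>s. if s \<le> a then x s else y s"] conjI) 
  qed
  obtain k :: nat where "1 / h < k" using reals_Archimedean2 by blast
  then have "min 1 (real k * h) = 1" using h by (simp add: field_simps min_def)
  then show ?thesis using ex[of k] by simp
qed

section \<open>Davie solutions and solutions of the integral equation\<close>

text \<open>
  Removing the drift from a Picard image leaves the path that represents the Riemann--Stieltjes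
  integral.
\<close>

lemma picard_image_path:
  assumes x: "holder_on 0 1 R \<mu> x" "0 \<le> R" and y: "picard_image 0 1 x y"
    and Y_def: "\<And>v. Y v = y v - integral {0..v} (\<lambda>s. b s (x s))"
  obtains C where "0 \<le> C" "\<And>u v. 0 \<le> u \<Longrightarrow> u \<le> v \<Longrightarrow> v \<le> 1 \<Longrightarrow>
      norm (Y v - Y u - \<sigma> v (x v) *v (g v - g u)) \<le> C * (v - u) powr \<theta>"
proof -
  have cont: "continuous_on {0..1} x" using x(1) \<mu>(1) by (rule holder_on_imp_continuous_on)
  obtain C where C: "0 \<le> C" "\<And>u v. 0 \<le> u \<Longrightarrow> u \<le> v \<Longrightarrow> v \<le> 1 \<Longrightarrow>
      norm (y v - y u - integral {u..v} (\<lambda>s. b s (x s)) - \<sigma> v (x v) *v (g v - g u)) \<le> C * (v - u) powr \<theta>"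
    by (rule picard_imageE[OF y]) (rule that)
  show thesis
  proof (rule that[OF C(1)])
    fix u v :: real assume uv: "0 \<le> u" "u \<le> v" "v \<le> 1"
    have "Y v - Y u = y v - y u - integral {u..v} (\<lambda>s. b s (x s))"
      using drift_integral_combine[of 0 1 x u v] cont uv by (simp add: Y_def algebra_simps)
    then show "norm (Y v - Y u - \<sigma> v (x v) *v (g v - g u)) \<le> C * (v - u) powr \<theta>"
      using C(2)[OF uv] by simp
  qed
qed

lemma davie_solution_imp_is_solution:
  assumes x: "davie_solution 0 1 x"
  shows "is_solution b \<sigma> g (x 0) x"
  unfolding is_solution_def
proof (intro ballI conjI)
  fix t :: real assume t: "t \<in> {0..1}"
  obtain R where R: "holder_on 0 1 R \<mu> x" "0 \<le> R" and im: "picard_image 0 1 x x"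
    using x unfolding davie_solution_def by blast
  have cont: "continuous_on {0..1} x" using R(1) \<mu>(1) by (rule holder_on_imp_continuous_on)
  then have cont_t: "continuous_on {0..t} x" using t by (auto elim: continuous_on_subset)
  show int: "set_integrable lebesgue {0..t} (\<lambda>s. b s (x s))"
    using t cont_t by (intro drift_absolutely_integrable) auto
  define Y where "Y v = x v - integral {0..v} (\<lambda>s. b s (x s))" for v
  obtain C where C: "0 \<le> C" "\<And>u v. 0 \<le> u \<Longrightarrow> u \<le> v \<Longrightarrow> v \<le> 1 \<Longrightarrow>
      norm (Y v - Y u - \<sigma> v (x v) *v (g v - g u)) \<le> C * (v - u) powr \<theta>"
    by (rule picard_image_path[OF R im Y_def]) (rule that)
  have K: "0 \<le> M + M * R * 1 powr (\<mu> - \<nu>)" using M_pos R by simp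
  have F: "holder_on 0 1 (M + M * R * 1 powr (\<mu> - \<nu>)) \<nu> (\<lambda>s. \<sigma> s (x s))"
    using R by (intro diffusion_holder) auto
  have "has_RS_integral (\<lambda>s. \<sigma> s (x s)) g (Y t - Y 0) 0 t"
  proof (rule has_RS_integral_path_increment[OF _ _ _ C(1) K G])
    fix u v assume uv: "0 \<le> u" "u \<le> v" "v \<le> t"
    then show "norm (Y v - Y u - \<sigma> v (x v) *v (g v - g u)) \<le> C * (v - u) powr \<theta>" using t by (intro C) auto
  next
    show "holder_on 0 t (M + M * R * 1 powr (\<mu> - \<nu>)) \<nu> (\<lambda>s. \<sigma> s (x s))"
      by (rule holder_on_subinterval[OF F]) (use t in auto)
    show "holder_on 0 t G (\<mu> + \<delta>) g"
      by (rule holder_on_subinterval[OF g]) (use t in auto)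
  qed (use \<nu> \<mu> \<delta> t in auto)
  moreover have "x t = x 0 + (LINT s:{0..t}|lebesgue. b s (x s)) + (Y t - Y 0)"
    by (simp add: set_lebesgue_integral_eq_integral(2)[OF int] Y_def)
  ultimately show "\<exists>J. has_RS_integral (\<lambda>s. \<sigma> s (x s)) g J 0 t \<and>
      x t = x 0 + (LINT s:{0..t}|lebesgue. b s (x s)) + J" by blast
qed

lemma is_solution_eq_path:
  assumes x: "is_solution b \<sigma> g \<xi> x" and t: "t \<in> {0..1}"
    and Y: "\<And>u v. 0 \<le> u \<Longrightarrow> u \<le> v \<Longrightarrow> v \<le> 1 \<Longrightarrow>
      norm (Y v - Y u - \<sigma> v (x v) *v (g v - g u)) \<le> C * (v - u) powr p" and "1 < p" "0 \<le> C"
  shows "x t = \<xi> + integral {0..t} (\<lambda>s. b s (x s)) + (Y t - Y 0)"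
proof -
  from x t obtain J where int: "set_integrable lebesgue {0..t} (\<lambda>s. b s (x s))"
    and J: "has_RS_integral (\<lambda>s. \<sigma> s (x s)) g J 0 t"
    and xt: "x t = \<xi> + (LINT s:{0..t}|lebesgue. b s (x s)) + J"
    unfolding is_solution_def by blast
  have "J = Y t - Y 0"
    using J _ \<open>1 < p\<close> \<open>0 \<le> C\<close>
  proof (rule has_RS_integral_eq_path_increment)
    show "norm (Y v - Y u - \<sigma> v (x v) *v (g v - g u)) \<le> C * (v - u) powr p" if "0 \<le> u" "u \<le> v" "v \<le> t" for u v
      using that t by (intro Y) auto
  qed (use t in simp)
  then show ?thesis using xt set_lebesgue_integral_eq_integral(2)[OF int] by simp
qed

text \<open>
  The bootstrap of regularity: $x$, and with it $\sigma(\cdot,x)$, is $(1-\mu)$-Hoelder on $(0,1]$, and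
  $(1-\mu) + (\mu+\delta) > 1$. So the integral is a sewn path, whose increments are of order
  $(v-u)^{\mu+\delta}$ on all of $[0,1]$.
\<close>

lemma W0_solution_holder:
  assumes W: "x \<in> W0 (1 - \<mu>)" and x: "is_solution b \<sigma> g \<xi> x"
  obtains R where "0 \<le> R" "holder_on 0 1 R \<mu> x"
proof -
  have \<alpha>: "0 < 1 - \<mu>" using \<mu> by simp
  obtain C where C: "0 \<le> C" "\<And>t. t \<in> {0..1} \<Longrightarrow> norm (x t) \<le> C"
    "\<And>u v. 0 < u \<Longrightarrow> u \<le> v \<Longrightarrow> v \<le> 1 \<Longrightarrow> norm (x v - x u) \<le> C * (v - u) powr (1 - \<mu>)"
    by (rule W0_imp_holder_right_of_0[OF W \<alpha>]) (rule that)
  have K: "0 \<le> M + M * C" using M_pos C by simp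
  have \<Xi>: "almost_additive 0 1 ((M + M * C) * G) (1 - \<mu> + (\<mu> + \<delta>)) (\<lambda>u v. \<sigma> v (x v) *v (g v - g u))"
  proof (rule young_almost_additive[OF _ g K G])
    fix u v :: real assume uv: "0 < u" "u \<le> v" "v \<le> 1"
    have "norm (\<sigma> v (x v) - \<sigma> u (x u)) \<le> M * (v - u) powr lam + M * norm (x v - x u)"
      using sigma_increment[OF sigma, of u v "x v" "x u"] uv by simp
    also have "\<dots> \<le> M * (v - u) powr (1 - \<mu>) + M * (C * (v - u) powr (1 - \<mu>))"
      using uv C(3)[OF uv] M_pos \<nu> by (intro add_mono mult_left_mono powr_mono') auto
    finally show "norm (\<sigma> v (x v) - \<sigma> u (x u)) \<le> (M + M * C) * (v - u) powr (1 - \<mu>)"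
      by (simp add: algebra_simps)
  qed (use \<mu> \<delta> in auto)
  have p: "1 < 1 - \<mu> + (\<mu> + \<delta>)" using \<delta> by simp
  have "0 \<le> (M + M * C) * G" using K G by simp
  from sewing_exists[OF \<Xi> p this zero_le_one] obtain Y where Y: "\<And>u v. 0 \<le> u \<Longrightarrow> u \<le> v \<Longrightarrow> v \<le> 1 \<Longrightarrow>
      norm (Y v - Y u - \<sigma> v (x v) *v (g v - g u))
        \<le> 2 * sewing_const (1 - \<mu> + (\<mu> + \<delta>)) * ((M + M * C) * G) * (v - u) powr (1 - \<mu> + (\<mu> + \<delta>))"
    by blast
  define D where "D = 2 * sewing_const (1 - \<mu> + (\<mu> + \<delta>)) * ((M + M * C) * G)"
  have D: "0 \<le> D" using sewing_const_pos[OF p] K G by (simp add: D_def)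
  define A where "A = norm (\<sigma> 0 0) + M"
  have A: "0 \<le> A" using M_pos by (simp add: A_def)
  have path: "x t = \<xi> + integral {0..t} (\<lambda>s. b s (x s)) + (Y t - Y 0)" if "t \<in> {0..1}" for t
    using x that Y p D unfolding D_def by (rule is_solution_eq_path)
  have int: "(\<lambda>s. b s (x s)) integrable_on {u..v}" if "0 \<le> u" "v \<le> 1" for u v
  proof -
    have "set_integrable lebesgue {0..1} (\<lambda>s. b s (x s))" using x unfolding is_solution_def by auto
    then show ?thesis
      using integrable_on_subinterval[OF set_lebesgue_integral_eq_integral(1), of "{0..1}" "\<lambda>s. b s (x s)" u v] that by auto
  qed
  define R where "R = L * (1 + C) + A * (1 + C) * G + D"
  have R: "0 \<le> R" using L_pos C A G D by (simp add: R_def)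
  have "holder_on 0 1 R \<mu> x"
  proof (rule holder_onI)
    fix u v :: real assume uv: "0 \<le> u" "u \<le> v" "v \<le> 1"
    let ?d = "(v - u) powr \<mu>"
    have le: "(v - u) powr q \<le> ?d" if "\<mu> \<le> q" for q using uv that by (intro powr_mono') auto
    have 1: "norm (integral {u..v} (\<lambda>s. b s (x s))) \<le> L * (1 + C) * ?d"
    proof -
      have "norm (integral {u..v} (\<lambda>s. b s (x s))) \<le> L * (1 + C) * (v - u)"
      proof (rule integral_norm_le[OF int])
        fix s assume s: "s \<in> {u..v}"
        have "norm (b s (x s)) \<le> L * (1 + norm (x s))" using s uv by (intro drift_growth) auto
        also have "\<dots> \<le> L * (1 + C)" using C(2)[of s] s uv L_pos by (intro mult_left_mono) auto
        finally show "norm (b s (x s)) \<le> L * (1 + C)" .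
      qed (use uv L_pos C in auto)
      also have "\<dots> \<le> L * (1 + C) * ?d"
        using le[of 1] uv \<mu> L_pos C(1) by (intro mult_left_mono) auto
      finally show ?thesis .
    qed
    have 2: "norm (\<sigma> v (x v) *v (g v - g u)) \<le> A * (1 + C) * (G * ?d)"
    proof -
      have "norm (\<sigma> v (x v)) \<le> A * (1 + norm (x v))"
        unfolding A_def using uv lam_pos by (intro sigma_growth[OF sigma]) auto
      also have "\<dots> \<le> A * (1 + C)" using C(2)[of v] uv A by (intro mult_left_mono) auto
      finally have s: "norm (\<sigma> v (x v)) \<le> A * (1 + C)" .
      have "norm (g v - g u) \<le> G * (v - u) powr (\<mu> + \<delta>)" using uv by (rule holder_onD[OF g])
      also have "\<dots> \<le> G * ?d" using le[of "\<mu> + \<delta>"] G \<delta> by (intro mult_left_mono) auto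
      finally show ?thesis
        using s A C(1) by (intro order_trans[OF norm_matrix_vector_mult_le] mult_mono) auto
    qed
    have 3: "norm (Y v - Y u - \<sigma> v (x v) *v (g v - g u)) \<le> D * ?d"
    proof -
      have "norm (Y v - Y u - \<sigma> v (x v) *v (g v - g u)) \<le> D * (v - u) powr (1 - \<mu> + (\<mu> + \<delta>))"
        unfolding D_def using uv by (rule Y)
      also have "\<dots> \<le> D * ?d" using le D \<mu> \<delta> by (intro mult_left_mono) auto
      finally show ?thesis .
    qed
    have "integral {0..v} (\<lambda>s. b s (x s)) - integral {0..u} (\<lambda>s. b s (x s)) = integral {u..v} (\<lambda>s. b s (x s))"
      using Henstock_Kurzweil_Integration.integral_combine[OF uv(1,2) int[of 0 v]] uv by (simp add: algebra_simps)
    then have "x v - x u = (Y v - Y u - \<sigma> v (x v) *v (g v - g u)) + \<sigma> v (x v) *v (g v - g u)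
        + integral {u..v} (\<lambda>s. b s (x s))"
      using path[of u] path[of v] uv by simp
    also have "norm \<dots> \<le> D * ?d + A * (1 + C) * (G * ?d) + L * (1 + C) * ?d"
      by (intro norm_triangle_mono 1 2 3)
    finally show "norm (x v - x u) \<le> R * ?d" by (simp add: R_def algebra_simps)
  qed
  with R show thesis by (rule that)
qed

text \<open>
  Now that $x$ is Hoelder, the Picard image of $x$ started at $\xi$ exists, and it must be $x$ itself
  because the Riemann--Stieltjes integral is unique.
\<close>

lemma W0_solution_imp_davie_solution:
  assumes W: "x \<in> W0 (1 - \<mu>)" and x: "is_solution b \<sigma> g \<xi> x"
  shows "x 0 = \<xi>" "davie_solution 0 1 x"
proof -
  obtain R where R: "0 \<le> R" "holder_on 0 1 R \<mu> x"
    by (rule W0_solution_holder[OF W x]) (rule that)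
  obtain y where y: "y 0 = \<xi>" "picard_image 0 1 x y"
    using picard_image_exists[OF _ _ _ R(2,1), of \<xi>] by auto
  define Y where "Y v = y v - integral {0..v} (\<lambda>s. b s (x s))" for v
  obtain C where C: "0 \<le> C" "\<And>u v. 0 \<le> u \<Longrightarrow> u \<le> v \<Longrightarrow> v \<le> 1 \<Longrightarrow>
      norm (Y v - Y u - \<sigma> v (x v) *v (g v - g u)) \<le> C * (v - u) powr \<theta>"
    by (rule picard_image_path[OF R(2,1) y(2) Y_def]) (rule that)
  have eq: "x t = y t" if "t \<in> {0..1}" for t
    using is_solution_eq_path[OF x that C(2) theta_gt_1 C(1)] y(1) by (simp add: Y_def)
  then show "x 0 = \<xi>" using y(1) by simp
  have "picard_image 0 1 x x" using eq by (intro picard_image_cong[OF y(2)]) auto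
  then show "davie_solution 0 1 x" using R unfolding davie_solution_def by blast
qed

text \<open>
  The constants depend on $\sigma$ only through $A$, hence through a bound for $|\sigma(0,0)|$, and not
  on $g$ or the initial value. The powers of $G$ hidden in \<open>inverse_step\<close> are made explicit.
\<close>

lemma davie_solution_estimates:
  fixes A :: real
  assumes x: "davie_solution 0 1 x" and A: "diffusion_const \<le> A"
  defines "C \<equiv> (4 * A) powr (1 / \<mu>)"
  shows "sup_norm x \<le> exp (2 + 4 * L) * (1 + norm (x 0)) * exp (C * G powr (1 / \<mu>))"
    and "holder_norm \<mu> x \<le> exp (2 + 4 * L) * (2 * (1 + 5 * L + A + C)) * (1 + norm (x 0)) *
           (1 + G powr (1 / \<mu>)) * (1 + G) * (1 + exp (C * G powr (1 / \<mu>)))"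
proof -
  define P where "P = G powr (1 / \<mu>)"
  have A0: "0 \<le> A" using diffusion_const_nonneg A by simp
  have P: "0 \<le> P" and C: "0 \<le> C" by (simp_all add: P_def C_def)
  have "(4 * diffusion_const * G) powr (1 / \<mu>) \<le> (4 * A * G) powr (1 / \<mu>)"
    using A A0 G \<mu> diffusion_const_nonneg by (intro powr_mono2 mult_right_mono) auto
  also have "\<dots> = C * P" using A0 G by (simp add: C_def P_def powr_mult)
  finally have step: "inverse_step \<le> 1 + 4 * L + C * P" by (simp add: inverse_step_def)
  define B where "B = exp (2 + 4 * L) * (1 + norm (x 0)) * exp (C * P)"
  have B: "exp (1 + inverse_step) * (1 + norm (x 0)) \<le> B"
  proof -
    have "exp (1 + inverse_step) \<le> exp ((2 + 4 * L) + C * P)" using step by simp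
    also have "\<dots> = exp (2 + 4 * L) * exp (C * P)" by (rule exp_add)
    finally have "exp (1 + inverse_step) * (1 + norm (x 0)) \<le> exp (2 + 4 * L) * exp (C * P) * (1 + norm (x 0))"
      by (intro mult_right_mono) auto
    then show ?thesis by (simp add: B_def mult_ac)
  qed
  show "sup_norm x \<le> exp (2 + 4 * L) * (1 + norm (x 0)) * exp (C * G powr (1 / \<mu>))"
    unfolding sup_norm_def
  proof (rule cSUP_least)
    fix t :: real assume "t \<in> {0..1}"
    then have "1 + norm (x t) \<le> B" using apriori_sup[of 1 x t] x B by simp
    then show "norm (x t) \<le> exp (2 + 4 * L) * (1 + norm (x 0)) * exp (C * G powr (1 / \<mu>))"
      by (simp add: B_def P_def)
  qed simp
  have "holder_norm \<mu> x \<le> exp (1 + inverse_step) * (1 + norm (x 0)) *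
      (2 * (L + diffusion_const * G) + 2 * inverse_step)"
    using x by (intro holder_norm_leI apriori_holder) auto
  also have "\<dots> \<le> B * (2 * (1 + 5 * L + A + C) * ((1 + P) * (1 + G)))"
  proof (rule mult_mono[OF B])
    let ?m = "(1 + P) * (1 + G)"
    have m: "1 \<le> ?m" "P \<le> ?m" "G \<le> ?m" using P G by (simp_all add: algebra_simps)
    have "L + diffusion_const * G + inverse_step \<le> 5 * L * 1 + A * G + 1 + C * P"
      using step mult_right_mono[OF A G] by simp
    also have "\<dots> \<le> 5 * L * ?m + A * ?m + ?m + C * ?m"
      using m L_pos A0 C by (intro add_mono mult_left_mono) auto
    finally show "2 * (L + diffusion_const * G) + 2 * inverse_step \<le> 2 * (1 + 5 * L + A + C) * ?m"
      by (simp add: algebra_simps)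
    show "0 \<le> B" by (simp add: B_def)
    show "0 \<le> 2 * (L + diffusion_const * G) + 2 * inverse_step"
      using L_pos diffusion_const_nonneg G inverse_step_ge_1 by simp
  qed
  also have "\<dots> = exp (2 + 4 * L) * (2 * (1 + 5 * L + A + C)) * (1 + norm (x 0)) * (1 + P) * (1 + G) * exp (C * P)"
    by (simp add: B_def mult_ac)
  also have "\<dots> \<le> exp (2 + 4 * L) * (2 * (1 + 5 * L + A + C)) * (1 + norm (x 0)) * (1 + P) * (1 + G) * (1 + exp (C * P))"
    using L_pos A0 C P G by (intro mult_left_mono) auto
  finally show "holder_norm \<mu> x \<le> exp (2 + 4 * L) * (2 * (1 + 5 * L + A + C)) * (1 + norm (x 0)) *
           (1 + G powr (1 / \<mu>)) * (1 + G) * (1 + exp (C * G powr (1 / \<mu>)))"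
    by (simp add: P_def)
qed

end

section \<open>The equation driven by a Hoelder function\<close>

text \<open>
  The condition $\alpha < \gamma/(1+\gamma)$ is equivalent to $\alpha < \gamma(1-\alpha)$, and $\delta < \alpha - (1-H)$ says
  that $1 - \alpha + \delta < H$, so that $g$ is Hoelder of this exponent.
\<close>

lemma young_equation_intro:
  assumes H: "1 / 2 < H" "H < 1"
    and sigma: "sigma_condition H M MN lam gam \<sigma>" and b: "b_condition L b"
    and g: "\<forall>\<epsilon>. 0 < \<epsilon> \<and> \<epsilon> < H \<longrightarrow> holder_continuous (H - \<epsilon>) g"
    and \<alpha>: "1 - H < \<alpha>" "\<alpha> < Min {1 / 2, lam, gam / (1 + gam)}"
    and \<delta>: "0 < \<delta>" "\<delta> < \<alpha> - (1 - H)"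
  shows "young_equation H M MN lam gam L (1 - \<alpha>) \<delta> (min lam (gam * (1 - \<alpha>)))
           (holder_norm (1 - \<alpha> + \<delta>) g) b \<sigma> g"
proof -
  have gam: "0 < gam" "gam \<le> 1"
  proof -
    have "1 < 1 / H" using H by simp
    moreover have "1 / H - 1 < gam" "gam \<le> 1" using sigma unfolding sigma_condition_def by blast+
    ultimately show "0 < gam" "gam \<le> 1" by linarith+
  qed
  have \<alpha>': "\<alpha> < 1 / 2" "\<alpha> < lam" "\<alpha> < gam / (1 + gam)" using \<alpha> by auto
  then have "\<alpha> < gam * (1 - \<alpha>)" using gam by (simp add: field_simps)
  moreover have "min lam (gam * (1 - \<alpha>)) \<le> 1 - \<alpha>"
    using mult_right_mono[of gam 1 "1 - \<alpha>"] gam \<alpha>' by (intro min.coboundedI2) simp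
  moreover have "holder_continuous (1 - \<alpha> + \<delta>) g"
  proof -
    define \<epsilon> where "\<epsilon> = H - (1 - \<alpha> + \<delta>)"
    have "0 < \<epsilon> \<and> \<epsilon> < H" using \<alpha>' \<delta> by (simp add: \<epsilon>_def)
    then have "holder_continuous (H - \<epsilon>) g" using g by blast
    moreover have "H - \<epsilon> = 1 - \<alpha> + \<delta>" by (simp add: \<epsilon>_def)
    ultimately show ?thesis by (simp only:)
  qed
  ultimately show ?thesis
    using sigma b \<alpha> \<alpha>' \<delta> H holder_on_holder_norm[of "1 - \<alpha> + \<delta>" g]
    by unfold_locales auto
qed

theorem proposition3p6:
  fixes H M lam gam L S :: real
    and MN :: "real \<Rightarrow> real"
  assumes H: "1/2 < H" "H < 1"
  shows "(\<forall>(b :: real \<Rightarrow> real^'m \<Rightarrow> real^'m) (\<sigma> :: real \<Rightarrow> real^'m \<Rightarrow> real^'d^'m) g x\<^sub>0 \<alpha>.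
            sigma_condition H M MN lam gam \<sigma> \<and> b_condition L b \<and>
            (\<forall>\<epsilon>. 0 < \<epsilon> \<and> \<epsilon> < H \<longrightarrow> holder_continuous (H - \<epsilon>) g) \<and>
            1 - H < \<alpha> \<and> \<alpha> < Min {1/2, lam, gam / (1 + gam)} \<longrightarrow>
            (\<exists>x. x \<in> W0 \<alpha> \<and> is_solution b \<sigma> g x\<^sub>0 x \<and> holder_continuous (1 - \<alpha>) x \<and>
                 (\<forall>y. y \<in> W0 \<alpha> \<and> is_solution b \<sigma> g x\<^sub>0 y \<longrightarrow> (\<forall>t\<in>{0..1}. y t = x t))))
       \<and>
         (\<forall>\<alpha> \<delta>. 1 - H < \<alpha> \<and> \<alpha> < Min {1/2, lam, gam / (1 + gam)} \<and> 0 < \<delta> \<and> \<delta> < \<alpha> - (1 - H) \<longrightarrow>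
            (\<exists>C1>0. \<exists>C2>0. \<exists>C3>0.
               \<forall>(b :: real \<Rightarrow> real^'m \<Rightarrow> real^'m) (\<sigma> :: real \<Rightarrow> real^'m \<Rightarrow> real^'d^'m) g x\<^sub>0 x.
                 sigma_condition H M MN lam gam \<sigma> \<and> b_condition L b \<and> norm (\<sigma> 0 0) \<le> S \<and>
                 (\<forall>\<epsilon>. 0 < \<epsilon> \<and> \<epsilon> < H \<longrightarrow> holder_continuous (H - \<epsilon>) g) \<and>
                 x \<in> W0 \<alpha> \<and> is_solution b \<sigma> g x\<^sub>0 x \<longrightarrow>
                 (let \<kappa> = 1 / (1 - \<alpha>); G = holder_norm (1 - \<alpha> + \<delta>) g in
                    sup_norm x \<le> C1 * (1 + norm x\<^sub>0) * exp (C2 * G powr \<kappa>) \<and>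
                    holder_norm (1 - \<alpha>) x
                      \<le> C3 * (1 + norm x\<^sub>0) * (1 + G powr \<kappa>) * (1 + G) * (1 + exp (C2 * G powr \<kappa>)))))"
proof (intro conjI allI impI, goal_cases)
  case (1 b \<sigma> g x\<^sub>0 \<alpha>)
  then have conds: "sigma_condition H M MN lam gam \<sigma>" "b_condition L b"
    "\<forall>\<epsilon>. 0 < \<epsilon> \<and> \<epsilon> < H \<longrightarrow> holder_continuous (H - \<epsilon>) g"
    "1 - H < \<alpha>" "\<alpha> < Min {1/2, lam, gam / (1 + gam)}" by blast+
  \<comment> \<open>any \<open>\<delta>\<close> strictly between \<open>0\<close> and \<open>\<alpha> - (1 - H)\<close> serves\<close>
  define \<delta> where "\<delta> = (\<alpha> - (1 - H)) / 2"
  have \<delta>: "0 < \<delta>" "\<delta> < \<alpha> - (1 - H)" using conds(4) by (simp_all add: \<delta>_def)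
  interpret young_equation H M MN lam gam L "1 - \<alpha>" \<delta> "min lam (gam * (1 - \<alpha>))"
      "holder_norm (1 - \<alpha> + \<delta>) g" b \<sigma> g
    by (rule young_equation_intro[OF H conds \<delta>])
  obtain x where x0: "x 0 = x\<^sub>0" and x: "davie_solution 0 1 x" using davie_solution_exists by blast
  obtain R where R: "0 \<le> R" "holder_on 0 1 R (1 - \<alpha>) x" using x unfolding davie_solution_def by blast
  have sym: "norm (x t - x s) \<le> R * \<bar>t - s\<bar> powr (1 - \<alpha>)" if "s \<in> {0..1}" "t \<in> {0..1}" for s t
    using R(2) that by (rule holder_on_sym)
  show ?case
  proof (intro exI[of _ x] conjI allI impI ballI)
    have "\<alpha> < 1 / 2" using conds(5) by simp
    then show "x \<in> W0 \<alpha>" using R(1) by (intro holder_imp_W0[OF R(2)]) auto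
    show "is_solution b \<sigma> g x\<^sub>0 x" using davie_solution_imp_is_solution[OF x] x0 by simp
    show "holder_continuous (1 - \<alpha>) x" unfolding holder_continuous_def using sym by (intro exI[of _ R]) simp
    fix y and t :: real assume y: "y \<in> W0 \<alpha> \<and> is_solution b \<sigma> g x\<^sub>0 y" and t: "t \<in> {0..1}"
    have "y \<in> W0 (1 - (1 - \<alpha>))" using y by simp
    note davie = W0_solution_imp_davie_solution[OF this conjunct2[OF y]]
    have "y 0 = x 0" unfolding x0 by (rule davie(1))
    then show "y t = x t" by (rule davie_solution_unique[OF davie(2) x _ t])
  qed
next
  case (2 \<alpha> \<delta>)
  then have \<alpha>: "1 - H < \<alpha>" "\<alpha> < Min {1/2, lam, gam / (1 + gam)}"
    and \<delta>: "0 < \<delta>" "\<delta> < \<alpha> - (1 - H)" by blast+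
  \<comment> \<open>absolute values and the summand \<open>1\<close> make the constants positive even if no coefficients satisfy the conditions\<close>
  define A where "A = \<bar>S\<bar> + \<bar>M\<bar> + \<bar>sewing_const (min lam (gam * (1 - \<alpha>)) + (1 - \<alpha> + \<delta>))\<bar> * \<bar>M\<bar> + 1"
  define C1 where "C1 = exp (2 + 4 * L)"
  define C2 where "C2 = (4 * A) powr (1 / (1 - \<alpha>))"
  define C3 where "C3 = exp (2 + 4 * L) * (2 * (1 + 5 * \<bar>L\<bar> + A + C2))"
  have A: "0 < A" unfolding A_def by (intro add_nonneg_pos add_nonneg_nonneg) auto
  have "0 < C1" unfolding C1_def by (rule exp_gt_zero)
  have "0 < C2" using A by (simp add: C2_def)
  have "0 < 1 + 5 * \<bar>L\<bar> + A + C2" using A \<open>0 < C2\<close> by linarith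
  then have "0 < C3" unfolding C3_def by (intro mult_pos_pos exp_gt_zero) simp_all
  show ?case
  proof (rule exI[of _ C1], rule conjI[OF \<open>0 < C1\<close>], rule exI[of _ C2], rule conjI[OF \<open>0 < C2\<close>],
      rule exI[of _ C3], rule conjI[OF \<open>0 < C3\<close>], intro allI impI)
    fix b :: "real \<Rightarrow> real^'m \<Rightarrow> real^'m" and \<sigma> :: "real \<Rightarrow> real^'m \<Rightarrow> real^'d^'m" and g x\<^sub>0 x
    assume *: "sigma_condition H M MN lam gam \<sigma> \<and> b_condition L b \<and> norm (\<sigma> 0 0) \<le> S \<and>
      (\<forall>\<epsilon>. 0 < \<epsilon> \<and> \<epsilon> < H \<longrightarrow> holder_continuous (H - \<epsilon>) g) \<and> x \<in> W0 \<alpha> \<and> is_solution b \<sigma> g x\<^sub>0 x"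
    then have conds: "sigma_condition H M MN lam gam \<sigma>" "b_condition L b"
      "\<forall>\<epsilon>. 0 < \<epsilon> \<and> \<epsilon> < H \<longrightarrow> holder_continuous (H - \<epsilon>) g" by blast+
    interpret young_equation H M MN lam gam L "1 - \<alpha>" \<delta> "min lam (gam * (1 - \<alpha>))"
        "holder_norm (1 - \<alpha> + \<delta>) g" b \<sigma> g
      by (rule young_equation_intro[OF H conds \<alpha> \<delta>])
    have "x \<in> W0 (1 - (1 - \<alpha>))" "is_solution b \<sigma> g x\<^sub>0 x" using * by simp_all
    note davie = W0_solution_imp_davie_solution[OF this]
    have "sew * M \<le> \<bar>sew\<bar> * \<bar>M\<bar>" by (simp flip: abs_mult)
    moreover have "norm (\<sigma> 0 0) \<le> S" using * by blast
    ultimately have "diffusion_const \<le> A" unfolding diffusion_const_def A_def by linarith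
    note est = davie_solution_estimates[OF davie(2) this]
    show "let \<kappa> = 1 / (1 - \<alpha>); G = holder_norm (1 - \<alpha> + \<delta>) g in
        sup_norm x \<le> C1 * (1 + norm x\<^sub>0) * exp (C2 * G powr \<kappa>) \<and>
        holder_norm (1 - \<alpha>) x
          \<le> C3 * (1 + norm x\<^sub>0) * (1 + G powr \<kappa>) * (1 + G) * (1 + exp (C2 * G powr \<kappa>))"
      unfolding Let_def using est L_pos by (simp add: C1_def C2_def C3_def davie(1))
  qed
qed

end
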